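(* There exists a constant $C$ such that for all integers $k\ge5$ and $p\ge2$, \[ g(K_k,p)<\bigl(4\log_2 k+2\log_2\log_2 k+C\bigr)(p-1). \] Moreover, there exist a constant $c\in\mathbb R$ and an infinite set $K\subseteq\mathbb N$ such that for every $k\in K$ and every integer $p\ge2$, \[ g(K_k,p)\ge\Bigl(\tfrac83\log_2 k+c\Bigr)(p-1). \]
   Context: Graphs are finite and simple; the girth is the length of a shortest cycle. $g(K_k,p)$ is defined as $\sup\{g:\text{there is a }K_k\text{-minor-free graph }G\text{ with }\mathrm{girth}(G)\ge g\text{ that is not }p\text{-path degenerate}\}$. A strict ear of a graph $G$ is a path of $G$ whose internal vertices all have degree $2$ in $G$ and whose two endpoints are distinct. For an integer $p\ge1$, a $p$-reduction of $G$ is the deletion of either an isolated vertex, or a vertex of degree $1$, or the internal vertices of a strict ear of $G$ of length at least $p$. A graph is $p$-path degenerate if it can be reduced to the empty graph by a sequence of $p$-reductions. *)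

theory Defs
  imports "HOL-Library.Extended_Real"
begin

definition graph :: "'a set \<Rightarrow> 'a set set \<Rightarrow> bool" where
  "graph V E \<longleftrightarrow> finite V \<and> (\<forall>e\<in>E. \<exists>u v. e = {u, v} \<and> u \<noteq> v \<and> u \<in> V \<and> v \<in> V)"

definition degree :: "'a set set \<Rightarrow> 'a \<Rightarrow> nat" where
  "degree E v = card {e\<in>E. v \<in> e}"

definition del_verts :: "'a set \<Rightarrow> 'a set \<times> 'a set set \<Rightarrow> 'a set \<times> 'a set set" where
  "del_verts X G = (fst G - X, {e\<in>snd G. e \<inter> X = {}})"

definition is_path :: "'a set \<Rightarrow> 'a set set \<Rightarrow> 'a list \<Rightarrow> bool" where
  "is_path V E vs \<longleftrightarrow> vs \<noteq> [] \<and> distinct vs \<and> set vs \<subseteq> V \<and>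
     (\<forall>i. Suc i < length vs \<longrightarrow> {vs ! i, vs ! Suc i} \<in> E)"

definition strict_ear :: "'a set \<Rightarrow> 'a set set \<Rightarrow> 'a list \<Rightarrow> bool" where
  "strict_ear V E vs \<longleftrightarrow> is_path V E vs \<and> length vs \<ge> 2 \<and> hd vs \<noteq> last vs \<and>
     (\<forall>i. 0 < i \<and> Suc i < length vs \<longrightarrow> degree E (vs ! i) = 2)"

definition p_reduction :: "nat \<Rightarrow> 'a set \<times> 'a set set \<Rightarrow> 'a set \<times> 'a set set \<Rightarrow> bool" where
  "p_reduction p G H \<longleftrightarrow>
     (\<exists>v\<in>fst G. (degree (snd G) v = 0 \<or> degree (snd G) v = 1) \<and> H = del_verts {v} G) \<or>
     (\<exists>vs. strict_ear (fst G) (snd G) vs \<and> length vs - 1 \<ge> p \<and>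
        H = del_verts (set (butlast (tl vs))) G)"

definition p_path_degenerate :: "nat \<Rightarrow> 'a set \<Rightarrow> 'a set set \<Rightarrow> bool" where
  "p_path_degenerate p V E \<longleftrightarrow> (p_reduction p)\<^sup>*\<^sup>* (V, E) ({}, {})"

text \<open>Cycles and girth (girth \<ge> g means every cycle has length \<ge> g; forests have infinite girth).\<close>
definition has_cycle_len :: "'a set \<Rightarrow> 'a set set \<Rightarrow> nat \<Rightarrow> bool" where
  "has_cycle_len V E l \<longleftrightarrow> (\<exists>vs. length vs = l \<and> l \<ge> 3 \<and> distinct vs \<and> set vs \<subseteq> V \<and>
      (\<forall>i<l. {vs ! i, vs ! ((i + 1) mod l)} \<in> E))"

definition girth_ge :: "'a set \<Rightarrow> 'a set set \<Rightarrow> nat \<Rightarrow> bool" where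
  "girth_ge V E g \<longleftrightarrow> (\<forall>l. has_cycle_len V E l \<longrightarrow> g \<le> l)"

definition induced_connected :: "'a set set \<Rightarrow> 'a set \<Rightarrow> bool" where
  "induced_connected E S \<longleftrightarrow>
     (\<forall>u\<in>S. \<forall>v\<in>S. (\<lambda>x y. x \<in> S \<and> y \<in> S \<and> {x, y} \<in> E)\<^sup>*\<^sup>* u v)"

definition has_complete_minor :: "nat \<Rightarrow> 'a set \<Rightarrow> 'a set set \<Rightarrow> bool" where
  "has_complete_minor k V E \<longleftrightarrow> (\<exists>B :: nat \<Rightarrow> 'a set.
     (\<forall>i<k. B i \<noteq> {} \<and> B i \<subseteq> V \<and> induced_connected E (B i)) \<and>
     (\<forall>i<k. \<forall>j<k. i \<noteq> j \<longrightarrow> B i \<inter> B j = {} \<and>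
        (\<exists>u\<in>B i. \<exists>v\<in>B j. {u, v} \<in> E)))"

text \<open>g(K_k, p), as an extended real (\<infinity> if unbounded). Vertices are taken from nat,
  which is no loss of generality for finite graphs.\<close>
definition gKp :: "nat \<Rightarrow> nat \<Rightarrow> ereal" where
  "gKp k p = Sup {ereal (real g) | g. \<exists>(V :: nat set) E. graph V E \<and>
      \<not> has_complete_minor k V E \<and> girth_ge V E g \<and> \<not> p_path_degenerate p V E}"

end

(*
  Upper bound.  A graph that is not p-path degenerate contains a non-empty subgraph that admits no
  p-reduction.  Suppressing its vertices of degree two gives a graph of minimum degree three and
  girth at least g / (p - 1).  In such a graph, greedily chosen balls of radius about a quarter of
  the girth cover all but few edges; contracting the corresponding breadth-first trees yields a
  simple graph of average degree of order 2^(girth / 4) (Kuehn and Osthus).  A graph of average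
  degree of order k sqrt(log k) has a K_k minor (Kostochka, Thomason); this is shown as by Alon,
  Krivelevich and Sudakov: Mader's contraction argument gives a dense subgraph, and there random
  tuples, made connected by short paths, serve as branch sets.

  Lower bound.  Three quaternions of norm 2 generate a free product of three groups of order two.
  Reducing it modulo a prime q gives a cubic graph on O(q^3) vertices, and its bipartite double cover
  has girth at least 4 log q - 4, because only even words matter and these are
  scalar modulo q only if q^2 < 2^(length / 2 + 2).  After replacing each edge by a path of length
  p - 1 no p-reduction applies, and a K_k minor would need k (k - 3) branch vertices.
*)
theory Submission
  imports Defs "HOL-Library.FuncSet" "HOL-Number_Theory.Cong"
begin

section \<open>Minors\<close>

text \<open>The constants come from two counts. For the upper bound, a minor of average degree of
  order k sqrt(log k) needs balls of radius n with 2^n of that order; two trees of radius n joined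
  by two edges close up within 4 n + 4 edges, so the girth has to be 4 n up to a constant, that is,
  4 log k + 2 log log k. For the lower bound, \<open>k * (k - 3)\<close> must exceed O(q^3), so k is
  of order q^(3/2) and girth 4 log q becomes (8/3) log k. Girth is awkward to carry through
  suppression and contraction as long as cycles are lists of vertices. It is replaced by a count: a
  nonempty set of edges with no more vertices than edges must be large. The double cover restricts
  attention to words of even length, whose norm is a perfect square. The norm equation then factors
  as a difference of squares, which doubles the girth that the size of the norm alone would
  give.\<close>

lemma graph_finite_edges: "graph V E \<Longrightarrow> finite E"
proof -
  assume "graph V E"
  then have "finite V" "E \<subseteq> Pow V" by (auto simp: graph_def)
  then show ?thesis by (meson finite_Pow_iff finite_subset)
qed

lemma graph_edgeD:
  assumes "graph V E" "{u, v} \<in> E"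
  shows "u \<in> V" "v \<in> V" "u \<noteq> v"
proof -
  from assms obtain a b where "{u, v} = {a, b}" "a \<noteq> b" "a \<in> V" "b \<in> V"
    unfolding graph_def by blast
  then show "u \<in> V" "v \<in> V" "u \<noteq> v" by (auto simp: doubleton_eq_iff)
qed

lemma graph_edgeE:
  assumes "graph V E" "e \<in> E"
  obtains u v where "e = {u, v}" "u \<noteq> v" "u \<in> V" "v \<in> V"
  using assms unfolding graph_def by blast

lemma graph_card_edge: "graph V E \<Longrightarrow> e \<in> E \<Longrightarrow> card e = 2"
  by (auto elim!: graph_edgeE)

lemma graph_Union_edges: "graph V F \<Longrightarrow> graph (\<Union>F) F"
proof -
  assume G: "graph V F"
  have "finite e" if "e \<in> F" for e using graph_edgeE[OF G that] by blast
  then have "finite (\<Union>F)" using graph_finite_edges[OF G] by blast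
  moreover have "\<exists>u v. e = {u, v} \<and> u \<noteq> v \<and> u \<in> \<Union>F \<and> v \<in> \<Union>F" if e: "e \<in> F" for e
  proof -
    obtain u v where uv: "e = {u, v}" "u \<noteq> v" by (rule graph_edgeE[OF G e])
    then have "u \<in> \<Union>F" "v \<in> \<Union>F" using e by auto
    then show ?thesis using uv by blast
  qed
  ultimately show ?thesis by (simp add: graph_def)
qed

abbreviation step_in :: "'a set set \<Rightarrow> 'a set \<Rightarrow> 'a \<Rightarrow> 'a \<Rightarrow> bool" where
  "step_in E S \<equiv> (\<lambda>x y. x \<in> S \<and> y \<in> S \<and> {x, y} \<in> E)"

lemma induced_connectedI:
  assumes "\<And>v. v \<in> S \<Longrightarrow> (step_in E S)\<^sup>*\<^sup>* c v"
  shows "induced_connected E S"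
  unfolding induced_connected_def
proof (intro ballI)
  fix u v assume uv: "u \<in> S" "v \<in> S"
  have "symp (step_in E S)" by (auto simp: symp_def insert_commute)
  then have "symp ((step_in E S)\<^sup>*\<^sup>*)" by (rule symp_rtranclp)
  then have "(step_in E S)\<^sup>*\<^sup>* u c" using assms[OF uv(1)] by (auto dest: sympD)
  then show "(step_in E S)\<^sup>*\<^sup>* u v" using assms[OF uv(2)] by (rule rtranclp_trans)
qed

lemma induced_connected_mono:
  "induced_connected E S \<Longrightarrow> E \<subseteq> E' \<Longrightarrow> induced_connected E' S"
  unfolding induced_connected_def
  by (smt (verit, best) mono_rtranclp subsetD)

lemma step_in_mono:
  assumes "(step_in E S)\<^sup>*\<^sup>* u v" "S \<subseteq> S'"
  shows "(step_in E S')\<^sup>*\<^sup>* u v"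
  using assms by (smt (verit, best) mono_rtranclp subsetD)

lemma induced_connected_singleton [simp]: "induced_connected E {v}"
  by (simp add: induced_connected_def)

lemma induced_connected_insert:
  assumes "induced_connected E S" "s \<in> S" "{s, v} \<in> E"
  shows "induced_connected E (insert v S)"
proof (rule induced_connectedI[where c = s])
  fix w assume "w \<in> insert v S"
  then consider "w = v" | "w \<in> S" by blast
  then show "(step_in E (insert v S))\<^sup>*\<^sup>* s w"
  proof cases
    case 1
    show ?thesis unfolding 1 by (rule r_into_rtranclp) (use assms in simp)
  next
    case 2
    then have "(step_in E S)\<^sup>*\<^sup>* s w" using assms(1,2) by (simp add: induced_connected_def)
    then show ?thesis by (rule step_in_mono) blast
  qed
qed

lemma induced_connected_Un_common:
  assumes "\<And>A. A \<in> \<A> \<Longrightarrow> induced_connected E A \<and> x \<in> A"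
  shows "induced_connected E (\<Union>\<A>)"
proof (rule induced_connectedI[where c = x])
  fix v assume "v \<in> \<Union>\<A>"
  then obtain A where A: "A \<in> \<A>" "v \<in> A" by blast
  then have "(step_in E A)\<^sup>*\<^sup>* x v" using assms[OF A(1)] by (auto simp: induced_connected_def)
  then show "(step_in E (\<Union>\<A>))\<^sup>*\<^sup>* x v" by (rule step_in_mono) (use A in blast)
qed

text \<open>The body of \<open>has_complete_minor\<close> for a named witness, so that its clauses
  can be used separately.\<close>

definition minor_model :: "nat \<Rightarrow> 'a set \<Rightarrow> 'a set set \<Rightarrow> (nat \<Rightarrow> 'a set) \<Rightarrow> bool" where
  "minor_model k V E B \<longleftrightarrow>
     (\<forall>i<k. B i \<noteq> {} \<and> B i \<subseteq> V \<and> induced_connected E (B i)) \<and>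
     (\<forall>i<k. \<forall>j<k. i \<noteq> j \<longrightarrow> B i \<inter> B j = {} \<and>
        (\<exists>u\<in>B i. \<exists>v\<in>B j. {u, v} \<in> E))"

lemma has_complete_minor_iff: "has_complete_minor k V E \<longleftrightarrow> (\<exists>B. minor_model k V E B)"
  unfolding has_complete_minor_def minor_model_def ..

lemma minor_modelD:
  assumes "minor_model k V E B"
  shows "\<And>i. i < k \<Longrightarrow> B i \<noteq> {}" "\<And>i. i < k \<Longrightarrow> B i \<subseteq> V"
    "\<And>i. i < k \<Longrightarrow> induced_connected E (B i)"
    "\<And>i j. i < k \<Longrightarrow> j < k \<Longrightarrow> i \<noteq> j \<Longrightarrow> B i \<inter> B j = {}"
    "\<And>i j. i < k \<Longrightarrow> j < k \<Longrightarrow> i \<noteq> j \<Longrightarrow> \<exists>u\<in>B i. \<exists>v\<in>B j. {u, v} \<in> E"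
  using assms unfolding minor_model_def by simp_all

lemma complete_minorI:
  assumes "\<And>i. i < k \<Longrightarrow> B i \<noteq> {}" "\<And>i. i < k \<Longrightarrow> B i \<subseteq> V"
    "\<And>i. i < k \<Longrightarrow> induced_connected E (B i)"
    "\<And>i j. i < k \<Longrightarrow> j < k \<Longrightarrow> i \<noteq> j \<Longrightarrow> B i \<inter> B j = {}"
    "\<And>i j. i < k \<Longrightarrow> j < k \<Longrightarrow> i \<noteq> j \<Longrightarrow> \<exists>u\<in>B i. \<exists>v\<in>B j. {u, v} \<in> E"
  shows "has_complete_minor k V E"
  unfolding has_complete_minor_def by (rule exI[of _ B]) (simp add: assms)

lemma complete_minor_mono:
  assumes "has_complete_minor k V E" "V \<subseteq> V'" "E \<subseteq> E'"
  shows "has_complete_minor k V' E'"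
proof -
  from assms(1) obtain B where "minor_model k V E B" by (auto simp: has_complete_minor_iff)
  note B = minor_modelD[OF this]
  show ?thesis
  proof (rule complete_minorI[of k B])
    show "\<exists>u\<in>B i. \<exists>v\<in>B j. {u, v} \<in> E'" if "i < k" "j < k" "i \<noteq> j" for i j
      using B(5)[OF that] assms(3) by blast
    show "B i \<subseteq> V'" if "i < k" for i using B(2)[OF that] assms(2) by blast
    show "induced_connected E' (B i)" if "i < k" for i
      using induced_connected_mono[OF B(3)[OF that] assms(3)] .
  qed (fact B)+
qed

text \<open>Transitivity of the minor relation: branch sets of the quotient are replaced by unions
  of fibres, and a walk in the quotient lifts because fibres are connected and consecutive ones are
  joined by an edge. It covers the contraction of an edge as well as that of breadth-first
  trees.\<close>

lemma complete_minor_quotient: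
  fixes fib :: "'b \<Rightarrow> 'a set"
  assumes minor: "has_complete_minor k W F"
    and fib: "\<And>w. w \<in> W \<Longrightarrow> fib w \<noteq> {} \<and> fib w \<subseteq> V \<and> induced_connected E (fib w)"
    and disj: "\<And>w w'. w \<in> W \<Longrightarrow> w' \<in> W \<Longrightarrow> w \<noteq> w' \<Longrightarrow> fib w \<inter> fib w' = {}"
    and edges: "\<And>w w'. {w, w'} \<in> F \<Longrightarrow> w \<in> W \<Longrightarrow> w' \<in> W \<Longrightarrow> w \<noteq> w'
      \<Longrightarrow> \<exists>u\<in>fib w. \<exists>v\<in>fib w'. {u, v} \<in> E"
  shows "has_complete_minor k V E"
proof -
  from minor obtain B where "minor_model k W F B" by (auto simp: has_complete_minor_iff)
  note B0 = minor_modelD[OF this]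
  have B: "B i \<noteq> {} \<and> B i \<subseteq> W \<and> induced_connected F (B i)" if "i < k" for i
    using B0 that by simp
  define C where "C i = (\<Union>w\<in>B i. fib w)" for i
  have conn: "induced_connected E (C i)" if i: "i < k" for i
  proof -
    have fib_step: "(step_in E (C i))\<^sup>*\<^sup>* u v" if "w \<in> B i" "u \<in> fib w" "v \<in> fib w" for w u v
    proof -
      have "(step_in E (fib w))\<^sup>*\<^sup>* u v"
        using that fib[of w] B[OF i] by (auto simp: induced_connected_def)
      then show ?thesis by (rule step_in_mono) (use that in \<open>auto simp: C_def\<close>)
    qed
    have walk: "(step_in E (C i))\<^sup>*\<^sup>* u v"
      if "(step_in F (B i))\<^sup>*\<^sup>* w w'" "w \<in> B i" "u \<in> fib w" "v \<in> fib w'" for w w' u v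
      using that
    proof (induction arbitrary: v rule: rtranclp_induct)
      case base then show ?case using fib_step by blast
    next
      case (step y z)
      show ?case
      \<comment> \<open>\<open>F\<close> may contain loops here, and \<open>edges\<close> speaks of
        distinct vertices only.\<close>
      proof (cases "y = z")
        case True then show ?thesis using step.IH[OF step.prems(1,2)] step.prems(3) by simp
      next
        case False
        then obtain a b where ab: "a \<in> fib y" "b \<in> fib z" "{a, b} \<in> E"
          using edges[of y z] step.hyps(2) B[OF i] by (meson subsetD)
        have "(step_in E (C i))\<^sup>*\<^sup>* u a" by (rule step.IH[OF step.prems(1,2) ab(1)])
        moreover have "step_in E (C i) a b" using ab step.hyps(2) by (auto simp: C_def)
        moreover have "(step_in E (C i))\<^sup>*\<^sup>* b v"
          by (rule fib_step[of z]) (use step ab in auto)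
        ultimately show ?thesis by (rule rtranclp_trans[OF rtranclp.rtrancl_into_rtrancl])
      qed
    qed
    show ?thesis unfolding induced_connected_def
    proof (intro ballI)
      fix u v assume "u \<in> C i" "v \<in> C i"
      then obtain w w' where "w \<in> B i" "w' \<in> B i" "u \<in> fib w" "v \<in> fib w'" by (auto simp: C_def)
      then show "(step_in E (C i))\<^sup>*\<^sup>* u v"
        using walk[of w w' u v] B[OF i] by (auto simp: induced_connected_def)
    qed
  qed
  show ?thesis
  proof (rule complete_minorI[of k C])
    fix i assume i: "i < k"
    from B[OF i] obtain w where "w \<in> B i" "w \<in> W" by blast
    then show "C i \<noteq> {}" using fib[of w] unfolding C_def by blast
    show "C i \<subseteq> V" using B[OF i] fib unfolding C_def by blast
    show "induced_connected E (C i)" using conn i .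
  next
    fix i j assume ij: "i < k" "j < k" "i \<noteq> j"
    have sub: "B i \<subseteq> W" "B j \<subseteq> W" using B ij by blast+
    have "fib w \<inter> fib w' = {}" if "w \<in> B i" "w' \<in> B j" for w w'
      using that B0(4)[OF ij] sub disj[of w w'] by blast
    then show "C i \<inter> C j = {}" unfolding C_def by blast
    from B0(5)[OF ij] obtain w w' where w: "w \<in> B i" "w' \<in> B j" "{w, w'} \<in> F" by blast
    then have "\<exists>u\<in>fib w. \<exists>v\<in>fib w'. {u, v} \<in> E"
      using B0(4)[OF ij] sub by (intro edges) auto
    then show "\<exists>u\<in>C i. \<exists>v\<in>C j. {u, v} \<in> E" using w unfolding C_def by blast
  qed
qed

text \<open>The merged vertex keeps the name \<open>u\<close>. Edges are sets, so parallel edges to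
  common neighbours coincide by themselves, and \<open>w \<noteq> u\<close> drops the loop.\<close>

definition contract_edges :: "'a \<Rightarrow> 'a \<Rightarrow> 'a set set \<Rightarrow> 'a set set" where
  "contract_edges u v E = {e \<in> E. v \<notin> e} \<union> {{u, w} |w. {v, w} \<in> E \<and> w \<noteq> u}"

lemma graph_contract:
  assumes "graph V E" "{u, v} \<in> E"
  shows "graph (V - {v}) (contract_edges u v E)"
  unfolding graph_def
proof (intro conjI ballI)
  show "finite (V - {v})" using assms by (simp add: graph_def)
  note D = graph_edgeD[OF assms]
  fix e assume "e \<in> contract_edges u v E"
  then consider "e \<in> E" "v \<notin> e" | w where "e = {u, w}" "{v, w} \<in> E" "w \<noteq> u"
    unfolding contract_edges_def by (elim UnE CollectE exE conjE) metis+
  then show "\<exists>a b. e = {a, b} \<and> a \<noteq> b \<and> a \<in> V - {v} \<and> b \<in> V - {v}"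
  proof cases
    case 1
    then obtain a b where "e = {a, b}" "a \<noteq> b" "a \<in> V" "b \<in> V"
      using graph_edgeE[OF assms(1)] by blast
    then show ?thesis using 1 by blast
  next
    case 2
    then show ?thesis using D graph_edgeD[OF assms(1) 2(2)] by blast
  qed
qed

lemma complete_minor_contract:
  assumes G: "graph V E" and uv: "{u, v} \<in> E"
    and minor: "has_complete_minor k (V - {v}) (contract_edges u v E)"
  shows "has_complete_minor k V E"
proof (rule complete_minor_quotient[where fib = "\<lambda>w. if w = u then {u, v} else {w}", OF minor])
  note D = graph_edgeD[OF G uv]
  have "induced_connected E {v, u}"
    by (rule induced_connected_insert[where s = u]) (use uv in auto)
  then have "induced_connected E {u, v}" by (simp add: insert_commute)
  then show "\<And>w. w \<in> V - {v} \<Longrightarrow> (if w = u then {u, v} else {w}) \<noteq> {} \<and>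
         (if w = u then {u, v} else {w}) \<subseteq> V \<and> induced_connected E (if w = u then {u, v} else {w})"
    using D by auto
  show "\<And>w w'. w \<in> V - {v} \<Longrightarrow> w' \<in> V - {v} \<Longrightarrow> w \<noteq> w' \<Longrightarrow>
     (if w = u then {u, v} else {w}) \<inter> (if w' = u then {u, v} else {w'}) = {}"
    by auto
  show "\<exists>x\<in>if w = u then {u, v} else {w}. \<exists>y\<in>if w' = u then {u, v} else {w'}. {x, y} \<in> E"
    if e: "{w, w'} \<in> contract_edges u v E" and ww: "w \<in> V - {v}" "w' \<in> V - {v}" "w \<noteq> w'" for w w'
  proof -
    consider "{w, w'} \<in> E" | z where "{w, w'} = {u, z}" "{v, z} \<in> E"
      using e unfolding contract_edges_def by auto
    then show ?thesis
    proof cases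
      case 1
      then show ?thesis by (intro bexI[of _ w] bexI[of _ w']) simp_all
    next
      case 2
      then consider "w = u" "w' = z" | "w = z" "w' = u" by (auto simp: doubleton_eq_iff)
      then show ?thesis
      proof cases
        case 1
        then show ?thesis using 2 ww(3) by (intro bexI[of _ v] bexI[of _ z]) simp_all
      next
        case 2
        then show ?thesis using \<open>{v, z} \<in> E\<close> ww(3)
          by (intro bexI[of _ z] bexI[of _ v]) (simp_all add: insert_commute)
      qed
    qed
  qed
qed

section \<open>Complete minors in dense graphs\<close>

definition nbs :: "'a set set \<Rightarrow> 'a \<Rightarrow> 'a set" where
  "nbs E v = {u. {u, v} \<in> E}"

lemma nbs_subset: "graph V E \<Longrightarrow> nbs E v \<subseteq> V - {v}"
  by (auto simp: nbs_def dest: graph_edgeD)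

lemma finite_nbs: "graph V E \<Longrightarrow> finite (nbs E v)"
  by (rule finite_subset[OF nbs_subset]) (auto simp: graph_def)

lemma card_nbs: "graph V E \<Longrightarrow> card (nbs E v) = degree E v"
proof -
  assume G: "graph V E"
  have "bij_betw (\<lambda>u. {u, v}) (nbs E v) {e \<in> E. v \<in> e}"
  proof (rule bij_betw_imageI)
    show "inj_on (\<lambda>u. {u, v}) (nbs E v)" by (auto simp: inj_on_def doubleton_eq_iff)
    show "(\<lambda>u. {u, v}) ` nbs E v = {e \<in> E. v \<in> e}"
    proof (intro equalityI subsetI)
      fix e assume e: "e \<in> {e \<in> E. v \<in> e}"
      then obtain a b where ab: "e = {a, b}" using G by (auto elim!: graph_edgeE)
      with e consider "v = a" | "v = b" by auto
      then show "e \<in> (\<lambda>u. {u, v}) ` nbs E v"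
        by cases (use e ab in \<open>auto simp: nbs_def insert_commute\<close>)
    qed (auto simp: nbs_def)
  qed
  then show ?thesis by (simp add: degree_def bij_betw_same_card)
qed

text \<open>Robust diameter at most three. It is stated as connectedness of a set rather than by a
  path, since only unions of such sets are needed.\<close>

definition linked :: "'a set \<Rightarrow> 'a set set \<Rightarrow> nat \<Rightarrow> bool" where
  "linked V E r \<longleftrightarrow> (\<forall>Z x y. Z \<subseteq> V \<longrightarrow> card Z \<le> r \<longrightarrow> x \<in> V - Z \<longrightarrow> y \<in> V - Z \<longrightarrow>
     (\<exists>S. S \<subseteq> V - Z \<and> finite S \<and> card S \<le> 2 \<and> induced_connected E (insert x (insert y S))))"

text \<open>A later branch set in \<open>V\<close> is adjacent to \<open>B\<close> exactly if it is
  not contained in this set; keeping it small for every chosen \<open>B\<close> is what makes later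
  choices possible.\<close>

definition undominated :: "'a set \<Rightarrow> 'a set set \<Rightarrow> 'a set \<Rightarrow> 'a set" where
  "undominated V E B = {v \<in> V. \<forall>b\<in>B. {b, v} \<notin> E}"

text \<open>A uniformly random \<open>s\<close>-tuple misses the neighbourhood of a fixed vertex with probability at
  most \<open>(3/4)^s\<close>, and lies entirely in a fixed small set \<open>U i\<close> with probability about
  \<open>(3/4)^(s^2)\<close>; the union bound is carried out by counting tuples.\<close>
lemma exists_good_tuple:
  fixes nb :: "'a \<Rightarrow> 'a set" and U :: "nat \<Rightarrow> 'a set"
  assumes V: "finite V" "V' \<subseteq> V" "11 * card V \<le> 12 * card V'" "V \<noteq> {}"
    and nb: "\<And>v. v \<in> V \<Longrightarrow> 4 * card (V' - nb v) \<le> 3 * card V'"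
    and U: "\<And>i. i < j \<Longrightarrow> U i \<subseteq> V \<and> real (card (U i)) \<le> 2 * real (card V) * (3/4)^s"
    and j: "j \<le> k" and cond: "2 * real k * (3 * (3/4)^s)^s < 1"
  shows "\<exists>f. (\<forall>l<s. f l \<in> V') \<and>
     real (card {v\<in>V. \<forall>l<s. f l \<notin> nb v}) \<le> 2 * real (card V) * (3/4)^s \<and>
     (\<forall>i<j. \<exists>l<s. f l \<notin> U i)"
proof (rule ccontr)
  assume neg: "\<not> ?thesis"
  define N where "N = real (card V)"
  define M where "M = real (card V')"
  define q where "q = (3/4::real)^s"
  have finV': "finite V'" using V finite_subset by blast
  have N0: "N > 0" using V by (simp add: N_def card_gt_0_iff)
  have NM: "11 * N \<le> 12 * M" using V(3) unfolding N_def M_def by linarith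
  have M0: "M > 0" using N0 NM by linarith
  have q0: "q > 0" by (simp add: q_def)
  define Fs where "Fs = ({..<s} \<rightarrow>\<^sub>E V')"
  have finFs: "finite Fs" using finV' by (simp add: Fs_def finite_PiE)
  have cardFs: "real (card Fs) = M ^ s"
    by (simp add: Fs_def card_funcsetE M_def)
  define und where "und f = {v\<in>V. \<forall>l<s. f l \<notin> nb v}" for f
  \<comment> \<open>\<open>A\<close> holds the tuples that leave too many vertices undominated,
    \<open>C i\<close> those lying in \<open>U i\<close>; if no tuple were good, these sets would
    cover all tuples.\<close>
  define A where "A = {f\<in>Fs. real (card (und f)) > 2 * N * q}"
  define C where "C i = ({..<s} \<rightarrow>\<^sub>E (U i \<inter> V'))" for i
  have cover: "Fs \<subseteq> A \<union> (\<Union>i<j. C i)"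
  proof
    fix f assume f: "f \<in> Fs"
    then have fV: "\<forall>l<s. f l \<in> V'" by (auto simp: Fs_def)
    show "f \<in> A \<union> (\<Union>i<j. C i)"
    proof (cases "f \<in> A")
      case False
      then have "real (card (und f)) \<le> 2 * N * q" using f by (simp add: A_def)
      then have "\<not> (\<forall>i<j. \<exists>l<s. f l \<notin> U i)"
        using neg[unfolded not_ex, THEN spec, of f] fV by (simp add: und_def N_def q_def)
      then obtain i where i: "i < j" "\<forall>l<s. f l \<in> U i" by blast
      then have "f \<in> C i" using f fV by (auto simp: C_def Fs_def PiE_iff)
      then show ?thesis using i by blast
    qed simp
  qed
  have "(\<Sum>f\<in>Fs. card (und f)) = (\<Sum>v\<in>V. card ({..<s} \<rightarrow>\<^sub>E (V' - nb v)))"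
    unfolding und_def
  proof (rule sum_multicount_gen[where R = "\<lambda>f v. \<forall>l<s. f l \<notin> nb v"])
    have "{f \<in> Fs. \<forall>l<s. f l \<notin> nb v} = ({..<s} \<rightarrow>\<^sub>E (V' - nb v))" for v
      unfolding Fs_def PiE_iff set_eq_iff mem_Collect_eq by (simp; blast)
    then show "\<forall>v\<in>V. card {f \<in> Fs. \<forall>l<s. f l \<notin> nb v} = card ({..<s} \<rightarrow>\<^sub>E (V' - nb v))"
      by simp
    show "finite Fs" "finite V" by (fact finFs, fact V(1))
  qed
  also have "\<dots> = (\<Sum>v\<in>V. card (V' - nb v) ^ s)" by (simp add: card_funcsetE)
  finally have "(\<Sum>f\<in>Fs. real (card (und f))) = (\<Sum>v\<in>V. real (card (V' - nb v)) ^ s)"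
    by (metis (mono_tags, lifting) of_nat_power of_nat_sum sum.cong)
  also have "\<dots> \<le> (\<Sum>v\<in>V. ((3/4) * M) ^ s)"
  proof (intro sum_mono power_mono)
    fix v assume "v \<in> V"
    from nb[OF this] have "4 * real (card (V' - nb v)) \<le> 3 * M" unfolding M_def by linarith
    then show "real (card (V' - nb v)) \<le> (3/4) * M" by simp
  qed simp
  also have "\<dots> = N * q * M ^ s" by (simp add: N_def q_def power_mult_distrib power_divide)
  finally have tot: "(\<Sum>f\<in>Fs. real (card (und f))) \<le> N * q * M ^ s" .
  \<comment> \<open>Markov's inequality: the threshold is twice the bound on the average, so at most
    half of all tuples are in \<open>A\<close>.\<close>
  have "real (card A) * (2 * N * q) = (\<Sum>f\<in>A. 2 * N * q)" by simp
  also have "\<dots> \<le> (\<Sum>f\<in>A. real (card (und f)))" by (rule sum_mono) (simp add: A_def)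
  also have "\<dots> \<le> (\<Sum>f\<in>Fs. real (card (und f)))"
    by (rule sum_mono2) (auto simp: A_def finFs)
  also note tot
  finally have "(2 * real (card A)) * (N * q) \<le> M ^ s * (N * q)" by (simp add: mult_ac)
  then have cardA: "2 * real (card A) \<le> M ^ s" using N0 q0 by simp
  have cardC: "real (card (C i)) \<le> (3 * q) ^ s * M ^ s" if "i < j" for i
  proof -
    have "real (card (U i \<inter> V')) \<le> real (card (U i))"
      using V U[OF that] by (intro of_nat_mono card_mono finite_subset[of "U i" V]) auto
    also have "\<dots> \<le> 2 * N * q" using U[OF that] by (simp add: N_def q_def)
    \<comment> \<open>Passing from \<open>V\<close> to \<open>V'\<close> turns 2 into 24/11;
      rounding this up gives the factor 3 in \<open>cond\<close>.\<close>
    also have "\<dots> \<le> 3 * M * q" using NM M0 q0 by (intro mult_right_mono) linarith+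
    finally have "real (card (U i \<inter> V')) ^ s \<le> (3 * M * q) ^ s" by (intro power_mono) auto
    then show ?thesis by (simp add: C_def card_funcsetE power_mult_distrib mult_ac)
  qed
  have finC: "finite (C i)" for i using finV' by (simp add: C_def finite_PiE)
  have "card Fs \<le> card A + card (\<Union>i<j. C i)"
    using card_mono[OF _ cover] card_Un_le[of A "\<Union>i<j. C i"] finFs finC
    by (simp add: A_def)
  also have "card (\<Union>i<j. C i) \<le> (\<Sum>i<j. card (C i))" by (rule card_UN_le) simp
  finally have "real (card Fs) \<le> real (card A) + (\<Sum>i<j. real (card (C i)))"
    by (simp flip: of_nat_sum of_nat_add)
  also have "(\<Sum>i<j. real (card (C i))) \<le> (\<Sum>i<j. (3 * q) ^ s * M ^ s)"
    by (rule sum_mono) (rule cardC, simp)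
  also have "\<dots> = real j * ((3 * q) ^ s * M ^ s)" by simp
  also have "\<dots> \<le> real k * ((3 * q) ^ s * M ^ s)"
    using j M0 q0 by (intro mult_right_mono) auto
  finally have "M ^ s \<le> real (card A) + real k * (3 * q) ^ s * M ^ s" by (simp add: cardFs mult_ac)
  then have "M ^ s \<le> (2 * real k * (3 * q) ^ s) * M ^ s" using cardA by (simp add: algebra_simps)
  moreover have "M ^ s > 0" using M0 by simp
  ultimately have "1 \<le> 2 * real k * (3 * q) ^ s" by (simp add: pos_le_divide_eq)
  then show False using cond by (simp add: q_def)
qed

text \<open>Greedy choice of the branch sets. Each consists of a tuple of \<open>s\<close> vertices
  and at most two connectors per entry, so together they have at most \<open>3 * s * k\<close>
  vertices, few enough for \<open>linked\<close> to avoid them. Every chosen set dominates almost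
  all of \<open>V\<close>, so a random tuple is likely to meet the neighbourhood of each earlier
  one.\<close>

lemma linked_complete_minor:
  assumes G: "graph V E" and V0: "V \<noteq> {}"
    and deg: "\<And>v. v \<in> V \<Longrightarrow> card V \<le> 3 * card (nbs E v)"
    and link: "linked V E (3 * s * k)" and big: "12 * (3 * s * k) \<le> card V"
    and s: "s \<ge> 1" and cond: "2 * real k * (3 * (3/4)^s)^s < 1"
  shows "has_complete_minor k V E"
proof -
  define b where "b = 2 * real (card V) * (3/4)^s"
  have finV: "finite V" using G by (simp add: graph_def)
  define good where "good B \<longleftrightarrow> B \<noteq> {} \<and> B \<subseteq> V \<and> card B \<le> 3 * s \<and> induced_connected E B \<and>
    real (card (undominated V E B)) \<le> b" for B
  have "\<exists>B. (\<forall>i<j. good (B i)) \<and> (\<forall>i<j. \<forall>i'<j. i \<noteq> i' \<longrightarrow> B i \<inter> B i' = {} \<and>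
      (\<exists>u\<in>B i. \<exists>v\<in>B i'. {u, v} \<in> E))" if "j \<le> k" for j
    using that
  proof (induction j)
    case 0 show ?case by simp
  next
    case (Suc j)
    then obtain B where B: "\<forall>i<j. good (B i)"
      "\<forall>i<j. \<forall>i'<j. i \<noteq> i' \<longrightarrow> B i \<inter> B i' = {} \<and> (\<exists>u\<in>B i. \<exists>v\<in>B i'. {u, v} \<in> E)" by auto
    define Z where "Z = (\<Union>i<j. B i)"
    have ZV: "Z \<subseteq> V" using B(1) by (auto simp: Z_def good_def)
    have finZ: "finite Z" using ZV finV finite_subset by blast
    have "card Z \<le> (\<Sum>i<j. card (B i))" unfolding Z_def by (rule card_UN_le) simp
    also have "\<dots> \<le> (\<Sum>i<j. 3 * s)" by (rule sum_mono) (use B(1) in \<open>simp add: good_def\<close>)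
    also have "\<dots> = 3 * s * j" by simp
    also have "\<dots> \<le> 3 * s * k" using Suc.prems by simp
    finally have Z: "card Z \<le> 3 * s * k" .
    define V' where "V' = V - Z"
    have cV': "card V' + card Z = card V"
      using card_Diff_subset[OF finZ ZV] card_mono[OF finV ZV] by (simp add: V'_def)
    have "\<exists>f. (\<forall>l<s. f l \<in> V') \<and>
       real (card {v\<in>V. \<forall>l<s. f l \<notin> nbs E v}) \<le> 2 * real (card V) * (3/4)^s \<and>
       (\<forall>i<j. \<exists>l<s. f l \<notin> undominated V E (B i))"
    proof (rule exists_good_tuple[OF finV _ _ V0, where k = k])
      show "V' \<subseteq> V" by (auto simp: V'_def)
      show "11 * card V \<le> 12 * card V'" using cV' Z big by linarith
      \<comment> \<open>A third of \<open>card V\<close> minus the twelfth that \<open>Z\<close> may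
        take is a quarter, the source of 3/4.\<close>
      show "4 * card (V' - nbs E v) \<le> 3 * card V'" if v: "v \<in> V" for v
      proof -
        have "card (nbs E v) \<le> card (nbs E v \<inter> V' \<union> Z)"
          using finZ finite_nbs[OF G] nbs_subset[OF G, of v] by (intro card_mono) (auto simp: V'_def)
        also have "\<dots> \<le> card (nbs E v \<inter> V') + card Z" by (rule card_Un_le)
        finally have 1: "card (nbs E v) \<le> card (nbs E v \<inter> V') + card Z" .
        have finV': "finite V'" using finV by (simp add: V'_def)
        have "card (V' - nbs E v) + card (nbs E v \<inter> V') = card V'"
          using card_Int_Diff[OF finV', of "nbs E v"] by (simp add: Int_commute)
        then show ?thesis using 1 deg[OF v] cV' Z big by linarith
      qed
      show "undominated V E (B i) \<subseteq> V \<and> real (card (undominated V E (B i))) \<le> 2 * real (card V) * (3/4)^s"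
        if "i < j" for i
        using B(1) that by (auto simp: good_def undominated_def b_def)
      show "j \<le> k" using Suc.prems by simp
    qed (rule cond)
    then obtain f where f: "\<And>l. l < s \<Longrightarrow> f l \<in> V'"
      "real (card {v\<in>V. \<forall>l<s. f l \<notin> nbs E v}) \<le> b"
      "\<And>i. i < j \<Longrightarrow> \<exists>l<s. f l \<notin> undominated V E (B i)" unfolding b_def by blast
    \<comment> \<open>Entry \<open>f 0\<close> is a hub to which every entry is linked outside
      \<open>Z\<close>, so the union formed below is connected.\<close>
    have "\<exists>S. S \<subseteq> V' \<and> finite S \<and> card S \<le> 2 \<and> induced_connected E (insert (f 0) (insert (f l) S))"
      if "l < s" for l
      using link ZV Z f(1)[of 0] f(1)[OF that] s unfolding linked_def V'_def by auto
    then obtain S where S: "\<And>l. l < s \<Longrightarrow> S l \<subseteq> V'" "\<And>l. l < s \<Longrightarrow> finite (S l)"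
       "\<And>l. l < s \<Longrightarrow> card (S l) \<le> 2"
       "\<And>l. l < s \<Longrightarrow> induced_connected E (insert (f 0) (insert (f l) (S l)))" by metis
    define T where "T = (\<Union>l<s. insert (f 0) (insert (f l) (S l)))"
    have TV': "T \<subseteq> V'" unfolding T_def using S(1) f(1) f(1)[of 0] s by (intro UN_least) simp
    have T_eq: "T = f ` {..<s} \<union> (\<Union>l<s. S l)"
      using s unfolding T_def by (auto intro: image_eqI[of _ _ 0])
    have "card T \<le> card (f ` {..<s}) + card (\<Union>l<s. S l)" unfolding T_eq by (rule card_Un_le)
    also have "\<dots> \<le> s + (\<Sum>l<s. card (S l))"
      using card_image_le[of "{..<s}" f] card_UN_le[of "{..<s}" S] by simp
    also have "(\<Sum>l<s. card (S l)) \<le> (\<Sum>l<s. 2)" by (rule sum_mono) (use S(3) in simp)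
    finally have cT: "card T \<le> 3 * s" by simp
    have conn: "induced_connected E T"
      unfolding T_def by (rule induced_connected_Un_common[where x = "f 0"]) (use S(4) in auto)
    have "undominated V E T \<subseteq> {v\<in>V. \<forall>l<s. f l \<notin> nbs E v}"
      by (auto simp: undominated_def T_def nbs_def)
    then have "card (undominated V E T) \<le> card {v\<in>V. \<forall>l<s. f l \<notin> nbs E v}"
      using finV by (intro card_mono) auto
    then have und: "real (card (undominated V E T)) \<le> b" using f(2) by linarith
    have T0: "T \<noteq> {}" using s by (auto simp: T_eq lessThan_empty_iff)
    have goodT: "good T" using T0 TV' cT conn und by (auto simp: good_def V'_def)
    have adj: "\<exists>u\<in>B i. \<exists>v\<in>T. {u, v} \<in> E" if i: "i < j" for i
    proof -
      obtain l where l: "l < s" "f l \<notin> undominated V E (B i)" using f(3)[OF i] by blast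
      then obtain b where "b \<in> B i" "{b, f l} \<in> E"
        using f(1)[of l] by (auto simp: undominated_def V'_def)
      then show ?thesis using l by (auto simp: T_eq)
    qed
    have dis: "B i \<inter> T = {}" if i: "i < j" for i
      using TV' i by (auto simp: V'_def Z_def)
    show ?case
    proof (intro exI[of _ "B(j := T)"] conjI allI impI)
      show "good ((B(j := T)) i)" if "i < Suc j" for i
        using B(1) goodT that by (auto simp: less_Suc_eq)
      fix i i' assume ii: "i < Suc j" "i' < Suc j" "i \<noteq> i'"
      then consider "i < j" "i' < j" | "i = j" "i' < j" | "i < j" "i' = j" by linarith
      then have "(B(j := T)) i \<inter> (B(j := T)) i' = {} \<and>
        (\<exists>u\<in>(B(j := T)) i. \<exists>v\<in>(B(j := T)) i'. {u, v} \<in> E)"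
      proof cases
        case 1 then show ?thesis using B(2) ii(3) by simp
      next
        case 2
        then obtain u v where "u \<in> B i'" "v \<in> T" "{v, u} \<in> E" using adj[of i'] by (auto simp: insert_commute)
        then show ?thesis using 2 dis[of i'] by (auto simp: Int_commute)
      next
        case 3 then show ?thesis using dis[of i] adj[of i] by auto
      qed
      then show "(B(j := T)) i \<inter> (B(j := T)) i' = {}"
        "\<exists>u\<in>(B(j := T)) i. \<exists>v\<in>(B(j := T)) i'. {u, v} \<in> E" by blast+
    qed
  qed
  from this[of k] obtain B where "\<forall>i<k. good (B i)" "\<forall>i<k. \<forall>i'<k. i \<noteq> i' \<longrightarrow> B i \<inter> B i' = {} \<and>
      (\<exists>u\<in>B i. \<exists>v\<in>B i'. {u, v} \<in> E)" by auto
  then have "minor_model k V E B" by (simp add: minor_model_def good_def)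
  then show ?thesis by (auto simp: has_complete_minor_iff)
qed

lemma graph_induced: "graph V E \<Longrightarrow> X \<subseteq> V \<Longrightarrow> graph X {e\<in>E. e \<subseteq> X}"
proof -
  assume G: "graph V E" and X: "X \<subseteq> V"
  have "\<exists>u v. e = {u, v} \<and> u \<noteq> v \<and> u \<in> X \<and> v \<in> X" if "e \<in> E" "e \<subseteq> X" for e
    using that by (auto elim!: graph_edgeE[OF G])
  moreover have "finite X" using G X finite_subset unfolding graph_def by blast
  ultimately show ?thesis by (simp add: graph_def)
qed

text \<open>If \<open>linked\<close> fails at \<open>x\<close> and \<open>y\<close>, their
  neighbourhoods outside \<open>Z\<close> are disjoint with no edge between them, and each has
  nearly half of the vertices or more. A vertex of \<open>X\<close> has no neighbour in
  \<open>Y\<close> but at least half of \<open>card V\<close> neighbours, so it is adjacent to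
  almost all of \<open>X\<close>. Thus \<open>X\<close> is nearly complete, and linked.\<close>

lemma half_dense_complete_minor:
  assumes G: "graph V E" and V0: "V \<noteq> {}"
    and deg: "\<And>v. v \<in> V \<Longrightarrow> card V \<le> 2 * card (nbs E v)"
    and big: "26 * (3 * s * k) \<le> card V"
    and sk: "s \<ge> 1" "k \<ge> 1" and cond: "2 * real k * (3 * (3/4)^s)^s < 1"
  shows "has_complete_minor k V E"
proof (cases "linked V E (3 * s * k)")
  case True
  show ?thesis
  proof (rule linked_complete_minor[OF G V0 _ True])
    show "card V \<le> 3 * card (nbs E v)" if "v \<in> V" for v using deg[OF that] by linarith
  qed (use big sk cond in auto)
next
  case False
  define r where "r = 3 * s * k"
  have r: "r \<ge> 1" using sk by (simp add: r_def)
  have finV: "finite V" using G by (simp add: graph_def)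
  from False obtain Z x y where Z: "Z \<subseteq> V" "card Z \<le> r" "x \<in> V - Z" "y \<in> V - Z"
    and nS: "\<not> (\<exists>S. S \<subseteq> V - Z \<and> finite S \<and> card S \<le> 2 \<and> induced_connected E (insert x (insert y S)))"
    unfolding linked_def r_def[symmetric] not_all not_imp by (elim exE conjE) (rule that)
  have S: "\<not> induced_connected E (insert x (insert y S))" if "S \<subseteq> V - Z" "finite S" "card S \<le> 2" for S
    using nS[unfolded not_ex, THEN spec, of S] that by simp
  have conn: "induced_connected E {x, y, a, b}" if "{x, a} \<in> E" "{a, b} \<in> E" "{b, y} \<in> E" for a b
  proof -
    have "induced_connected E {a, x}"
      by (rule induced_connected_insert[where s = x]) (use that in auto)
    then have "induced_connected E {b, a, x}"
      by (rule induced_connected_insert[where s = a]) (use that in auto)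
    then have "induced_connected E {y, b, a, x}"
      by (rule induced_connected_insert[where s = b]) (use that in auto)
    then show ?thesis by (simp add: insert_commute)
  qed
  define X where "X = nbs E x - Z"
  define Y where "Y = nbs E y - Z"
  have XV: "X \<subseteq> V" "Y \<subseteq> V" using nbs_subset[OF G] by (auto simp: X_def Y_def)
  have noedge: "{a, b} \<notin> E" if "a \<in> X" "b \<in> Y" for a b
  proof
    assume e: "{a, b} \<in> E"
    have "induced_connected E (insert x (insert y {a, b}))"
      using conn[of a b] e that by (auto simp: X_def Y_def nbs_def insert_commute)
    moreover have "{a, b} \<subseteq> V - Z" using that XV by (auto simp: X_def Y_def)
    moreover have "card {a, b} \<le> 2" by (simp add: card_insert_if)
    ultimately show False using S by blast
  qed
  have disj: "X \<inter> Y = {}"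
  proof (rule ccontr)
    assume "X \<inter> Y \<noteq> {}"
    then obtain a where a: "a \<in> X" "a \<in> Y" by blast
    then have e: "{x, a} \<in> E" "{a, y} \<in> E" by (auto simp: X_def Y_def nbs_def insert_commute)
    have "induced_connected E {a, x}"
      by (rule induced_connected_insert[where s = x]) (use e in auto)
    then have "induced_connected E {y, a, x}"
      by (rule induced_connected_insert[where s = a]) (use e in auto)
    then have "induced_connected E (insert x (insert y {a}))" by (simp add: insert_commute)
    moreover have "{a} \<subseteq> V - Z" using a XV by (auto simp: X_def)
    ultimately show False using S[of "{a}"] by simp
  qed
  have finXY: "finite X" "finite Y" using XV finV finite_subset by blast+
  have XY: "card X + card Y \<le> card V"
    using card_Un_disjoint[OF finXY disj] card_mono[OF finV, of "X \<union> Y"] XV by simp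
  have finZ: "finite Z" using Z(1) finV finite_subset by blast
  have cX: "card (nbs E x) \<le> card X + r" "card (nbs E y) \<le> card Y + r"
    using diff_card_le_card_Diff[OF finZ, of "nbs E x"] diff_card_le_card_Diff[OF finZ, of "nbs E y"] Z(2)
    by (simp_all add: X_def Y_def)
  have dx: "card V \<le> 2 * card (nbs E x)" "card V \<le> 2 * card (nbs E y)" using deg Z by auto
  have big': "26 * r \<le> card V" using big by (simp add: r_def)
  \<comment> \<open>Half of 26 r minus the r neighbours that \<open>Z\<close> may contain; 12 r is
    what \<open>linked_complete_minor\<close> asks for.\<close>
  have X12: "12 * r \<le> card X" using cX dx big' by linarith
  have X0: "X \<noteq> {}" using X12 r by auto
  define E' where "E' = {e\<in>E. e \<subseteq> X}"
  have G': "graph X E'" unfolding E'_def by (rule graph_induced[OF G XV(1)])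
  have nbs': "nbs E' a = nbs E a \<inter> X" if "a \<in> X" for a using that by (auto simp: nbs_def E'_def)
  have near: "card X \<le> card (nbs E' a) + r" if a: "a \<in> X" for a
  proof -
    have "nbs E a \<subseteq> (nbs E a \<inter> X) \<union> (V - (X \<union> Y))"
      using nbs_subset[OF G, of a] noedge[OF a] by (auto simp: nbs_def insert_commute)
    then have "card (nbs E a) \<le> card ((nbs E a \<inter> X) \<union> (V - (X \<union> Y)))"
      using finV finXY by (intro card_mono) auto
    also have "\<dots> \<le> card (nbs E a \<inter> X) + card (V - (X \<union> Y))" by (rule card_Un_le)
    also have "card (V - (X \<union> Y)) = card V - (card X + card Y)"
      using card_Diff_subset[of "X \<union> Y" V] card_Un_disjoint[OF finXY disj] finXY XV by simp
    finally have "card (nbs E a) \<le> card (nbs E' a) + (card V - (card X + card Y))"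
      using nbs'[OF a] by simp
    moreover have "card V \<le> 2 * card (nbs E a)" using deg a XV by auto
    ultimately show ?thesis using XY cX dx by linarith
  qed
  have "linked X E' r"
    unfolding linked_def
  proof (intro allI impI)
    fix Z' a b assume Z': "Z' \<subseteq> X" "card Z' \<le> r" and ab: "a \<in> X - Z'" "b \<in> X - Z'"
    have miss: "card (X - nbs E' c) \<le> r" if "c \<in> X" for c
    proof -
      have "card (X - nbs E' c) = card X - card (nbs E' c)"
        using nbs_subset[OF G', of c] finite_nbs[OF G'] by (intro card_Diff_subset) auto
      then show ?thesis using near[OF that] by linarith
    qed
    \<comment> \<open>The two sets of non-neighbours and \<open>Z'\<close> have at most
      \<open>3 * r\<close> elements together, fewer than \<open>X\<close>, so a common neighbour
      remains.\<close>
    have "\<not> X \<subseteq> (X - nbs E' a) \<union> (X - nbs E' b) \<union> Z'"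
    proof
      assume "X \<subseteq> (X - nbs E' a) \<union> (X - nbs E' b) \<union> Z'"
      then have "card X \<le> card ((X - nbs E' a) \<union> (X - nbs E' b) \<union> Z')"
        using finXY(1) Z' finite_subset[OF Z'(1)] by (intro card_mono) auto
      also have "\<dots> \<le> card (X - nbs E' a) + card (X - nbs E' b) + card Z'"
        by (rule order_trans[OF card_Un_le]) (simp add: card_Un_le)
      also have "\<dots> \<le> 3 * r" using miss[of a] miss[of b] ab Z'(2) by simp
      finally show False using X12 r by linarith
    qed
    then obtain c where c: "c \<in> X" "c \<notin> Z'" "{c, a} \<in> E'" "{c, b} \<in> E'" by (auto simp: nbs_def)
    have "induced_connected E' {a, c}"
      by (rule induced_connected_insert[where s = c]) (use c in auto)
    then have "induced_connected E' {b, a, c}"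
      by (rule induced_connected_insert[where s = c]) (use c in auto)
    then have "induced_connected E' (insert a (insert b {c}))" by (simp add: insert_commute)
    then show "\<exists>S\<subseteq>X - Z'. finite S \<and> card S \<le> 2 \<and> induced_connected E' (insert a (insert b S))"
      using c by (intro exI[of _ "{c}"]) simp
  qed
  then have link: "linked X E' (3 * s * k)" by (simp add: r_def)
  have "has_complete_minor k X E'"
  proof (rule linked_complete_minor[OF G' X0 _ link])
    show "card X \<le> 3 * card (nbs E' v)" if "v \<in> X" for v using near[OF that] X12 by linarith
  qed (use X12 sk cond in \<open>auto simp: r_def\<close>)
  then show ?thesis by (rule complete_minor_mono) (use XV in \<open>auto simp: E'_def\<close>)
qed

section \<open>Edge counts and Mader's contraction argument\<close>

lemma handshake: "graph V E \<Longrightarrow> (\<Sum>v\<in>V. degree E v) = 2 * card E"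
  unfolding degree_def
proof (rule sum_multicount)
  assume G: "graph V E"
  show "finite V" "finite E" using G graph_finite_edges by (auto simp: graph_def)
  have "{v \<in> V. v \<in> e} = e" if "e \<in> E" for e using G that by (auto elim!: graph_edgeE)
  then show "\<forall>e\<in>E. card {v \<in> V. v \<in> e} = 2" using graph_card_edge[OF G] by simp
qed

text \<open>Contraction loses the edge \<open>{u, v}\<close> itself and one of the two edges to each
  common neighbour. The second bound makes \<open>card V + card E\<close> decrease in the induction
  below.\<close>

lemma card_contract_edges:
  assumes G: "graph V E" and uv: "{u, v} \<in> E"
  shows "card E \<le> card (contract_edges u v E) + card (nbs E u \<inter> nbs E v) + 1"
    and "card (contract_edges u v E) \<le> card E"
proof -
  have finE: "finite E" by (rule graph_finite_edges[OF G])
  have fn: "finite (nbs E w)" for w by (rule finite_nbs[OF G])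
  let ?A = "{e\<in>E. v \<notin> e}"
  have ce: "contract_edges u v E = ?A \<union> (\<lambda>w. {u, w}) ` (nbs E v - {u})"
    by (auto simp: contract_edges_def nbs_def insert_commute)
  have inj: "inj_on (\<lambda>w. {u, w}) S" for S by (auto simp: inj_on_def doubleton_eq_iff)
  have "card E = card (?A \<union> {e\<in>E. v \<in> e})" by (rule arg_cong[of _ _ card]) blast
  also have "\<dots> = card ?A + card {e\<in>E. v \<in> e}" by (rule card_Un_disjoint) (use finE in auto)
  also have "card {e\<in>E. v \<in> e} = card (nbs E v)" by (simp add: card_nbs[OF G] degree_def)
  finally have cE: "card E = card ?A + card (nbs E v)" .
  have u: "u \<in> nbs E v" "u \<notin> nbs E u" using uv nbs_subset[OF G, of u] by (simp add: nbs_def, blast)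
  then have cu: "card (nbs E v) = card (nbs E v - {u}) + 1"
    using card_Suc_Diff1[OF fn u(1)] by simp
  have "card (contract_edges u v E) \<le> card ?A + card ((\<lambda>w. {u, w}) ` (nbs E v - {u}))"
    unfolding ce by (rule card_Un_le)
  then show "card (contract_edges u v E) \<le> card E"
    using cE cu card_image_le[of "nbs E v - {u}" "\<lambda>w. {u, w}"] fn[of v] by simp
  have "?A \<inter> (\<lambda>w. {u, w}) ` (nbs E v - {u} - nbs E u) = {}"
    by (auto simp: nbs_def insert_commute)
  then have "card (?A \<union> (\<lambda>w. {u, w}) ` (nbs E v - {u} - nbs E u)) = card ?A + card (nbs E v - {u} - nbs E u)"
    using finE fn by (subst card_Un_disjoint) (auto simp: card_image[OF inj])
  moreover have "card (?A \<union> (\<lambda>w. {u, w}) ` (nbs E v - {u} - nbs E u)) \<le> card (contract_edges u v E)"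
    unfolding ce using finE fn by (intro card_mono) auto
  moreover have "card (nbs E v - {u}) \<le> card (nbs E v - {u} - nbs E u) + card (nbs E u \<inter> nbs E v)"
  proof -
    have "card (nbs E v - {u}) \<le> card ((nbs E v - {u} - nbs E u) \<union> (nbs E u \<inter> nbs E v))"
      using fn by (intro card_mono) auto
    also have "\<dots> \<le> card (nbs E v - {u} - nbs E u) + card (nbs E u \<inter> nbs E v)" by (rule card_Un_le)
    finally show ?thesis .
  qed
  ultimately show "card E \<le> card (contract_edges u v E) + card (nbs E u \<inter> nbs E v) + 1"
    using cE cu by linarith
qed

text \<open>Mader's argument: contracting an edge in fewer than \<open>d\<close> triangles keeps \<open>|E| \<ge> d |V|\<close>. Once
  no such edge is left, the neighbourhood of a vertex of degree at most \<open>2d\<close> induces a graph of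
  minimum degree at least half its order.\<close>
theorem dense_complete_minor:
  assumes "graph V E" "V \<noteq> {}" "d * card V \<le> card E"
    and d: "d \<ge> 1" "26 * (3 * s * k) \<le> d + 1"
    and sk: "s \<ge> 1" "k \<ge> 1" and cond: "2 * real k * (3 * (3/4)^s)^s < 1"
  shows "has_complete_minor k V E"
  using assms(1-3)
proof (induction "card V + card E" arbitrary: V E rule: less_induct)
  case less
  note G = less.prems(1)
  have finV: "finite V" using G by (simp add: graph_def)
  have finE: "finite E" by (rule graph_finite_edges[OF G])
  have cV: "card V \<ge> 1" using less.prems(2) finV by (simp add: Suc_le_eq card_gt_0_iff)
  have "card E \<ge> 1" using less.prems(3) cV d(1) by (metis One_nat_def Suc_le_eq less_le_trans mult_pos_pos)
  then have E0: "E \<noteq> {}" by auto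
  \<comment> \<open>Surplus edges and isolated vertices are removed as well, so that in the last
    case the average degree is exactly \<open>2 * d\<close> and every vertex has a
    neighbour.\<close>
  consider "d * card V < card E" | v where "v \<in> V" "degree E v = 0"
    | u v where "{u, v} \<in> E" "card (nbs E u \<inter> nbs E v) < d"
    | "card E = d * card V" "\<And>v. v \<in> V \<Longrightarrow> degree E v \<noteq> 0"
      "\<And>u v. {u, v} \<in> E \<Longrightarrow> d \<le> card (nbs E u \<inter> nbs E v)"
    using less.prems(3) by (metis le_neq_implies_less not_less)
  then show ?case
  proof cases
    case 1
    obtain e where e: "e \<in> E" using E0 by blast
    have ce: "card (E - {e}) = card E - 1" using e finE by simp
    have "has_complete_minor k V (E - {e})"
    proof (rule less.hyps)
      show "card V + card (E - {e}) < card V + card E" using ce 1 by linarith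
      show "graph V (E - {e})" using G by (auto simp: graph_def)
      show "d * card V \<le> card (E - {e})" using ce 1 by linarith
    qed (fact less.prems(2))
    then show ?thesis by (rule complete_minor_mono) auto
  next
    case 2
    have c: "card (V - {v}) = card V - 1" using 2 by simp
    have nv: "v \<notin> e" if "e \<in> E" for e using 2(2) that finE by (auto simp: degree_def)
    have "has_complete_minor k (V - {v}) E"
    proof (rule less.hyps)
      show "card (V - {v}) + card E < card V + card E" using c cV by linarith
      show "graph (V - {v}) E" using G nv unfolding graph_def by fastforce
      obtain e where e: "e \<in> E" using E0 by blast
      with nv[OF e] show "V - {v} \<noteq> {}" using G by (auto elim!: graph_edgeE)
      have "d * card (V - {v}) \<le> d * card V" using c by simp
      then show "d * card (V - {v}) \<le> card E" using less.prems(3) by linarith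
    qed
    then show ?thesis by (rule complete_minor_mono) auto
  next
    case 3
    note D = graph_edgeD[OF G 3(1)]
    have c: "card (V - {v}) = card V - 1" using D by simp
    note cc = card_contract_edges[OF G 3(1)]
    have "has_complete_minor k (V - {v}) (contract_edges u v E)"
    proof (rule less.hyps)
      show "card (V - {v}) + card (contract_edges u v E) < card V + card E" using c cc cV by linarith
      show "graph (V - {v}) (contract_edges u v E)" by (rule graph_contract[OF G 3(1)])
      show "V - {v} \<noteq> {}" using D by blast
      have "d * card (V - {v}) + d = d * card V" using c cV by (simp add: diff_mult_distrib2)
      then show "d * card (V - {v}) \<le> card (contract_edges u v E)"
        using cc(1) 3(2) less.prems(3) by linarith
    qed
    then show ?thesis by (rule complete_minor_contract[OF G 3(1)])
  next
    case 4
    have "\<exists>v\<in>V. degree E v \<le> 2 * d"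
    proof (rule ccontr)
      assume "\<not> ?thesis"
      then have "(\<Sum>v\<in>V. 2 * d) < (\<Sum>v\<in>V. degree E v)"
        using finV less.prems(2) by (intro sum_strict_mono) auto
      then show False using handshake[OF G] 4(1) by simp
    qed
    then obtain v where v: "v \<in> V" "degree E v \<le> 2 * d" by blast
    define N where "N = nbs E v"
    have cN: "card N \<le> 2 * d" "N \<noteq> {}" using v 4(2)[OF v(1)] card_nbs[OF G, of v] by (auto simp: N_def)
    have NV: "N \<subseteq> V" using nbs_subset[OF G] by (auto simp: N_def)
    define F where "F = {e\<in>E. e \<subseteq> N}"
    have GN: "graph N F" unfolding F_def by (rule graph_induced[OF G NV])
    have dN: "d \<le> card (nbs F w)" if "w \<in> N" for w
    proof -
      have "nbs F w = nbs E w \<inter> nbs E v" using that by (auto simp: nbs_def F_def N_def)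
      then show ?thesis using 4(3)[of w v] that by (simp add: N_def nbs_def)
    qed
    obtain w where w: "w \<in> N" using cN(2) by blast
    have "card (nbs F w) < card N"
      using nbs_subset[OF GN, of w] w GN by (intro psubset_card_mono) (auto simp: graph_def)
    \<comment> \<open>\<open>w\<close> is not its own neighbour, so \<open>N\<close> has at least
      one vertex more than the \<open>d\<close> common neighbours; this is the \<open>d + 1\<close>
      of the hypothesis.\<close>
    then have dN1: "d + 1 \<le> card N" using dN[OF w] by linarith
    have "has_complete_minor k N F"
    proof (rule half_dense_complete_minor[OF GN cN(2) _ _ sk cond])
      show "card N \<le> 2 * card (nbs F w)" if "w \<in> N" for w using dN[OF that] cN(1) by linarith
      show "26 * (3 * s * k) \<le> card N" using dN1 d(2) by linarith
    qed
    then show ?thesis by (rule complete_minor_mono) (use NV in \<open>auto simp: F_def\<close>)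
  qed
qed

section \<open>Breadth-first forests in locally sparse graphs\<close>

text \<open>Equivalent to all cycles having length at least \<open>g\<close>, but stable under the graph operations below.\<close>
definition sparse :: "'a set set \<Rightarrow> nat \<Rightarrow> bool" where
  "sparse E g \<longleftrightarrow> (\<forall>F\<subseteq>E. F \<noteq> {} \<longrightarrow> card F < g \<longrightarrow> card F < card (\<Union>F))"

section \<open>Balls around vertex sets\<close>

fun reach :: "'a set set \<Rightarrow> nat \<Rightarrow> 'a set \<Rightarrow> 'a set" where
  "reach E 0 D = D"
| "reach E (Suc n) D = reach E n D \<union> {v. \<exists>u\<in>reach E n D. {u, v} \<in> E}"

lemma reach_mono: "m \<le> n \<Longrightarrow> reach E m D \<subseteq> reach E n D"
  by (rule lift_Suc_mono_le[of "\<lambda>n. reach E n D"]) auto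

lemma reach_UN: "reach E n D = (\<Union>d\<in>D. reach E n {d})"
  by (induction n) auto

lemma reach_Suc_shift: "reach E (Suc n) D = reach E n (reach E 1 D)"
  by (induction n) auto

lemma reach_sym: "y \<in> reach E n {x} \<Longrightarrow> x \<in> reach E n {y}"
proof (induction n arbitrary: y)
  case (Suc n)
  then obtain u where u: "u \<in> reach E n {x}" "u = y \<or> {u, y} \<in> E" by auto
  then have "x \<in> reach E n {u}" using Suc.IH by simp
  moreover have "u \<in> reach E 1 {y}" using u(2) by (auto simp: insert_commute)
  ultimately have "x \<in> reach E n (reach E 1 {y})" by (subst reach_UN) blast
  then show ?case by (simp only: reach_Suc_shift)
qed simp

lemma reach_subset:
  assumes "graph V E" "D \<subseteq> V"
  shows "reach E n D \<subseteq> V"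
proof (induction n)
  case (Suc n)
  have "v \<in> V" if "{u, v} \<in> E" for u v using graph_edgeD[OF assms(1) that] by simp
  then show ?case using Suc by auto
qed (use assms in simp)

text \<open>The search starts from all of \<open>D\<close> at once, so the reached vertices fall
  into disjoint trees, one for each root.\<close>

locale bfs =
  fixes V :: "'a set" and E :: "'a set set" and D :: "'a set"
  assumes G: "graph V E" and DV: "D \<subseteq> V"
begin

definition reachable :: "'a \<Rightarrow> bool" where
  "reachable v \<longleftrightarrow> (\<exists>n. v \<in> reach E n D)"

definition depth :: "'a \<Rightarrow> nat" where
  "depth v = (LEAST n. v \<in> reach E n D)"

definition par :: "'a \<Rightarrow> 'a" where
  "par v = (SOME u. {u, v} \<in> E \<and> u \<in> reach E (depth v - 1) D)"

text \<open>The counter, later set to the depth, supplies the termination that iterating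
  \<open>par\<close> lacks; at a root \<open>par\<close> is unspecified, and the counter stops
  there.\<close>

fun ancn :: "nat \<Rightarrow> 'a \<Rightarrow> 'a set" where
  "ancn 0 v = {v}"
| "ancn (Suc n) v = insert v (ancn n (par v))"

fun rootn :: "nat \<Rightarrow> 'a \<Rightarrow> 'a" where
  "rootn 0 v = v"
| "rootn (Suc n) v = rootn n (par v)"

definition anc :: "'a \<Rightarrow> 'a set" where "anc v = ancn (depth v) v"
definition root :: "'a \<Rightarrow> 'a" where "root v = rootn (depth v) v"
definition tree_edges :: "'a set set" where
  "tree_edges = {{par w, w} |w. reachable w \<and> depth w > 0}"

lemma reachable_in_reach: "reachable v \<Longrightarrow> v \<in> reach E (depth v) D"
  unfolding reachable_def depth_def by (rule LeastI_ex)

lemma depth_le: "v \<in> reach E n D \<Longrightarrow> depth v \<le> n"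
  unfolding depth_def by (rule Least_le)

lemma reachableI: "v \<in> reach E n D \<Longrightarrow> reachable v"
  by (auto simp: reachable_def)

lemma in_reach_iff: "v \<in> reach E n D \<longleftrightarrow> reachable v \<and> depth v \<le> n"
  using reachable_in_reach[of v] depth_le[of v n] reachableI[of v n] reach_mono[of "depth v" n E D] by blast

lemma reachable_V: "reachable v \<Longrightarrow> v \<in> V"
  using reachable_in_reach reach_subset[OF G DV] by blast

lemma depth_0_iff: "reachable v \<Longrightarrow> depth v = 0 \<longleftrightarrow> v \<in> D"
  using in_reach_iff[of v 0] by simp

lemma D_reachable: "v \<in> D \<Longrightarrow> reachable v \<and> depth v = 0"
  using in_reach_iff[of v 0] by simp

lemma edge_depth: "reachable u \<Longrightarrow> {u, v} \<in> E \<Longrightarrow> reachable v \<and> depth v \<le> Suc (depth u)"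
  using reachable_in_reach[of u] in_reach_iff[of v "Suc (depth u)"] by auto

lemma par:
  assumes "reachable v" "depth v > 0"
  shows "{par v, v} \<in> E" "reachable (par v)" "Suc (depth (par v)) = depth v"
proof -
  obtain n where n: "depth v = Suc n" using assms(2) by (cases "depth v") auto
  have "v \<in> reach E (Suc n) D" using reachable_in_reach[OF assms(1)] n by simp
  moreover have "v \<notin> reach E n D" using depth_le[of v n] n by auto
  ultimately have "\<exists>u. {u, v} \<in> E \<and> u \<in> reach E n D" by auto
  then have *: "{par v, v} \<in> E \<and> par v \<in> reach E n D"
    unfolding par_def n diff_Suc_1 by (rule someI_ex)
  then show "{par v, v} \<in> E" by blast
  show r: "reachable (par v)" using * reachableI by blast
  have "depth (par v) \<le> n" using * depth_le by blast
  moreover have "depth v \<le> Suc (depth (par v))" using edge_depth[OF r] * by blast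
  ultimately show "Suc (depth (par v)) = depth v" using n by linarith
qed

lemma anc_rec: "reachable v \<Longrightarrow> depth v > 0 \<Longrightarrow> anc v = insert v (anc (par v))"
  using par(3)[of v] unfolding anc_def by (metis ancn.simps(2))

lemma root_rec: "reachable v \<Longrightarrow> depth v > 0 \<Longrightarrow> root (par v) = root v"
  using par(3)[of v] unfolding root_def by (metis rootn.simps(2))

lemma depth_induct [consumes 1, case_names root step]:
  assumes "reachable v"
    and "\<And>v. v \<in> D \<Longrightarrow> P v"
    and "\<And>v. reachable v \<Longrightarrow> depth v > 0 \<Longrightarrow> P (par v) \<Longrightarrow> P v"
  shows "P v"
  using assms(1)
proof (induction "depth v" arbitrary: v)
  case 0 then show ?case using assms(2) depth_0_iff by simp
next
  case (Suc n)
  then have d: "depth v > 0" by simp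
  show ?case
    using assms(3)[OF Suc.prems d] Suc.hyps(1)[of "par v"] par[OF Suc.prems d] Suc.hyps(2) by simp
qed

lemma root_D [simp]: "v \<in> D \<Longrightarrow> root v = v"
  using D_reachable by (simp add: root_def)

lemma anc_D [simp]: "v \<in> D \<Longrightarrow> anc v = {v}"
  using D_reachable by (simp add: anc_def)

lemma root_in_D: "reachable v \<Longrightarrow> root v \<in> D"
proof (induction rule: depth_induct)
  case (step v) then show ?case using root_rec[of v] by simp
qed simp

lemma anc_props:
  assumes "reachable v"
  shows "v \<in> anc v" "root v \<in> anc v" "finite (anc v)" "card (anc v) \<le> Suc (depth v)"
    "\<And>w. w \<in> anc v \<Longrightarrow> reachable w \<and> root w = root v"
    "\<And>w. w \<in> anc v \<Longrightarrow> w \<notin> D \<Longrightarrow> par w \<in> anc v"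
proof -
  have "v \<in> anc v \<and> root v \<in> anc v \<and> finite (anc v) \<and> card (anc v) \<le> Suc (depth v) \<and>
    (\<forall>w\<in>anc v. reachable w \<and> root w = root v) \<and> (\<forall>w\<in>anc v. w \<notin> D \<longrightarrow> par w \<in> anc v)"
    using assms
  proof (induction rule: depth_induct)
    case (root v) then show ?case using D_reachable by simp
  next
    case (step v)
    have "card (insert v (anc (par v))) \<le> Suc (card (anc (par v)))" by (rule card_insert_le_m1) simp_all
    then show ?case
      using step par(3)[OF step(1,2)] root_rec[OF step(1,2)] anc_rec[OF step(1,2)] by auto
  qed
  then show "v \<in> anc v" "root v \<in> anc v" "finite (anc v)" "card (anc v) \<le> Suc (depth v)"
    "\<And>w. w \<in> anc v \<Longrightarrow> reachable w \<and> root w = root v"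
    "\<And>w. w \<in> anc v \<Longrightarrow> w \<notin> D \<Longrightarrow> par w \<in> anc v" by blast+
qed

text \<open>The child is the deeper end of its parent edge.\<close>

lemma par_edge_inj: "inj_on (\<lambda>w. {par w, w}) {w. reachable w \<and> w \<notin> D}"
proof (rule inj_onI)
  fix w w' assume w: "w \<in> {w. reachable w \<and> w \<notin> D}" "w' \<in> {w. reachable w \<and> w \<notin> D}"
    and eq: "{par w, w} = {par w', w'}"
  have "depth w > 0" "depth w' > 0" using w depth_0_iff by auto
  then have "Suc (depth (par w)) = depth w" "Suc (depth (par w')) = depth w'" using par(3) w by auto
  moreover have "w = w' \<or> (w = par w' \<and> w' = par w)" using eq by (auto simp: doubleton_eq_iff)
  ultimately show "w = w'" by auto
qed

lemma tree_edge_same_root: "{u, v} \<in> tree_edges \<Longrightarrow> root u = root v"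
  unfolding tree_edges_def using root_rec by (auto simp: doubleton_eq_iff)

text \<open>A parent-closed vertex set \<open>A\<close> with \<open>r\<close> roots spans \<open>card A - r\<close> tree edges, so sparsity
  allows fewer than \<open>r\<close> further edges on it.\<close>
lemma few_extra_edges:
  assumes sp: "sparse E g"
    and A: "finite A" "\<And>w. w \<in> A \<Longrightarrow> reachable w" "\<And>w. w \<in> A \<Longrightarrow> w \<notin> D \<Longrightarrow> par w \<in> A"
    and X: "X \<subseteq> E" "X \<inter> tree_edges = {}" "X \<noteq> {}" "\<Union>X \<subseteq> A"
    and small: "card X + card (A - D) < g"
  shows "card X < card (A \<inter> D)"
proof -
  have finX: "finite X" using X(1) graph_finite_edges[OF G] finite_subset by blast
  define T where "T = (\<lambda>w. {par w, w}) ` (A - D)"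
  have dpos: "depth w > 0" if "w \<in> A - D" for w using that A(2) depth_0_iff[of w] by auto
  have T_tree: "T \<subseteq> tree_edges" using A(2) dpos unfolding T_def tree_edges_def by blast
  have TE: "T \<subseteq> E" using par(1) A(2) dpos unfolding T_def by blast
  have cT: "card T = card (A - D)" unfolding T_def
    by (intro card_image inj_on_subset[OF par_edge_inj]) (use A(2) in blast)
  have "finite T" using A(1) by (simp add: T_def)
  then have cF: "card (X \<union> T) = card X + card (A - D)"
    using card_Un_disjoint[OF finX, of T] X(2) T_tree cT by auto
  have UF: "\<Union>(X \<union> T) \<subseteq> A" using X(4) A(3) unfolding T_def by auto
  have "card (X \<union> T) < card (\<Union>(X \<union> T))"
    by (rule sp[unfolded sparse_def, rule_format]) (use X(1,3) TE small cF in auto)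
  also have "\<dots> \<le> card A" using UF A(1) by (rule card_mono[rotated])
  finally have "card X + card (A - D) < card A" using cF by simp
  moreover have "card (A \<inter> D) + card (A - D) = card A" using card_Int_Diff[OF A(1), of D] by simp
  ultimately show ?thesis by linarith
qed

text \<open>The ancestor paths of \<open>u\<close> and \<open>v\<close> end in the same root, so
  they form a parent-closed set with one root, on which \<open>few_extra_edges\<close> leaves no
  room for a non-tree edge.\<close>

lemma same_root_tree_edge:
  assumes sp: "sparse E g" and e: "{u, v} \<in> E" and r: "reachable u" "reachable v"
    and root: "root u = root v" and small: "depth u + depth v + 2 < g"
  shows "{u, v} \<in> tree_edges"
proof (rule ccontr)
  assume nt: "{u, v} \<notin> tree_edges"
  define A where "A = anc u \<union> anc v"
  note P = anc_props[OF r(1)] anc_props[OF r(2)]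
  have fin: "finite A" using P(3,9) by (simp add: A_def)
  have AD: "A \<inter> D = {root u}"
  proof
    show "A \<inter> D \<subseteq> {root u}"
    proof
      fix w assume w: "w \<in> A \<inter> D"
      then have "root w = root u" using P(5,11)[of w] root unfolding A_def by (elim IntE UnE) simp_all
      then show "w \<in> {root u}" using w by simp
    qed
    show "{root u} \<subseteq> A \<inter> D" using P(2) root_in_D[OF r(1)] by (simp add: A_def)
  qed
  have "card A \<le> card (anc u) + card (anc v)" unfolding A_def by (rule card_Un_le)
  then have cA: "card A \<le> depth u + depth v + 2" using P(4,10) by linarith
  have "card (A \<inter> D) + card (A - D) = card A" using card_Int_Diff[OF fin, of D] by simp
  then have cAD: "Suc (card (A - D)) = card A" using AD by simp
  have "card {{u, v}} < card (A \<inter> D)"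
  proof (rule few_extra_edges[OF sp fin])
    show "reachable w" if "w \<in> A" for w using that P(5,11)[of w] unfolding A_def by (elim UnE) simp_all
    show "par w \<in> A" if "w \<in> A" "w \<notin> D" for w using that P(6,12)[of w] unfolding A_def by (elim UnE) simp_all
    show "\<Union>{{u, v}} \<subseteq> A" using P(1,7) by (simp add: A_def)
  qed (use e nt cA cAD small in auto)
  then show False using AD by simp
qed

text \<open>The four ancestor paths have at most \<open>4 * n + 4\<close> vertices and only two
  roots, so at most one edge beyond the forest fits on them. This is where the girth has to exceed
  four times the radius.\<close>

lemma cross_edge_unique:
  assumes sp: "sparse E g" and e: "{u, v} \<in> E" "{u', v'} \<in> E"
    and r: "u \<in> reach E n D" "v \<in> reach E n D" "u' \<in> reach E n D" "v' \<in> reach E n D"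
    and root: "root u = root u'" "root v = root v'" "root u \<noteq> root v"
    and small: "4 * n + 4 < g"
  shows "{u, v} = {u', v'}"
proof (rule ccontr)
  assume ne: "{u, v} \<noteq> {u', v'}"
  have r': "reachable u" "reachable v" "reachable u'" "reachable v'"
    "depth u \<le> n" "depth v \<le> n" "depth u' \<le> n" "depth v' \<le> n" using r in_reach_iff by auto
  note P = anc_props[OF r'(1)] anc_props[OF r'(2)] anc_props[OF r'(3)] anc_props[OF r'(4)]
  define A where "A = (anc u \<union> anc v) \<union> (anc u' \<union> anc v')"
  have fin: "finite A" using P(3,9,15,21) by (simp add: A_def)
  have Aroot: "reachable w \<and> (root w = root u \<or> root w = root v)" if "w \<in> A" for w
    using that P(5,11,17,23)[of w] root(1,2) unfolding A_def by (elim UnE) simp_all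
  have AD: "A \<inter> D = {root u, root v}"
  proof
    show "A \<inter> D \<subseteq> {root u, root v}"
    proof
      fix w assume "w \<in> A \<inter> D"
      then show "w \<in> {root u, root v}" using Aroot[of w] by auto
    qed
    show "{root u, root v} \<subseteq> A \<inter> D" using P(2,8) root_in_D r' by (simp add: A_def)
  qed
  have "card A \<le> card (anc u \<union> anc v) + card (anc u' \<union> anc v')" unfolding A_def by (rule card_Un_le)
  also have "\<dots> \<le> (card (anc u) + card (anc v)) + (card (anc u') + card (anc v'))"
    by (intro add_mono card_Un_le)
  finally have cA: "card A \<le> 4 * n + 4" using P(4,10,16,22) r'(5-8) by linarith
  have "card (A \<inter> D) + card (A - D) = card A" using card_Int_Diff[OF fin, of D] by simp
  then have cAD: "card (A - D) + 2 = card A" using AD root(3) by simp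
  have nt: "{{u, v}, {u', v'}} \<inter> tree_edges = {}"
    using tree_edge_same_root[of u v] tree_edge_same_root[of u' v'] root by auto
  have "card {{u, v}, {u', v'}} < card (A \<inter> D)"
  proof (rule few_extra_edges[OF sp fin])
    show "reachable w" if "w \<in> A" for w using Aroot[OF that] by blast
    show "par w \<in> A" if "w \<in> A" "w \<notin> D" for w using that P(6,12,18,24)[of w] unfolding A_def by (elim UnE) simp_all
    show "\<Union>{{u, v}, {u', v'}} \<subseteq> A" using P(1,7,13,19) by (simp add: A_def)
    show "card {{u, v}, {u', v'}} + card (A - D) < g" using ne cA cAD small by simp
  qed (use e nt in auto)
  then show False using AD root(3) ne by simp
qed

end

text \<open>In the tree grown from \<open>x\<close>, a neighbour of \<open>v\<close> other than its
  parent is joined to \<open>v\<close> by a tree edge, hence is a child. With minimum degree three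
  every level at least doubles.\<close>

lemma ball_growth:
  assumes G: "graph V E" and deg: "\<And>v. v \<in> V \<Longrightarrow> 3 \<le> degree E v"
    and sp: "sparse E g" and x: "x \<in> V" and small: "2 * n + 1 < g"
  shows "2 ^ n \<le> card (reach E n {x})"
proof -
  interpret bfs V E "{x}" by unfold_locales (use G x in auto)
  have finV: "finite V" using G by (simp add: graph_def)
  define S where "S m = {v. reachable v \<and> depth v = m}" for m
  have finS: "finite (S m)" for m
    by (rule finite_subset[OF _ finV]) (auto simp: S_def reachable_V)
  have "2 ^ m \<le> card (S m)" if "m \<le> n" for m
    using that
  proof (induction m)
    case 0
    have "S 0 = {x}" using depth_0_iff D_reachable by (auto simp: S_def)
    then show ?case by simp
  next
    case (Suc m)
    define ch where "ch v = {w \<in> S (Suc m). par w = v}" for v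
    have ch2: "2 \<le> card (ch v)" if v: "v \<in> S m" for v
    proof -
      have rv: "reachable v" "depth v = m" using v by (auto simp: S_def)
      \<comment> \<open>At the root \<open>par v\<close> is unspecified; leaving it out costs at
        most one neighbour there too.\<close>
      have "nbs E v - {par v} \<subseteq> ch v"
      proof
        fix w assume "w \<in> nbs E v - {par v}"
        then have w: "{v, w} \<in> E" "w \<noteq> par v" by (auto simp: nbs_def insert_commute)
        have rw: "reachable w" "depth w \<le> Suc m" using edge_depth[OF rv(1) w(1)] rv by auto
        have "root v = root w" using root_in_D[OF rv(1)] root_in_D[OF rw(1)] by simp
        then have "{v, w} \<in> tree_edges"
          using same_root_tree_edge[OF sp w(1) rv(1) rw(1)] rv rw Suc.prems small by simp
        then obtain z where z: "{v, w} = {par z, z}" "reachable z" "depth z > 0"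
          unfolding tree_edges_def by auto
        then have "z = w" "par w = v" using w by (auto simp: doubleton_eq_iff)
        then show "w \<in> ch v" using z par(3)[of w] rv by (simp add: ch_def S_def)
      qed
      then have "card (nbs E v - {par v}) \<le> card (ch v)"
        using finS by (intro card_mono) (auto simp: ch_def)
      moreover have "card (nbs E v) - card {par v} \<le> card (nbs E v - {par v})"
        by (rule diff_card_le_card_Diff) simp
      ultimately show ?thesis using deg[OF reachable_V[OF rv(1)]] card_nbs[OF G, of v] by simp
    qed
    have "2 * card (S m) = (\<Sum>v\<in>S m. 2)" by simp
    also have "\<dots> \<le> (\<Sum>v\<in>S m. card (ch v))" by (rule sum_mono) (rule ch2)
    also have "\<dots> = card (\<Union>v\<in>S m. ch v)"
      using finS by (intro card_UN_disjoint[symmetric]) (auto simp: ch_def)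
    also have "\<dots> \<le> card (S (Suc m))" using finS by (intro card_mono) (auto simp: ch_def)
    finally show ?case using Suc by simp
  qed
  then have "2 ^ n \<le> card (S n)" by simp
  also have "\<dots> \<le> card (reach E n {x})"
  proof (rule card_mono)
    show "finite (reach E n {x})"
      by (rule finite_subset[OF reach_subset[OF G DV] finV])
    show "S n \<subseteq> reach E n {x}" using in_reach_iff by (auto simp: S_def)
  qed
  finally show ?thesis .
qed

section \<open>Dense minors in graphs of large girth\<close>

text \<open>Averaging: each point lies in at least \<open>M\<close> of the \<open>card V\<close>
  sets \<open>R x\<close>, so one of these sets captures a share \<open>M / card V\<close> of the
  weight that is still uncovered. The weights will be degrees, since it is edges that must not be
  lost.\<close>

lemma greedy_cover:
  fixes R :: "'a \<Rightarrow> 'a set" and w :: "'a \<Rightarrow> real"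
  assumes V: "finite V" "V \<noteq> {}" and w: "\<And>u. u \<in> V \<Longrightarrow> 0 \<le> w u"
    and M: "\<And>u. u \<in> V \<Longrightarrow> M \<le> card {x\<in>V. u \<in> R x}"
  shows "\<exists>D\<subseteq>V. card D \<le> j \<and> sum w (V - \<Union>(R ` D)) \<le> (1 - real M / real (card V)) ^ j * sum w V"
proof (induction j)
  case 0
  show ?case by (intro exI[of _ "{}"]) simp
next
  case (Suc j)
  then obtain D where D: "D \<subseteq> V" "card D \<le> j"
    "sum w (V - \<Union>(R ` D)) \<le> (1 - real M / real (card V)) ^ j * sum w V" by blast
  define n where "n = real (card V)"
  have n0: "n > 0" using V by (simp add: n_def card_gt_0_iff)
  define U where "U = V - \<Union>(R ` D)"
  have finU: "finite U" and UV: "U \<subseteq> V" using V by (auto simp: U_def)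
  have MV: "real M \<le> n"
  proof -
    obtain u where u: "u \<in> V" using V(2) by blast
    have "card {x\<in>V. u \<in> R x} \<le> card V" using V(1) by (intro card_mono) auto
    then show ?thesis using M[OF u] by (simp add: n_def)
  qed
  have "\<exists>x\<in>V. real M / n * sum w U \<le> sum w (R x \<inter> U)"
  proof (rule ccontr)
    assume "\<not> ?thesis"
    then have "(\<Sum>x\<in>V. sum w (R x \<inter> U)) < (\<Sum>x\<in>V. real M / n * sum w U)"
      using V by (intro sum_strict_mono) (auto simp: not_le)
    also have "\<dots> = real M * sum w U" using n0 by (simp add: n_def)
    also have "\<dots> = (\<Sum>u\<in>U. real M * w u)" by (simp add: sum_distrib_left)
    also have "\<dots> \<le> (\<Sum>u\<in>U. real (card {x\<in>V. u \<in> R x}) * w u)"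
      using M w UV by (intro sum_mono mult_right_mono) auto
    also have "\<dots> = (\<Sum>u\<in>U. \<Sum>x\<in>V. if u \<in> R x then w u else 0)"
    proof (rule sum.cong[OF refl])
      fix u
      have "(\<Sum>x\<in>V. if u \<in> R x then w u else 0) = (\<Sum>x\<in>{x\<in>V. u \<in> R x}. w u)"
        by (rule sum.inter_filter[OF V(1), symmetric])
      then show "real (card {x\<in>V. u \<in> R x}) * w u = (\<Sum>x\<in>V. if u \<in> R x then w u else 0)" by simp
    qed
    also have "\<dots> = (\<Sum>x\<in>V. \<Sum>u\<in>U. if u \<in> R x then w u else 0)" by (rule sum.swap)
    also have "\<dots> = (\<Sum>x\<in>V. sum w (R x \<inter> U))"
    proof (rule sum.cong[OF refl])
      fix x
      have "R x \<inter> U = {u\<in>U. u \<in> R x}" by blast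
      then show "(\<Sum>u\<in>U. if u \<in> R x then w u else 0) = sum w (R x \<inter> U)"
        using sum.inter_filter[OF finU, of w "\<lambda>u. u \<in> R x"] by simp
    qed
    finally show False by simp
  qed
  then obtain x where x: "x \<in> V" "real M / n * sum w U \<le> sum w (R x \<inter> U)" by blast
  have "V - \<Union>(R ` insert x D) = U - (R x \<inter> U)" by (auto simp: U_def)
  then have "sum w (V - \<Union>(R ` insert x D)) = sum w U - sum w (R x \<inter> U)"
    using finU by (simp add: sum_diff)
  also have "\<dots> \<le> (1 - real M / n) * sum w U" using x(2) by (simp add: algebra_simps)
  also have "\<dots> \<le> (1 - real M / n) * ((1 - real M / n) ^ j * sum w V)"
    using D(3) MV n0 by (intro mult_left_mono) (auto simp: U_def n_def)
  finally have "sum w (V - \<Union>(R ` insert x D)) \<le> (1 - real M / n) ^ Suc j * sum w V" by (simp add: mult_ac)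
  moreover have "card (insert x D) \<le> Suc j" by (rule card_insert_le_m1) (use D(2) in simp_all)
  ultimately show ?case using x(1) D(1) by (intro exI[of _ "insert x D"]) (simp add: n_def)
qed

lemma dominating_set:
  assumes G: "graph V E" and V0: "V \<noteq> {}" and deg: "\<And>v. v \<in> V \<Longrightarrow> 3 \<le> degree E v"
    and sp: "sparse E g" and small: "2 * n + 1 < g"
  obtains D where "D \<subseteq> V" "2 ^ n * card D \<le> 4 * card V"
    "6 * (\<Sum>v\<in>V - reach E n D. degree E v) \<le> card E"
proof -
  have finV: "finite V" using G by (simp add: graph_def)
  define N where "N = real (card V)"
  define M where "M = (2::nat) ^ n"
  have N0: "N > 0" using finV V0 by (simp add: N_def card_gt_0_iff)
  have ball: "M \<le> card {x\<in>V. u \<in> reach E n {x}}" if u: "u \<in> V" for u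
  proof -
    have "M \<le> card (reach E n {u})" unfolding M_def by (rule ball_growth[OF G deg sp u small])
    also have "\<dots> \<le> card {x\<in>V. u \<in> reach E n {x}}"
      using finV reach_subset[OF G, of "{u}" n] u by (intro card_mono) (auto intro: reach_sym)
    finally show ?thesis .
  qed
  have MN: "real M \<le> N"
  proof -
    obtain u where u: "u \<in> V" using V0 by blast
    have "card {x\<in>V. u \<in> reach E n {x}} \<le> card V" using finV by (intro card_mono) auto
    then show ?thesis using ball[OF u] by (simp add: N_def)
  qed
  have M0: "real M > 0" by (simp add: M_def)
  \<comment> \<open>About 3 N / M rounds leave a share exp (-3) of the degree sum, at most 1/12;
    rounding up adds at most one round, and by \<open>MN\<close> the product of M and j stays at
    most 4 N.\<close>
  define j where "j = nat \<lceil>3 * N / real M\<rceil>"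
  have jl: "3 * N / real M \<le> real j" unfolding j_def by linarith
  have "real j \<le> 3 * N / real M + 1" unfolding j_def using N0 M0
    by simp
  then have "real j * real M \<le> 3 * N + real M" using M0 by (simp add: field_simps)
  then have ju: "real M * real j \<le> 4 * N" using MN by (simp add: mult.commute)
  obtain D where D: "D \<subseteq> V" "card D \<le> j"
    "sum (\<lambda>v. real (degree E v)) (V - \<Union>((\<lambda>x. reach E n {x}) ` D))
       \<le> (1 - real M / real (card V)) ^ j * sum (\<lambda>v. real (degree E v)) V"
    using greedy_cover[OF finV V0 _ ball, where w = "\<lambda>v. real (degree E v)" and j = j] by auto
  have "(1 - real M / N) ^ j \<le> exp (- (real M / N)) ^ j"
    using exp_ge_add_one_self[of "- (real M / N)"] MN N0 by (intro power_mono) auto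
  also have "\<dots> = exp (- (real j * (real M / N)))" by (simp flip: exp_of_nat_mult)
  also have "\<dots> \<le> exp (- 3)"
    using jl M0 N0 by (simp add: field_simps)
  also have "exp (- 3) \<le> (1 / 12 :: real)"
  proof -
    \<comment> \<open>From e \<ge> 1 + 1 + 1/2; already (5/2)^3 exceeds 12.\<close>
    have "(5/2::real) ^ 3 \<le> exp 1 ^ 3"
      using exp_lower_Taylor_quadratic[of "1::real"] by (intro power_mono) auto
    also have "\<dots> = exp (3::real)" by (simp flip: exp_of_nat_mult)
    finally have "12 \<le> exp (3::real)" by (simp add: power3_eq_cube)
    then show ?thesis by (simp add: exp_minus field_simps)
  qed
  finally have small_pow: "(1 - real M / N) ^ j \<le> 1 / 12" .
  have "(\<Sum>v\<in>V. real (degree E v)) = 2 * real (card E)"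
    using handshake[OF G] by (metis of_nat_mult of_nat_numeral of_nat_sum)
  moreover have "(\<Union>((\<lambda>x. reach E n {x}) ` D)) = reach E n D" using reach_UN[of E n D] by simp
  ultimately have "(\<Sum>v\<in>V - reach E n D. real (degree E v)) \<le> (1 - real M / N) ^ j * (2 * real (card E))"
    using D(3) by (simp add: N_def)
  also have "\<dots> \<le> 1 / 12 * (2 * real (card E))" using small_pow by (intro mult_right_mono) auto
  finally have "6 * (\<Sum>v\<in>V - reach E n D. real (degree E v)) \<le> real (card E)" by simp
  then have "real (6 * (\<Sum>v\<in>V - reach E n D. degree E v)) \<le> real (card E)" by simp
  then have "6 * (\<Sum>v\<in>V - reach E n D. degree E v) \<le> card E" by (simp only: of_nat_le_iff)
  moreover have "2 ^ n * card D \<le> 4 * card V"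
  proof -
    have "real (M * card D) \<le> real M * real j" using D(2) by (simp add: mult_left_mono)
    also note ju
    finally have "real (M * card D) \<le> real (4 * card V)" by (simp add: N_def)
    then show ?thesis by (simp only: of_nat_le_iff M_def)
  qed
  ultimately show thesis using that D(1) by blast
qed

text \<open>The Kuehn--Osthus argument: contract the breadth-first trees grown from a sparse dominating set.
  Their radius is only a quarter of the girth, so distinct edges between trees stay distinct.\<close>
theorem dense_quotient:
  fixes V :: "'a set"
  assumes G: "graph V E" and V0: "V \<noteq> {}" and deg: "\<And>v. v \<in> V \<Longrightarrow> 3 \<le> degree E v"
    and sp: "sparse E g" and small: "4 * n + 4 < g"
  obtains D :: "'a set" and F where "graph D F" "D \<noteq> {}" "2 ^ n * card D \<le> 16 * card F"
    "\<forall>k. has_complete_minor k D F \<longrightarrow> has_complete_minor k V E"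
proof -
  have finV: "finite V" using G by (simp add: graph_def)
  have finE: "finite E" by (rule graph_finite_edges[OF G])
  have "2 * n + 1 < g" using small by simp
  from dominating_set[OF G V0 deg sp this] obtain D where D: "D \<subseteq> V"
    "2 ^ n * card D \<le> 4 * card V" "6 * (\<Sum>v\<in>V - reach E n D. degree E v) \<le> card E" by blast
  interpret bfs V E D by unfold_locales (use G D in auto)
  define W where "W = reach E n D"
  have WV: "W \<subseteq> V" unfolding W_def by (rule reach_subset[OF G DV])
  have W: "reachable v" "depth v \<le> n" if "v \<in> W" for v using that in_reach_iff by (auto simp: W_def)
  \<comment> \<open>\<open>EU\<close> collects the edges not inside the covered part,
    \<open>ET\<close> those within one tree and \<open>EC\<close> those between trees; only the last
    survive the contraction.\<close>
  define EU where "EU = {e\<in>E. \<not> e \<subseteq> W}"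
  define ET where "ET = {e\<in>E. e \<subseteq> W \<and> card (root ` e) = 1}"
  define EC where "EC = {e\<in>E. e \<subseteq> W \<and> card (root ` e) \<noteq> 1}"
  have "card EU \<le> (\<Sum>v\<in>V - W. degree E v)"
  proof -
    have "EU \<subseteq> (\<Union>v\<in>V - W. {e\<in>E. v \<in> e})"
    proof
      fix e assume e: "e \<in> EU"
      then obtain v where "v \<in> e" "v \<notin> W" by (auto simp: EU_def)
      moreover have "e \<subseteq> V" using e by (auto simp: EU_def elim!: graph_edgeE[OF G])
      ultimately show "e \<in> (\<Union>v\<in>V - W. {e\<in>E. v \<in> e})" using e by (auto simp: EU_def)
    qed
    then have "card EU \<le> card (\<Union>v\<in>V - W. {e\<in>E. v \<in> e})"
      using finV finE by (intro card_mono) auto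
    also have "\<dots> \<le> (\<Sum>v\<in>V - W. card {e\<in>E. v \<in> e})" using finV by (intro card_UN_le) auto
    finally show ?thesis by (simp add: degree_def)
  qed
  then have cU: "6 * card EU \<le> card E" using D(3) by (simp add: W_def)
  have cT: "card ET \<le> card V"
  proof -
    have "ET \<subseteq> (\<lambda>w. {par w, w}) ` V"
    proof
      fix e assume e: "e \<in> ET"
      then obtain u v where uv: "e = {u, v}" "u \<noteq> v" by (auto simp: ET_def elim!: graph_edgeE[OF G])
      have uvW: "u \<in> W" "v \<in> W" "{u, v} \<in> E" using e uv by (auto simp: ET_def)
      have "root u = root v"
        using e uv by (auto simp: ET_def card_insert_if split: if_splits)
      then have "{u, v} \<in> tree_edges"
        using same_root_tree_edge[OF sp uvW(3)] W[OF uvW(1)] W[OF uvW(2)] small by simp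
      then show "e \<in> (\<lambda>w. {par w, w}) ` V" using uv reachable_V by (auto simp: tree_edges_def)
    qed
    then show ?thesis using finV by (meson card_image_le card_mono finite_imageI order_trans)
  qed
  have ECE: "\<exists>u v. e = {u, v} \<and> {u, v} \<in> E \<and> u \<in> W \<and> v \<in> W \<and> root u \<noteq> root v" if "e \<in> EC" for e
  proof -
    have "e \<in> E" using that by (simp add: EC_def)
    then obtain u v where "e = {u, v}" by (auto elim!: graph_edgeE[OF G])
    then show ?thesis using that by (intro exI[of _ u] exI[of _ v]) (auto simp: EC_def)
  qed
  have "E = EU \<union> (ET \<union> EC)" by (auto simp: EU_def ET_def EC_def)
  then have "card E \<le> card EU + (card ET + card EC)"
    using card_Un_le[of EU "ET \<union> EC"] card_Un_le[of ET EC] by simp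
  moreover have "3 * card V \<le> 2 * card E"
  proof -
    have "3 * card V = (\<Sum>v\<in>V. 3)" by simp
    also have "\<dots> \<le> (\<Sum>v\<in>V. degree E v)" by (rule sum_mono) (rule deg)
    finally show ?thesis using handshake[OF G] by simp
  qed
  \<comment> \<open>\<open>card EC\<close> is at least 5/6 of \<open>card E\<close> minus
    \<open>card V\<close>, and 5/6 times 3/2 is 5/4, so a quarter of \<open>card V\<close>
    remains.\<close>
  ultimately have cX: "card V \<le> 4 * card EC" using cU cT by linarith
  define F where "F = (`) root ` EC"
  have "inj_on ((`) root) EC"
  proof (rule inj_onI)
    fix e e' assume ee: "e \<in> EC" "e' \<in> EC" and eq: "root ` e = root ` e'"
    obtain u v where uv: "e = {u, v}" "{u, v} \<in> E" "u \<in> W" "v \<in> W" "root u \<noteq> root v"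
      using ECE[OF ee(1)] by blast
    obtain u' v' where uv': "e' = {u', v'}" "{u', v'} \<in> E" "u' \<in> W" "v' \<in> W"
      using ECE[OF ee(2)] by blast
    have "{root u, root v} = {root u', root v'}" using eq uv uv' by simp
    then consider "root u = root u'" "root v = root v'" | "root u = root v'" "root v = root u'"
      by (auto simp: doubleton_eq_iff)
    then have "{u, v} = {u', v'}"
    proof cases
      case 1
      show ?thesis
        by (rule cross_edge_unique[OF sp uv(2) uv'(2) _ _ _ _ 1 uv(5) small]) (use uv uv' in \<open>auto simp: W_def\<close>)
    next
      case 2
      have "{v', u'} \<in> E" using uv'(2) by (simp add: insert_commute)
      then have "{u, v} = {v', u'}"
        by (rule cross_edge_unique[OF sp uv(2) _ _ _ _ _ 2 uv(5) small]) (use uv uv' in \<open>auto simp: W_def\<close>)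
      then show ?thesis by (simp add: insert_commute)
    qed
    then show "e = e'" using uv uv' by simp
  qed
  then have cF: "card F = card EC" by (simp add: F_def card_image)
  have FE: "\<exists>u v. e = {root u, root v} \<and> {u, v} \<in> E \<and> u \<in> W \<and> v \<in> W \<and> root u \<noteq> root v"
    if eF: "e \<in> F" for e
  proof -
    obtain e' where e': "e' \<in> EC" "e = root ` e'" using eF unfolding F_def by blast
    obtain u v where "e' = {u, v}" "{u, v} \<in> E" "u \<in> W" "v \<in> W" "root u \<noteq> root v"
      using ECE[OF e'(1)] by blast
    then show ?thesis using e'(2) by (intro exI[of _ u] exI[of _ v]) simp
  qed
  have rD: "root u \<in> D" if "u \<in> W" for u using root_in_D W[OF that] by blast
  have GD: "graph D F" unfolding graph_def
  proof (intro conjI ballI)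
    show "finite D" using finV DV finite_subset by blast
    fix e assume "e \<in> F"
    from FE[OF this] show "\<exists>u v. e = {u, v} \<and> u \<noteq> v \<and> u \<in> D \<and> v \<in> D" using rD by blast
  qed
  have V1: "card V \<ge> 1" using finV V0 by (simp add: Suc_le_eq card_gt_0_iff)
  have "card F \<ge> 1" using cX cF V1 by linarith
  then have "F \<noteq> {}" by auto
  then obtain e where "e \<in> F" by blast
  from FE[OF this] have D0: "D \<noteq> {}" using rD by blast
  have bound: "2 ^ n * card D \<le> 16 * card F" using D(2) cX cF by linarith
  have minor: "has_complete_minor k V E" if "has_complete_minor k D F" for k
  proof (rule complete_minor_quotient[where fib = "\<lambda>c. {v\<in>W. root v = c}", OF that])
    fix c assume c: "c \<in> D"
    have cW: "c \<in> {v\<in>W. root v = c}" using c in_reach_iff[of c n] D_reachable[OF c] by (simp add: W_def)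
    have "induced_connected E {v\<in>W. root v = c}"
    proof (rule induced_connectedI[where c = c])
      fix v assume v: "v \<in> {v\<in>W. root v = c}"
      have "reachable v" using v W by simp
      then have "v \<in> W \<longrightarrow> root v = c \<longrightarrow> (step_in E {v\<in>W. root v = c})\<^sup>*\<^sup>* c v"
      proof (induction rule: depth_induct)
        case (root v) then show ?case by simp
      next
        case (step v)
        show ?case
        proof (intro impI)
          assume v: "v \<in> W" "root v = c"
          have pW: "par v \<in> W" using par(2,3)[OF step(1,2)] W[OF v(1)] in_reach_iff by (simp add: W_def)
          have pr: "root (par v) = c" using root_rec[OF step(1,2)] v by simp
          have "step_in E {v\<in>W. root v = c} (par v) v" using pW pr v par(1)[OF step(1,2)] by simp
          moreover have "(step_in E {v\<in>W. root v = c})\<^sup>*\<^sup>* c (par v)" using step(3) pW pr by blast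
          ultimately show "(step_in E {v\<in>W. root v = c})\<^sup>*\<^sup>* c v"
            by (rule rtranclp.rtrancl_into_rtrancl[rotated])
        qed
      qed
      then show "(step_in E {v\<in>W. root v = c})\<^sup>*\<^sup>* c v" using v by simp
    qed
    then show "{v\<in>W. root v = c} \<noteq> {} \<and> {v\<in>W. root v = c} \<subseteq> V \<and> induced_connected E {v\<in>W. root v = c}"
      using cW WV by blast
  next
    fix c c' assume "{c, c'} \<in> F"
    from FE[OF this] obtain u v where uv: "{c, c'} = {root u, root v}" "{u, v} \<in> E" "u \<in> W" "v \<in> W" by blast
    then consider "c = root u" "c' = root v" | "c = root v" "c' = root u" by (auto simp: doubleton_eq_iff)
    then show "\<exists>u\<in>{v\<in>W. root v = c}. \<exists>v\<in>{v\<in>W. root v = c'}. {u, v} \<in> E"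
    proof cases
      case 1 then show ?thesis using uv by (intro bexI[of _ u] bexI[of _ v]) auto
    next
      case 2 then show ?thesis using uv by (intro bexI[of _ v] bexI[of _ u]) (auto simp: insert_commute)
    qed
  qed auto
  show thesis by (rule that[OF GD D0 bound]) (use minor in simp)
qed

section \<open>Cycles in edge sets\<close>

lemma has_cycle_len_mono:
  "has_cycle_len V E l \<Longrightarrow> V \<subseteq> V' \<Longrightarrow> E \<subseteq> E' \<Longrightarrow> has_cycle_len V' E' l"
  unfolding has_cycle_len_def by (elim exE conjE) (rule exI, intro conjI; (assumption | blast))

lemma has_cycle_len_le:
  assumes "has_cycle_len V E l" "finite V" shows "l \<le> card V"
proof -
  obtain vs where "length vs = l" "distinct vs" "set vs \<subseteq> V"
    using assms(1) unfolding has_cycle_len_def by (elim exE conjE) (rule that)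
  then show ?thesis using card_mono[OF assms(2), of "set vs"] distinct_card[of vs] by simp
qed

text \<open>On a longest path all neighbours of the first vertex lie on the path, and one other than
  the second vertex closes a cycle.\<close>

lemma leafless_has_cycle:
  assumes G: "graph V F" and F0: "F \<noteq> {}" and deg: "\<And>v. v \<in> \<Union>F \<Longrightarrow> 2 \<le> degree F v"
  shows "\<exists>l. has_cycle_len (\<Union>F) F l"
proof -
  have finU: "finite (\<Union>F)"
    using graph_finite_edges[OF G] by (auto elim!: graph_edgeE[OF G])
  define P where "P vs \<longleftrightarrow> vs \<noteq> [] \<and> distinct vs \<and> set vs \<subseteq> \<Union>F \<and> successively (\<lambda>x y. {x, y} \<in> F) vs" for vs
  obtain e where e: "e \<in> F" using F0 by blast
  then obtain a b where "e = {a, b}" by (rule graph_edgeE[OF G])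
  then have a: "a \<in> \<Union>F" using e by auto
  have "P [a]" using a by (simp add: P_def)
  moreover have "length vs \<le> card (\<Union>F)" if "P vs" for vs
    using that finU card_mono[of "\<Union>F" "set vs"] distinct_card[of vs] by (simp add: P_def)
  ultimately obtain vs where vs: "P vs" "\<And>ws. P ws \<Longrightarrow> length ws \<le> length vs"
    using ex_has_greatest_nat[of P "[a]" length "Suc (card (\<Union>F))"] by (metis le_imp_less_Suc)
  obtain x xs where x: "vs = x # xs" using vs(1) by (cases vs) (auto simp: P_def)
  have sub: "nbs F x \<subseteq> set xs"
  proof
    fix u assume u: "u \<in> nbs F x"
    have "u \<noteq> x" using u nbs_subset[OF G, of x] by blast
    moreover have "u \<in> set vs"
    proof (rule ccontr)
      assume "u \<notin> set vs"
      then have "P (u # vs)" using vs(1) u x by (auto simp: P_def nbs_def successively_Cons)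
      then show False using vs(2)[of "u # vs"] by simp
    qed
    ultimately show "u \<in> set xs" using x by simp
  qed
  have "x \<in> \<Union>F" using vs(1) x by (simp add: P_def)
  then have c2: "2 \<le> card (nbs F x)" using deg card_nbs[OF G, of x] by simp
  then have "\<not> nbs F x \<subseteq> {vs ! 1}"
    using card_mono[of "{vs ! 1}" "nbs F x"] by auto
  then obtain u where u: "u \<in> nbs F x" "u \<noteq> vs ! 1" by auto
  then obtain i where i: "i < length xs" "xs ! i = u" using sub by (metis in_set_conv_nth subsetD)
  define j where "j = Suc i"
  have j: "j < length vs" "vs ! j = u" "2 \<le> j" using i u x by (auto simp: j_def numeral_2_eq_2 Suc_le_eq)
      (metis gr0I)
  have edge: "{vs ! m, vs ! Suc m} \<in> F" if "Suc m < length vs" for m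
    using vs(1) that by (auto simp: P_def dest: successively_nth)
  have "has_cycle_len (\<Union>F) F (Suc j)"
    unfolding has_cycle_len_def
  proof (intro exI[of _ "take (Suc j) vs"] conjI allI impI)
    show "length (take (Suc j) vs) = Suc j" "3 \<le> Suc j" using j by auto
    show "distinct (take (Suc j) vs)" "set (take (Suc j) vs) \<subseteq> \<Union>F"
      using vs(1) set_take_subset[of "Suc j" vs] by (auto simp: P_def)
    fix m assume m: "m < Suc j"
    show "{take (Suc j) vs ! m, take (Suc j) vs ! ((m + 1) mod Suc j)} \<in> F"
    proof (cases "m = j")
      case True
      then show ?thesis using j u(1) x by (simp add: nbs_def)
    next
      case False
      then have "Suc m < Suc j" using m by simp
      then show ?thesis using edge[of m] j by simp
    qed
  qed
  then show ?thesis ..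
qed

text \<open>Deleting a leaf with its edge removes at least as many vertices as edges, so the
  hypothesis persists until no leaf is left. A cycle found then has at most as many vertices as
  there are. This connects the counting form of girth with \<open>has_cycle_len\<close>.\<close>

lemma cyclic_has_cycle:
  assumes "graph V F" "F \<noteq> {}" "card (\<Union>F) \<le> card F"
  shows "\<exists>l\<le>card F. has_cycle_len (\<Union>F) F l"
  using assms
proof (induction "card F" arbitrary: F)
  case 0
  have "finite F" by (rule graph_finite_edges[OF 0(2)])
  then show ?case using 0 by simp
next
  case (Suc n)
  note G = Suc.prems(1)
  have finF: "finite F" by (rule graph_finite_edges[OF G])
  have finU: "finite (\<Union>F)" using finF by (auto elim!: graph_edgeE[OF G])
  show ?case
  proof (cases "\<forall>v\<in>\<Union>F. 2 \<le> degree F v")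
    case True
    then obtain l where "has_cycle_len (\<Union>F) F l" using leafless_has_cycle[OF G Suc.prems(2)] by blast
    then show ?thesis using has_cycle_len_le[OF _ finU] Suc.prems(3) by (meson order_trans)
  next
    case False
    then obtain v e0 where v: "e0 \<in> F" "v \<in> e0" "degree F v < 2" by auto
    have "card {e\<in>F. v \<in> e} \<noteq> 0" using v finF by auto
    then have "card {e\<in>F. v \<in> e} = 1" using v(3) unfolding degree_def by linarith
    then obtain e where e: "{e\<in>F. v \<in> e} = {e}" by (rule card_1_singletonE)
    then have eF: "e \<in> F" "v \<in> e" by blast+
    define F' where "F' = F - {e}"
    have cF': "card F' = n" using eF finF Suc.hyps(2) by (simp add: F'_def)
    have "\<Union>F' \<subseteq> \<Union>F - {v}" using e by (auto simp: F'_def)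
    then have "card (\<Union>F') \<le> card (\<Union>F - {v})" using finU by (intro card_mono) auto
    also have "\<dots> = card (\<Union>F) - 1" using eF finU by (intro card_Diff_singleton) auto
    finally have cU: "card (\<Union>F') \<le> card F'" using cF' Suc.prems(3) Suc.hyps(2) by linarith
    have "F' \<noteq> {}"
    proof
      assume "F' = {}"
      then have "F = {e}" using eF by (auto simp: F'_def)
      then show False using Suc.prems(3) graph_card_edge[OF G eF(1)] by simp
    qed
    moreover have "graph V F'" using G by (simp add: graph_def F'_def)
    ultimately obtain l where l: "l \<le> card F'" "has_cycle_len (\<Union>F') F' l"
      using Suc.hyps(1)[of F'] cF' cU by auto
    have "has_cycle_len (\<Union>F) F l"
      by (rule has_cycle_len_mono[OF l(2)]) (auto simp: F'_def)
    then show ?thesis using l(1) cF' Suc.hyps(2) by (intro exI[of _ l]) simp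
  qed
qed

section \<open>Reduction to minimum degree three\<close>

lemma graph_del_verts: "graph V E \<Longrightarrow> graph (fst (del_verts X (V, E))) (snd (del_verts X (V, E)))"
proof -
  assume G: "graph V E"
  have "\<exists>u v. e = {u, v} \<and> u \<noteq> v \<and> u \<in> V - X \<and> v \<in> V - X" if "e \<in> E" "e \<inter> X = {}" for e
    using that by (auto elim!: graph_edgeE[OF G])
  then show ?thesis using G by (simp add: graph_def del_verts_def)
qed

text \<open>For p \<ge> 2 an ear that may be deleted has an inner vertex, so every reduction shrinks
  the graph; an ear of length one would delete nothing.\<close>

lemma p_reduction_del_verts:
  assumes "p_reduction p (V, E) H" "p \<ge> 2"
  obtains X where "X \<noteq> {}" "X \<subseteq> V" "H = del_verts X (V, E)"
proof -
  from assms(1) consider v where "v \<in> V" "H = del_verts {v} (V, E)"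
    | vs where "strict_ear V E vs" "length vs - 1 \<ge> p" "H = del_verts (set (butlast (tl vs))) (V, E)"
    unfolding p_reduction_def by auto
  then show thesis
  proof cases
    case 1 then show thesis using that[of "{v}"] by simp
  next
    case 2
    have "set (butlast (tl vs)) \<noteq> {}" using 2(2) assms(2) by (cases vs) (auto simp: butlast_conv_take)
    moreover have "set (butlast (tl vs)) \<subseteq> V"
    proof -
      have "set (butlast (tl vs)) \<subseteq> set vs" by (cases vs) (auto dest: in_set_butlastD)
      then show ?thesis using 2(1) by (auto simp: strict_ear_def is_path_def)
    qed
    ultimately show thesis using 2(3) by (rule that)
  qed
qed

lemma reduced_core:
  assumes "graph V E" "\<not> p_path_degenerate p V E" "p \<ge> 2"
  shows "\<exists>V' E'. V' \<subseteq> V \<and> E' \<subseteq> E \<and> graph V' E' \<and> V' \<noteq> {} \<and> (\<forall>H. \<not> p_reduction p (V', E') H)"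
  using assms
proof (induction "card V" arbitrary: V E rule: less_induct)
  case less
  show ?case
  proof (cases "\<exists>H. p_reduction p (V, E) H")
    case False
    have "V \<noteq> {}"
    proof
      assume V: "V = {}"
      then have "E = {}" using less.prems(1) by (auto simp: graph_def)
      then show False using less.prems(2) V by (simp add: p_path_degenerate_def)
    qed
    then show ?thesis using False less.prems(1) by (intro exI[of _ V] exI[of _ E]) auto
  next
    case True
    then obtain H where H: "p_reduction p (V, E) H" by blast
    obtain X where X: "X \<noteq> {}" "X \<subseteq> V" "H = del_verts X (V, E)"
      by (rule p_reduction_del_verts[OF H less.prems(3)])
    obtain V1 E1 where H1: "H = (V1, E1)" by (cases H)
    have V1: "V1 = V - X" "E1 \<subseteq> E" using X(3) H1 by (auto simp: del_verts_def)
    have "card V1 < card V" unfolding V1(1) using X less.prems(1)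
      by (intro psubset_card_mono) (auto simp: graph_def)
    moreover have "graph V1 E1" using graph_del_verts[OF less.prems(1), of X] unfolding X(3)[symmetric] H1 by simp
    moreover have "\<not> p_path_degenerate p V1 E1"
      using less.prems(2) H unfolding p_path_degenerate_def H1 by (meson converse_rtranclp_into_rtranclp)
    ultimately obtain V' E' where "V' \<subseteq> V1" "E' \<subseteq> E1" "graph V' E'" "V' \<noteq> {}"
      "\<forall>H. \<not> p_reduction p (V', E') H" using less.hyps[of V1 E1] less.prems(3) by blast
    then show ?thesis using V1 by (intro exI[of _ V'] exI[of _ E']) auto
  qed
qed

section \<open>Weighted paths and suppression of vertices of degree two\<close>

fun plen :: "('a set \<Rightarrow> nat) \<Rightarrow> 'a list \<Rightarrow> nat" where
  "plen len (x # y # xs) = len {x, y} + plen len (y # xs)"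
| "plen len _ = 0"

lemma plen_append: "plen len (xs @ x # y # ys) = plen len (xs @ [x]) + len {x, y} + plen len (y # ys)"
proof (induction xs)
  case (Cons z zs) then show ?case by (cases zs) auto
qed simp

lemma plen_cong: "successively (\<lambda>x y. len {x, y} = len' {x, y}) xs \<Longrightarrow> plen len xs = plen len' xs"
  by (induction len xs rule: plen.induct) auto

lemma plen_const: "plen (\<lambda>_. 1) xs = length xs - 1"
  by (induction "\<lambda>_::'a set. 1::nat" xs rule: plen.induct) auto

lemma not_successively_split:
  "\<not> successively P xs \<Longrightarrow> \<exists>us x y vs. xs = us @ x # y # vs \<and> \<not> P x y"
proof (induction xs)
  case (Cons a xs)
  show ?case
  proof (cases "successively P xs")
    case True
    then obtain b ys where "xs = b # ys" "\<not> P a b" using Cons.prems by (cases xs) auto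
    then show ?thesis by (intro exI[of _ "[]"]) auto
  next
    case False
    then obtain us x y vs where "xs = us @ x # y # vs" "\<not> P x y" using Cons.IH by blast
    then show ?thesis by (intro exI[of _ "a # us"]) auto
  qed
qed simp

text \<open>For the two halves of a path split at an edge \<open>e\<close>: each half misses one end
  of \<open>e\<close>, so it does not use \<open>e\<close> again.\<close>

lemma successively_avoid:
  assumes "successively P xs" "d \<notin> set xs" "d \<in> e"
  shows "successively (\<lambda>x y. P x y \<and> {x, y} \<noteq> e) xs"
  using assms(1,2) by (induction xs rule: induct_list012) (use assms(3) in auto)

text \<open>\<open>strict_ear\<close> in a form suited to inserting a vertex; the ends differ
  because the list is distinct with at least two entries.\<close>

definition ear :: "'a set set \<Rightarrow> 'a list \<Rightarrow> bool" where
  "ear E vs \<longleftrightarrow> distinct vs \<and> length vs \<ge> 2 \<and> successively (\<lambda>x y. {x, y} \<in> E) vs \<and>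
     (\<forall>v\<in>set vs. v \<noteq> hd vs \<longrightarrow> v \<noteq> last vs \<longrightarrow> degree E v = 2)"

text \<open>A graph obtained from a reduced one by suppressing vertices of degree two; \<open>len e\<close> is the number
  of original edges that \<open>e\<close> stands for, \<open>q\<close> bounds the length of ears and \<open>g\<close> the girth.\<close>
definition suppressed :: "nat \<Rightarrow> nat \<Rightarrow> 'a set \<Rightarrow> 'a set set \<Rightarrow> ('a set \<Rightarrow> nat) \<Rightarrow> bool" where
  "suppressed q g V E len \<longleftrightarrow> graph V E \<and> V \<noteq> {} \<and> (\<forall>v\<in>V. 2 \<le> degree E v) \<and>
     (\<forall>F\<subseteq>E. F \<noteq> {} \<longrightarrow> card (\<Union>F) \<le> card F \<longrightarrow> g \<le> sum len F) \<and>
     (\<forall>vs. ear E vs \<longrightarrow> plen len vs \<le> q)"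

lemma suppressed_edge:
  assumes "suppressed q g V E len" "e \<in> E" shows "len e \<le> q"
proof -
  obtain u v where "e = {u, v}" "u \<noteq> v"
    using assms by (auto simp: suppressed_def elim!: graph_edgeE)
  moreover have "ear E [u, v]" using calculation assms(2) by (simp add: ear_def)
  ultimately show ?thesis using assms(1) unfolding suppressed_def by fastforce
qed

text \<open>Suppression is contraction of \<open>{a, v}\<close>, with the edge \<open>{a, b}\<close>
  inheriting both lengths. That edge is new, since a triangle would have length at most
  \<open>3 * q\<close>. Edge sets and ears that use \<open>{a, b}\<close> are compared with those
  obtained by restoring \<open>v\<close>.\<close>

lemma suppress_step:
  fixes V :: "'a set"
  assumes S: "suppressed q g V E len" and g: "3 * q < g" and v: "v \<in> V" "degree E v = 2"
  obtains V' :: "'a set" and E' len' where "suppressed q g V' E' len'" "card V' < card V"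
    "\<forall>k. has_complete_minor k V' E' \<longrightarrow> has_complete_minor k V E"
proof -
  have G: "graph V E" and deg2: "\<And>v. v \<in> V \<Longrightarrow> 2 \<le> degree E v"
    and heavy: "\<And>F. F \<subseteq> E \<Longrightarrow> F \<noteq> {} \<Longrightarrow> card (\<Union>F) \<le> card F \<Longrightarrow> g \<le> sum len F"
    and ears: "\<And>vs. ear E vs \<Longrightarrow> plen len vs \<le> q"
    using S unfolding suppressed_def by simp_all
  have "card (nbs E v) = 2" using v(2) card_nbs[OF G] by simp
  then obtain a b where ab: "nbs E v = {a, b}" "a \<noteq> b" by (auto simp: card_2_iff)
  have avE: "{a, v} \<in> E" "{b, v} \<in> E" using ab by (auto simp: nbs_def)
  have D: "a \<in> V" "b \<in> V" "a \<noteq> v" "b \<noteq> v" using graph_edgeD[OF G] avE by blast+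
  have v_edge: "w = a \<or> w = b" if "{v, w} \<in> E" for w
  proof -
    have "w \<in> nbs E v" using that by (simp add: nbs_def insert_commute)
    then show ?thesis using ab(1) by simp
  qed
  have abE: "{a, b} \<notin> E"
  proof
    assume e: "{a, b} \<in> E"
    let ?F = "{{a, v}, {b, v}, {a, b}}"
    have ne: "{a, v} \<noteq> {b, v}" "{a, v} \<noteq> {a, b}" "{b, v} \<noteq> {a, b}"
      using ab D by (auto simp: doubleton_eq_iff)
    have U: "\<Union>?F = {a, b, v}" by auto
    have "card (\<Union>?F) \<le> card ?F" unfolding U using ne ab D by simp
    then have "g \<le> sum len ?F" using heavy[of ?F] avE e by simp
    also have "\<dots> = len {a, v} + len {b, v} + len {a, b}" using ne by simp
    also have "\<dots> \<le> q + q + q"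
      using suppressed_edge[OF S] avE e by (intro add_mono) auto
    finally show False using g by simp
  qed
  define E' where "E' = contract_edges a v E"
  define len' where "len' = len({a, b} := len {a, v} + len {b, v})"
  have E'_eq: "E' = insert {a, b} {e\<in>E. v \<notin> e}"
  proof -
    have "{{a, w} |w. {v, w} \<in> E \<and> w \<noteq> a} = {{a, b}}"
      using v_edge avE(2) ab(2) by (auto simp: insert_commute)
    then show ?thesis by (simp add: E'_def contract_edges_def)
  qed
  have G': "graph (V - {v}) E'" unfolding E'_def by (rule graph_contract[OF G avE(1)])
  have degE': "degree E' w = degree E w" if w: "w \<noteq> v" for w
  proof -
    have fn: "finite (nbs E w)" for w by (rule finite_nbs[OF G])
    consider "w = a" | "w = b" | "w \<noteq> a" "w \<noteq> b" by blast
    then have "card (nbs E' w) = card (nbs E w)"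
    proof cases
      case 1
      have "nbs E' a = insert b (nbs E a - {v})"
        using ab D abE by (auto simp: nbs_def E'_eq doubleton_eq_iff)
      moreover have "b \<notin> nbs E a" "v \<in> nbs E a" using abE avE by (auto simp: nbs_def insert_commute)
      ultimately show ?thesis using fn 1 by (simp add: card_Suc_Diff1 del: card_Diff_insert)
    next
      case 2
      have "nbs E' b = insert a (nbs E b - {v})"
        using ab D abE by (auto simp: nbs_def E'_eq doubleton_eq_iff)
      moreover have "a \<notin> nbs E b" "v \<in> nbs E b" using abE avE by (auto simp: nbs_def insert_commute)
      ultimately show ?thesis using fn 2 by (simp add: card_Suc_Diff1 del: card_Diff_insert)
    next
      case 3
      have "v \<notin> nbs E w" using v_edge[of w] 3 by (auto simp: nbs_def)
      then have "nbs E' w = nbs E w" using 3 w by (auto simp: nbs_def E'_eq doubleton_eq_iff)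
      then show ?thesis by simp
    qed
    then show ?thesis by (simp add: card_nbs[OF G] card_nbs[OF G'])
  qed
  have heavy': "g \<le> sum len' F" if F: "F \<subseteq> E'" "F \<noteq> {}" "card (\<Union>F) \<le> card F" for F
  proof (cases "{a, b} \<in> F")
    case False
    then have FE: "F \<subseteq> E" using F(1) by (auto simp: E'_eq)
    have "sum len' F = sum len F" by (rule sum.cong) (use False in \<open>auto simp: len'_def\<close>)
    then show ?thesis using heavy[OF FE F(2,3)] by simp
  next
    case True
    define F0 where "F0 = F - {{a, b}}"
    have F0: "F0 \<subseteq> {e\<in>E. v \<notin> e}" "{a, b} \<notin> F0" using F(1) by (auto simp: E'_eq F0_def)
    have finF: "finite F" using F(1) graph_finite_edges[OF G'] finite_subset by blast
    then have finF0: "finite F0" by (simp add: F0_def)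
    have cF: "card F = Suc (card F0)" using card_Suc_Diff1[OF finF True] by (simp add: F0_def)
    \<comment> \<open>Replacing \<open>{a, b}\<close> by the two edges at \<open>v\<close> adds one
      edge and one vertex, so there are still no more vertices than edges, and the total length is
      unchanged.\<close>
    let ?F = "insert {a, v} (insert {b, v} F0)"
    have nin: "{a, v} \<notin> insert {b, v} F0" "{b, v} \<notin> F0" using F0 ab(2) D by (auto simp: doubleton_eq_iff)
    have cF': "card ?F = Suc (card F)" using nin finF0 cF by simp
    have "\<Union>?F = insert v (\<Union>F)" using True by (auto simp: F0_def)
    moreover have "finite (\<Union>F)" using finF F(1) by (auto elim!: graph_edgeE[OF G'])
    ultimately have "card (\<Union>?F) \<le> Suc (card (\<Union>F))" by (simp add: card_insert_if)
    then have "g \<le> sum len ?F" using heavy[of ?F] F0 avE F(3) cF' by auto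
    also have "\<dots> = len {a, v} + len {b, v} + sum len F0" using nin finF0 by simp
    also have "sum len F0 = sum len' F0" by (rule sum.cong) (use F0 in \<open>auto simp: len'_def\<close>)
    also have "len {a, v} + len {b, v} + sum len' F0 = sum len' F"
      using sum.remove[OF finF True, of len'] by (simp add: len'_def F0_def)
    finally show ?thesis .
  qed
  have ears': "plen len' vs \<le> q" if e: "ear E' vs" for vs
  proof -
    have vs: "distinct vs" "length vs \<ge> 2" "successively (\<lambda>x y. {x, y} \<in> E') vs"
      "\<And>v. v \<in> set vs \<Longrightarrow> v \<noteq> hd vs \<Longrightarrow> v \<noteq> last vs \<Longrightarrow> degree E' v = 2"
      using e unfolding ear_def by simp_all
    have vvs: "v \<notin> set vs"
    proof
      assume "v \<in> set vs"
      then obtain i where i: "i < length vs" "vs ! i = v" by (auto simp: in_set_conv_nth)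
      have "\<exists>e\<in>E'. v \<in> e"
      proof (cases "Suc i < length vs")
        case True then show ?thesis using successively_nth[OF vs(3) True] i by blast
      next
        case False
        then have "Suc (i - 1) < length vs" "Suc (i - 1) = i" using i vs(2) by auto
        then show ?thesis using successively_nth[OF vs(3), of "i - 1"] i by auto
      qed
      then show False using D by (auto simp: E'_eq)
    qed
    show ?thesis
    proof (cases "successively (\<lambda>x y. {x, y} \<noteq> {a, b}) vs")
      case True
      have "successively (\<lambda>x y. {x, y} \<in> E) vs"
        using vs(3) True by (auto simp: successively_conv_nth E'_eq)
      then have "ear E vs" using vs vvs degE' unfolding ear_def by metis
      moreover have "plen len' vs = plen len vs"
        by (rule plen_cong) (use True in \<open>auto simp: successively_conv_nth len'_def\<close>)
      ultimately show ?thesis using ears by simp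
    next
      case False
      \<comment> \<open>The ear passes through \<open>{a, b}\<close> only once, as its vertices are
        distinct; \<open>v\<close> is put back between \<open>c\<close> and
        \<open>d\<close>.\<close>
      then obtain us c d ws where sp: "vs = us @ c # d # ws" "{c, d} = {a, b}"
        using not_successively_split by blast
      have dist: "distinct (us @ c # d # ws)" using vs(1) sp by simp
      have s1: "successively (\<lambda>x y. {x, y} \<in> E' \<and> {x, y} \<noteq> {a, b}) (us @ [c])"
      proof -
        have "successively (\<lambda>x y. {x, y} \<in> E') (us @ [c])"
          using vs(3) by (cases us rule: rev_cases) (auto simp: sp(1) successively_append_iff)
        moreover have "d \<notin> set (us @ [c])" using dist by auto
        moreover have "d \<in> {a, b}" using sp(2) by blast
        ultimately show ?thesis by (rule successively_avoid)
      qed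
      have s2: "successively (\<lambda>x y. {x, y} \<in> E' \<and> {x, y} \<noteq> {a, b}) (d # ws)"
      proof -
        have "successively (\<lambda>x y. {x, y} \<in> E') (d # ws)"
          using vs(3) by (auto simp: sp(1) successively_append_iff)
        moreover have "c \<notin> set (d # ws)" using dist by auto
        moreover have "c \<in> {a, b}" using sp(2) by blast
        ultimately show ?thesis by (rule successively_avoid)
      qed
      define vs' where "vs' = us @ c # v # d # ws"
      have cd: "{c, v} \<in> E" "{v, d} \<in> E" "len {c, v} + len {v, d} = len {a, v} + len {b, v}"
        using sp(2) avE by (auto simp: doubleton_eq_iff insert_commute)
      have "successively (\<lambda>x y. {x, y} \<in> E) vs'"
      proof -
        have "successively (\<lambda>x y. {x, y} \<in> E) (us @ [c])" "successively (\<lambda>x y. {x, y} \<in> E) (d # ws)"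
          by (rule successively_mono[OF s1], auto simp: E'_eq) (rule successively_mono[OF s2], auto simp: E'_eq)
        then show ?thesis using cd(1,2) unfolding vs'_def
          by (cases us rule: rev_cases) (auto simp: successively_append_iff successively_Cons)
      qed
      moreover have "distinct vs'" using dist vvs sp(1) by (auto simp: vs'_def)
      moreover have "hd vs' = hd vs" by (cases us) (simp_all add: vs'_def sp(1))
      moreover have "last vs' = last vs" by (simp add: vs'_def sp(1))
      moreover have "set vs' = insert v (set vs)" by (auto simp: vs'_def sp(1))
      moreover have "length vs' \<ge> 2" by (simp add: vs'_def)
      ultimately have "ear E vs'"
        unfolding ear_def using vs(4) v(2) degE' vvs by (metis insert_iff)
      then have "plen len vs' \<le> q" by (rule ears)
      moreover have "plen len vs' = plen len (us @ [c]) + len {c, v} + (len {v, d} + plen len (d # ws))"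
        unfolding vs'_def by (subst plen_append) simp
      moreover have "plen len' vs = plen len' (us @ [c]) + len' {c, d} + plen len' (d # ws)"
        unfolding sp(1) by (rule plen_append)
      moreover have "plen len' (us @ [c]) = plen len (us @ [c])"
        by (rule plen_cong, rule successively_mono[OF s1]) (simp add: len'_def)
      moreover have "plen len' (d # ws) = plen len (d # ws)"
        by (rule plen_cong, rule successively_mono[OF s2]) (simp add: len'_def)
      moreover have "len' {c, d} = len {c, v} + len {v, d}" using cd(3) sp(2) by (simp add: len'_def)
      ultimately show ?thesis by linarith
    qed
  qed
  have "suppressed q g (V - {v}) E' len'"
    unfolding suppressed_def
    using G' D deg2 degE' heavy' ears' by (intro conjI ballI allI impI) auto
  moreover have "card (V - {v}) < card V"
    using G v(1) by (intro psubset_card_mono) (auto simp: graph_def)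
  moreover have "\<forall>k. has_complete_minor k (V - {v}) E' \<longrightarrow> has_complete_minor k V E"
    using complete_minor_contract[OF G avE(1)] by (simp add: E'_def)
  ultimately show thesis by (rule that)
qed

lemma suppress_all:
  fixes V :: "'a set"
  assumes "suppressed q g V E len" "3 * q < g"
  shows "\<exists>(V' :: 'a set) E' len'. suppressed q g V' E' len' \<and> (\<forall>v\<in>V'. 3 \<le> degree E' v) \<and>
    (\<forall>k. has_complete_minor k V' E' \<longrightarrow> has_complete_minor k V E)"
  using assms(1)
proof (induction "card V" arbitrary: V E len rule: less_induct)
  case less
  show ?case
  proof (cases "\<exists>v\<in>V. degree E v = 2")
    case False
    have "3 \<le> degree E v" if "v \<in> V" for v
    proof -
      have "2 \<le> degree E v" "degree E v \<noteq> 2" using less.prems that False by (auto simp: suppressed_def)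
      then show ?thesis by linarith
    qed
    then show ?thesis using less.prems by blast
  next
    case True
    then obtain v where v: "v \<in> V" "degree E v = 2" by blast
    obtain V1 :: "'a set" and E1 len1 where 1: "suppressed q g V1 E1 len1" "card V1 < card V"
      "\<forall>k. has_complete_minor k V1 E1 \<longrightarrow> has_complete_minor k V E"
      by (rule suppress_step[OF less.prems assms(2) v]) (rule that)
    from less.hyps[OF 1(2,1)] obtain V2 :: "'a set" and E2 len2 where 2: "suppressed q g V2 E2 len2"
      "\<forall>v\<in>V2. 3 \<le> degree E2 v" "\<forall>k. has_complete_minor k V2 E2 \<longrightarrow> has_complete_minor k V1 E1"
      by (elim exE conjE) (rule that)
    then show ?thesis using 1(3) by (intro exI[of _ V2] exI[of _ E2] exI[of _ len2]) simp
  qed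
qed

text \<open>With all lengths 1, a graph without a \<open>p_reduction\<close> has minimum degree at
  least two and ears of length at most \<open>p - 1\<close>. After suppression every edge still has
  length at most \<open>p - 1\<close>, so a nonempty edge set with no more vertices than edges has
  more than \<open>4 * n + 4\<close> edges.\<close>

theorem dense_minor_of_nondegenerate:
  fixes V :: "'a set"
  assumes G: "graph V E" and girth: "girth_ge V E g" and nd: "\<not> p_path_degenerate p V E"
    and p: "p \<ge> 2" and g: "(4 * n + 4) * (p - 1) < g"
  obtains D :: "'a set" and F where "graph D F" "D \<noteq> {}" "2 ^ n * card D \<le> 16 * card F"
    "\<forall>k. has_complete_minor k D F \<longrightarrow> has_complete_minor k V E"
proof -
  obtain V1 E1 where 1: "V1 \<subseteq> V" "E1 \<subseteq> E" "graph V1 E1" "V1 \<noteq> {}" "\<And>H. \<not> p_reduction p (V1, E1) H"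
    using reduced_core[OF G nd p] by blast
  have sup: "suppressed (p - 1) g V1 E1 (\<lambda>_. 1)"
    unfolding suppressed_def
  proof (intro conjI ballI allI impI)
    show "graph V1 E1" "V1 \<noteq> {}" by (fact 1)+
    show "2 \<le> degree E1 v" if "v \<in> V1" for v
    proof (rule ccontr)
      assume "\<not> 2 \<le> degree E1 v"
      then have "degree E1 v = 0 \<or> degree E1 v = 1" by linarith
      then have "p_reduction p (V1, E1) (del_verts {v} (V1, E1))"
        unfolding p_reduction_def using that by auto
      then show False using 1(5) by blast
    qed
    show "g \<le> (\<Sum>e\<in>F. 1)" if F: "F \<subseteq> E1" "F \<noteq> {}" "card (\<Union>F) \<le> card F" for F
    proof -
      have GF: "graph V F" using G F(1) 1(2) by (auto simp: graph_def)
      obtain l where l: "l \<le> card F" "has_cycle_len (\<Union>F) F l"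
        using cyclic_has_cycle[OF GF F(2,3)] by blast
      have "has_cycle_len V E l"
        by (rule has_cycle_len_mono[OF l(2)]) (use F(1) 1(2) in \<open>auto elim!: graph_edgeE[OF GF]\<close>)
      then show ?thesis using girth l(1) by (auto simp: girth_ge_def)
    qed
    show "plen (\<lambda>_. 1) vs \<le> p - 1" if e: "ear E1 vs" for vs
    proof (rule ccontr)
      assume neg: "\<not> plen (\<lambda>_. 1) vs \<le> p - 1"
      have vs: "distinct vs" "length vs \<ge> 2" "successively (\<lambda>x y. {x, y} \<in> E1) vs"
        "\<And>v. v \<in> set vs \<Longrightarrow> v \<noteq> hd vs \<Longrightarrow> v \<noteq> last vs \<Longrightarrow> degree E1 v = 2"
        using e unfolding ear_def by simp_all
      have edge: "{vs ! i, vs ! Suc i} \<in> E1" if "Suc i < length vs" for i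
        using successively_nth[OF vs(3) that] .
      have sub: "set vs \<subseteq> V1"
      proof
        fix x assume "x \<in> set vs"
        then obtain i where i: "i < length vs" "x = vs ! i" by (auto simp: in_set_conv_nth)
        show "x \<in> V1"
        proof (cases "Suc i < length vs")
          case True then show ?thesis using graph_edgeD(1)[OF 1(3) edge[OF True]] i by simp
        next
          case False
          then have j: "Suc (i - 1) < length vs" "Suc (i - 1) = i" using i vs(2) by auto
          then show ?thesis using graph_edgeD(2)[OF 1(3) edge[OF j(1)]] i by simp
        qed
      qed
      have ne: "vs \<noteq> []" using vs(2) by auto
      have "strict_ear V1 E1 vs"
        unfolding strict_ear_def is_path_def
      proof (intro conjI allI impI)
        show "hd vs \<noteq> last vs"
          using vs(1,2) ne by (simp add: hd_conv_nth last_conv_nth nth_eq_iff_index_eq)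
        fix i assume i: "0 < i \<and> Suc i < length vs"
        then have "vs ! i \<noteq> hd vs" "vs ! i \<noteq> last vs"
          using vs(1) ne by (auto simp: hd_conv_nth last_conv_nth nth_eq_iff_index_eq)
        then show "degree E1 (vs ! i) = 2" using vs(4)[of "vs ! i"] i by simp
      qed (use vs ne sub edge in auto)
      moreover have "p \<le> length vs - 1" using neg p plen_const[of vs] by simp
      ultimately have "p_reduction p (V1, E1) (del_verts (set (butlast (tl vs))) (V1, E1))"
        unfolding p_reduction_def fst_conv snd_conv by blast
      then show False using 1(5) by blast
    qed
  qed
  have "3 * (p - 1) \<le> (4 * n + 4) * (p - 1)" by (rule mult_le_mono1) simp
  then have "3 * (p - 1) < g" using g by linarith
  from suppress_all[OF sup this] obtain V2 :: "'a set" and E2 len where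
    2: "suppressed (p - 1) g V2 E2 len" "\<forall>v\<in>V2. 3 \<le> degree E2 v"
      "\<forall>k. has_complete_minor k V2 E2 \<longrightarrow> has_complete_minor k V1 E1"
    by (elim exE conjE) (rule that)
  have G2: "graph V2 E2" "V2 \<noteq> {}" using 2(1) by (simp_all add: suppressed_def)
  have sp: "sparse E2 (4 * n + 5)"
    unfolding sparse_def
  proof (intro allI impI)
    fix F assume F: "F \<subseteq> E2" "F \<noteq> {}" "card F < 4 * n + 5"
    show "card F < card (\<Union>F)"
    proof (rule ccontr)
      assume "\<not> card F < card (\<Union>F)"
      then have "g \<le> sum len F" using 2(1) F by (simp add: suppressed_def)
      also have "\<dots> \<le> card F * (p - 1)"
        using sum_bounded_above[of F len "p - 1"] suppressed_edge[OF 2(1)] F(1) by auto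
      also have "\<dots> \<le> (4 * n + 4) * (p - 1)" using F(3) by (intro mult_le_mono1) simp
      finally show False using g by simp
    qed
  qed
  have d3: "\<And>v. v \<in> V2 \<Longrightarrow> 3 \<le> degree E2 v" "4 * n + 4 < 4 * n + 5" using 2(2) by simp_all
  obtain D :: "'a set" and F where
    DF: "graph D F" "D \<noteq> {}" "2 ^ n * card D \<le> 16 * card F"
    "\<forall>k. has_complete_minor k D F \<longrightarrow> has_complete_minor k V2 E2"
    by (rule dense_quotient[OF G2 d3(1) sp d3(2)]) (assumption, rule that)
  have "has_complete_minor k V E" if "has_complete_minor k D F" for k
    by (rule complete_minor_mono[OF _ 1(1,2)]) (use that DF(4) 2(3) in simp)
  then show thesis using that[OF DF(1-3)] by simp
qed

section \<open>The upper bound\<close>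

text \<open>Since 3 \<le> (4/3)^4, the base is at most (3/4)^(s - 4). The exponent
  \<open>(s - 4) * s\<close> is at least 3 (log k + 2), and (3/4)^3 \<le> 1/2, which gives 1 / (4
  k).\<close>

lemma tuple_length_suffices:
  fixes s k :: nat
  assumes k: "k \<ge> 1" and s: "8 + 3 * sqrt (log 2 (real k)) \<le> real s"
  shows "2 * real k * (3 * (3/4)^s)^s < 1"
proof -
  define L where "L = log 2 (real k)"
  have L0: "L \<ge> 0" using k by (simp add: L_def)
  have s8: "s \<ge> 8" using s L0 real_sqrt_ge_zero[of L] unfolding L_def by linarith
  have "(3::real) * (3/4)^s \<le> (4/3)^4 * (3/4)^s" by (intro mult_right_mono) (simp_all add: power4_eq_xxxx)
  also have "\<dots> = (3/4)^(s - 4)"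
  proof -
    have "(3/4::real)^s = (3/4)^(s - 4) * (3/4)^4" using s8 by (simp flip: power_add)
    then show ?thesis by (simp add: power_divide)
  qed
  finally have "(3 * (3/4::real)^s)^s \<le> ((3/4)^(s - 4))^s" by (intro power_mono) auto
  also have "\<dots> = (3/4) powr real ((s - 4) * s)" by (simp add: powr_realpow del: of_nat_mult flip: power_mult)
  also have "\<dots> \<le> (3/4) powr (3 * (L + 2))"
  proof (rule powr_mono')
    have "3 * (L + 2) \<le> (4 + 3 * sqrt L) * (8 + 3 * sqrt L)"
      using L0 real_sqrt_ge_zero[OF L0] by (simp add: algebra_simps flip: power2_eq_square)
    also have "\<dots> \<le> real (s - 4) * real s"
      using s s8 L0 by (intro mult_mono) (auto simp: L_def)
    finally show "3 * (L + 2) \<le> real ((s - 4) * s)" by simp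
  qed auto
  also have "\<dots> = ((3/4) powr 3) powr (L + 2)" by (simp only: powr_powr)
  also have "\<dots> \<le> (1/2) powr (L + 2)"
    using L0 by (intro powr_mono2) (simp_all add: powr_numeral power3_eq_cube)
  also have "\<dots> = 1 / (4 * real k)"
  proof -
    have "(2::real) powr L = real k" using k by (simp add: L_def)
    then have "(2::real) powr (L + 2) = 4 * real k" by (simp add: powr_add powr_numeral)
    then show ?thesis by (simp add: powr_divide)
  qed
  finally have "(3 * (3/4::real)^s)^s \<le> 1 / (4 * real k)" .
  then have "2 * real k * (3 * (3/4::real)^s)^s \<le> 2 * real k * (1 / (4 * real k))"
    by (intro mult_left_mono) auto
  also have "\<dots> < 1" using k by simp
  finally show ?thesis .
qed

lemma girth_bound:
  fixes V :: "'a set"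
  assumes k: "k \<ge> 5" and p: "p \<ge> 2" and G: "graph V E" and nm: "\<not> has_complete_minor k V E"
    and girth: "girth_ge V E g" and nd: "\<not> p_path_degenerate p V E"
  shows "real g \<le> (4 * log 2 (real k) + 2 * log 2 (log 2 (real k)) + 64) * (real p - 1)"
proof (rule ccontr)
  assume neg: "\<not> ?thesis"
  define L where "L = log 2 (real k)"
  \<comment> \<open>2^9 = 512 \<le> 625 = 5^4. The value 9/4 is chosen for its root 3/2, which lets
    9 + 3 sqrt L be bounded by 9 sqrt L.\<close>
  have "log 2 (2 powr (9/4)) \<le> log 2 (real k)"
  proof (subst log_le_cancel_iff)
    have "(2 powr (9/4::real)) ^ 4 \<le> 5 ^ 4" by (simp add: powr_power powr_numeral)
    then have "2 powr (9/4) \<le> (5::real)" by (rule power_le_imp_le_base[where n = 3, simplified]) simp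
    then show "2 powr (9/4) \<le> real k" using k by simp
  qed (use k in auto)
  then have L: "9/4 \<le> L" by (simp add: L_def)
  have sqL: "3/2 \<le> sqrt L" using L by (intro real_le_rsqrt) (simp add: power2_eq_square)
  define s where "s = nat \<lceil>8 + 3 * sqrt L\<rceil>"
  have s1: "8 + 3 * sqrt L \<le> real s" unfolding s_def by linarith
  have "real s \<le> 9 + 3 * sqrt L" unfolding s_def using sqL by linarith
  then have s2: "real s \<le> 9 * sqrt L" using sqL by linarith
  have s0: "s \<ge> 1" using s1 sqL by linarith
  \<comment> \<open>The 10 absorbs the factor 26 * 3 * 9 = 702 \<le> 2^10.\<close>
  define \<sigma> where "\<sigma> = nat \<lceil>10 + L + log 2 L / 2\<rceil>"
  have lL: "log 2 L \<ge> 0" using L by simp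
  have sg1: "10 + L + log 2 L / 2 \<le> real \<sigma>" unfolding \<sigma>_def by linarith
  have sg2: "real \<sigma> \<le> 11 + L + log 2 L / 2" unfolding \<sigma>_def using L lL by linarith
  have "26 * (3 * s * k) \<le> 2 ^ \<sigma>"
  proof -
    have k': "2 powr L = real k" using k by (simp add: L_def)
    have L': "2 powr (log 2 L / 2) = sqrt L"
    proof -
      have "2 powr (log 2 L / 2) = (2 powr log 2 L) powr (1/2)" by (simp add: powr_powr)
      then show ?thesis using L by (simp add: powr_half_sqrt)
    qed
    have "real (26 * (3 * s * k)) = 78 * real s * real k" by simp
    also have "\<dots> \<le> 78 * (9 * sqrt L) * real k" using s2 by (intro mult_right_mono mult_left_mono) auto
    also have "\<dots> \<le> 1024 * real k * sqrt L" using L by (simp add: mult_ac)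
    also have "\<dots> = 2 powr (10 + L + log 2 L / 2)" by (simp add: powr_add k' L' powr_numeral)
    also have "\<dots> \<le> 2 powr real \<sigma>" using sg1 by (intro powr_mono) auto
    also have "\<dots> = real (2 ^ \<sigma>)" by (simp add: powr_realpow)
    finally show ?thesis by (simp only: of_nat_le_iff)
  qed
  then have d: "26 * (3 * s * k) \<le> 2 ^ \<sigma> + 1" by simp
  \<comment> \<open>The extra 4 in \<open>\<sigma> + 4\<close> cancels the factor 16 of the dense
    minor; with the rounding of \<open>\<sigma>\<close>, 4 * 11 + 20 = 64.\<close>
  have "real (4 * (\<sigma> + 4) + 4) \<le> 4 * L + 2 * log 2 L + 64" using sg2 by simp
  then have "real (4 * (\<sigma> + 4) + 4) * (real p - 1) \<le> (4 * L + 2 * log 2 L + 64) * (real p - 1)"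
    using p by (intro mult_right_mono) auto
  also have "\<dots> < real g" using neg by (simp add: L_def)
  finally have "real ((4 * (\<sigma> + 4) + 4) * (p - 1)) < real g" using p by (simp add: of_nat_diff)
  then have gg: "(4 * (\<sigma> + 4) + 4) * (p - 1) < g" by (simp only: of_nat_less_iff)
  obtain D :: "'a set" and F where DF: "graph D F" "D \<noteq> {}" "2 ^ (\<sigma> + 4) * card D \<le> 16 * card F"
    "\<forall>k. has_complete_minor k D F \<longrightarrow> has_complete_minor k V E"
    by (rule dense_minor_of_nondegenerate[OF G girth nd p gg]) (rule that)
  have "2 ^ \<sigma> * card D \<le> card F" using DF(3) by (simp add: power_add)
  then have "has_complete_minor k D F"
    using DF(1,2) d s0 k tuple_length_suffices[of k s] s1
    by (intro dense_complete_minor[where d = "2 ^ \<sigma>" and s = s]) (auto simp: L_def)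
  then show False using DF(4) nm by blast
qed

theorem gKp_upper_bound:
  assumes "k \<ge> 5" "p \<ge> 2"
  shows "gKp k p < ereal ((4 * log 2 (real k) + 2 * log 2 (log 2 (real k)) + 65) * (real p - 1))"
proof -
  have "gKp k p \<le> ereal ((4 * log 2 (real k) + 2 * log 2 (log 2 (real k)) + 64) * (real p - 1))"
    unfolding gKp_def by (rule Sup_least) (use girth_bound[OF assms] in auto)
  \<comment> \<open>A bound on every member gives a supremum that may equal it; 65 in place of 64
    makes the bound strict, as \<open>p - 1\<close> is positive.\<close>
  also have "\<dots> < ereal ((4 * log 2 (real k) + 2 * log 2 (log 2 (real k)) + 65) * (real p - 1))"
    using assms(2) by (simp add: algebra_simps)
  finally show ?thesis .
qed

section \<open>Clique minors in graphs with few branch vertices\<close>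

definition leaving :: "'a set set \<Rightarrow> 'a set \<Rightarrow> 'a set set" where
  "leaving E T = {e\<in>E. e \<inter> T \<noteq> {} \<and> \<not> e \<subseteq> T}"

lemma rtranclp_crossing:
  "R\<^sup>*\<^sup>* x y \<Longrightarrow> x \<in> T \<Longrightarrow> y \<notin> T \<Longrightarrow> \<exists>u v. u \<in> T \<and> v \<notin> T \<and> R u v"
  by (induction rule: rtranclp_induct) auto

lemma leaving_insert:
  assumes G: "graph V E" and e: "{t, v} \<in> E" and t: "t \<in> T" and v: "v \<notin> T"
  shows "card (leaving E (insert v T)) + 2 \<le> card (leaving E T) + degree E v"
proof -
  have fin: "finite (leaving E T)" "finite {e\<in>E. v \<in> e}"
    using graph_finite_edges[OF G] by (auto simp: leaving_def)
  have in1: "{t, v} \<in> leaving E T" "{t, v} \<in> {e\<in>E. v \<in> e}" using e t v by (auto simp: leaving_def)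
  have "leaving E (insert v T) \<subseteq> (leaving E T - {{t, v}}) \<union> ({e\<in>E. v \<in> e} - {{t, v}})"
    using t by (auto simp: leaving_def)
  then have "card (leaving E (insert v T)) \<le> card ((leaving E T - {{t, v}}) \<union> ({e\<in>E. v \<in> e} - {{t, v}}))"
    using fin by (intro card_mono) auto
  also have "\<dots> \<le> card (leaving E T - {{t, v}}) + card ({e\<in>E. v \<in> e} - {{t, v}})" by (rule card_Un_le)
  finally show ?thesis
    using card_Suc_Diff1[OF fin(1) in1(1)] card_Suc_Diff1[OF fin(2) in1(2)] by (simp add: degree_def)
qed

text \<open>Grow \<open>S\<close> from one vertex along its edges: a new vertex \<open>v\<close>
  uses up one boundary edge and adds at most \<open>degree E v - 1\<close>. Vertices of degree two
  contribute nothing, so the count is insensitive to subdivision.\<close>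

lemma leaving_connected:
  assumes G: "graph V E" and deg: "\<And>v. v \<in> V \<Longrightarrow> 2 \<le> degree E v"
    and S: "induced_connected E S" "S \<subseteq> V" "S \<noteq> {}"
  shows "card (leaving E S) \<le> 2 + (\<Sum>v\<in>S. degree E v - 2)"
proof -
  have finS: "finite S" using S(2) G finite_subset by (auto simp: graph_def)
  have grow: "card (leaving E S) \<le> 2 + (\<Sum>v\<in>S. degree E v - 2)"
    if "T \<subseteq> S" "T \<noteq> {}" "card (leaving E T) \<le> 2 + (\<Sum>v\<in>T. degree E v - 2)" for T
    using that
  proof (induction "card (S - T)" arbitrary: T rule: less_induct)
    case less
    show ?case
    proof (cases "T = S")
      case True then show ?thesis using less.prems by simp
    next
      case False
      then obtain x y where xy: "x \<in> T" "y \<in> S" "y \<notin> T" using less.prems by blast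
      then have "(step_in E S)\<^sup>*\<^sup>* x y" using S(1) less.prems(1) by (auto simp: induced_connected_def)
      from rtranclp_crossing[OF this xy(1,3)] obtain t v where
        tv: "t \<in> T" "v \<notin> T" "v \<in> S" "{t, v} \<in> E" by blast
      have finT: "finite T" using less.prems(1) finS finite_subset by blast
      have "S - insert v T \<subset> S - T" using tv by blast
      then have "card (S - insert v T) < card (S - T)" using finS by (intro psubset_card_mono) auto
      moreover have "card (leaving E (insert v T)) \<le> 2 + (\<Sum>v\<in>insert v T. degree E v - 2)"
        using leaving_insert[OF G tv(4,1,2)] less.prems(3) finT tv(2) deg[of v] tv(3) S(2) by auto
      ultimately show ?thesis using less.hyps[of "insert v T"] less.prems(1) tv(3) by simp
    qed
  qed
  obtain x where x: "x \<in> S" using S(3) by blast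
  have "leaving E {x} \<subseteq> {e\<in>E. x \<in> e}" by (auto simp: leaving_def)
  then have "card (leaving E {x}) \<le> degree E x"
    unfolding degree_def using graph_finite_edges[OF G] by (intro card_mono) auto
  then show ?thesis using x by (intro grow[of "{x}"]) auto
qed

text \<open>A branch set sends edges to the \<open>k - 1\<close> others, so its vertices have total
  excess at least \<open>k - 3\<close> over degree two. The sets are disjoint, so these excesses add
  up.\<close>

lemma complete_minor_size:
  assumes G: "graph V E" and deg: "\<And>v. v \<in> V \<Longrightarrow> 2 \<le> degree E v"
    and minor: "has_complete_minor k V E"
  shows "k * (k - 3) \<le> (\<Sum>v\<in>V. degree E v - 2)"
proof -
  have finV: "finite V" using G by (simp add: graph_def)
  from minor obtain B where "minor_model k V E B" by (auto simp: has_complete_minor_iff)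
  note B = minor_modelD[OF this]
  have each: "k - 3 \<le> (\<Sum>v\<in>B i. degree E v - 2)" if i: "i < k" for i
  proof -
    have "\<exists>e\<in>leaving E (B i). e \<inter> B j \<noteq> {} \<and> e \<subseteq> B i \<union> B j" if j: "j \<in> {..<k} - {i}" for j
    proof -
      obtain u v where "u \<in> B i" "v \<in> B j" "{u, v} \<in> E" using B(5)[of i j] i j by auto
      moreover have "v \<notin> B i" using B(4)[of i j] i j calculation by auto
      ultimately show ?thesis by (intro bexI[of _ "{u, v}"]) (auto simp: leaving_def)
    qed
    then obtain f where f: "\<And>j. j \<in> {..<k} - {i} \<Longrightarrow> f j \<in> leaving E (B i) \<and> f j \<inter> B j \<noteq> {} \<and> f j \<subseteq> B i \<union> B j"
      by metis
    have "inj_on f ({..<k} - {i})"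
    proof (rule inj_onI, rule ccontr)
      fix j j' assume j: "j \<in> {..<k} - {i}" "j' \<in> {..<k} - {i}" "f j = f j'" "j \<noteq> j'"
      then have "f j \<inter> B j \<noteq> {}" "f j \<subseteq> B i \<union> B j'" using f by metis+
      moreover have "B i \<inter> B j = {}" "B j \<inter> B j' = {}" using B(4) i j by auto
      ultimately show False by blast
    qed
    moreover have "f ` ({..<k} - {i}) \<subseteq> leaving E (B i)" using f by blast
    moreover have "finite (leaving E (B i))" using graph_finite_edges[OF G] by (simp add: leaving_def)
    ultimately have "card ({..<k} - {i}) \<le> card (leaving E (B i))" by (rule card_inj_on_le)
    then have "k - 1 \<le> card (leaving E (B i))" using i by simp
    also have "\<dots> \<le> 2 + (\<Sum>v\<in>B i. degree E v - 2)"
      by (rule leaving_connected[OF G deg B(3)[OF i] B(2)[OF i] B(1)[OF i]])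
    finally show ?thesis by linarith
  qed
  have finB: "finite (B i)" if "i < k" for i using B(2)[OF that] finV finite_subset by blast
  have "k * (k - 3) = (\<Sum>i<k. k - 3)" by simp
  also have "\<dots> \<le> (\<Sum>i<k. \<Sum>v\<in>B i. degree E v - 2)" by (rule sum_mono) (use each in simp)
  also have "\<dots> = (\<Sum>v\<in>(\<Union>i<k. B i). degree E v - 2)"
    using finB B(4) by (intro sum.UNION_disjoint[symmetric]) auto
  also have "\<dots> \<le> (\<Sum>v\<in>V. degree E v - 2)" using B(2) finV by (intro sum_mono2) auto
  finally show ?thesis .
qed

section \<open>Subdivided cubic bipartite graphs\<close>

text \<open>A bipartite cubic graph with parts \<open>A\<close> and \<open>B\<close> and edge set \<open>P\<close>; every edge is replaced by a path of
  length \<open>q\<close> whose vertices are numbered from the end in \<open>A\<close>.\<close>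
locale cubic_subdivision =
  fixes A B :: "nat set" and P :: "(nat \<times> nat) set" and q :: nat
  assumes fin: "finite A" "finite B" and P: "P \<subseteq> A \<times> B"
    and degA: "\<And>a. a \<in> A \<Longrightarrow> card {b. (a, b) \<in> P} = 3"
    and degB: "\<And>b. b \<in> B \<Longrightarrow> card {a. (a, b) \<in> P} = 3"
    and q: "q \<ge> 1" and A0: "A \<noteq> {}"
begin

text \<open>The end in \<open>A\<close> depends on \<open>a\<close> only and the end in
  \<open>B\<close> on \<open>b\<close> only, so that paths share their ends; the tags 0, 1, 2 keep
  the kinds apart. The code is in \<open>nat\<close> because \<open>gKp\<close> ranges over graphs
  on \<open>nat\<close>.\<close>

definition pos :: "nat \<Rightarrow> nat \<Rightarrow> nat \<Rightarrow> nat" where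
  "pos a b j = to_nat (if j = 0 then (0, a, 0, 0) else if j = q then (1, b, 0, 0) else (2, a, b, j) :: nat \<times> nat \<times> nat \<times> nat)"

definition seg :: "nat \<Rightarrow> nat \<Rightarrow> nat \<Rightarrow> nat set" where
  "seg a b j = {pos a b j, pos a b (Suc j)}"

definition SE :: "nat set set" where "SE = {seg a b j |a b j. (a, b) \<in> P \<and> j < q}"
definition SV :: "nat set" where "SV = {pos a b j |a b j. (a, b) \<in> P \<and> j \<le> q}"

lemma pos_eq: "pos a b j = pos a' b' j' \<longleftrightarrow> j = j' \<and> (j = 0 \<and> a = a' \<or> j \<noteq> 0 \<and> j = q \<and> b = b' \<or> j \<noteq> 0 \<and> j \<noteq> q \<and> a = a' \<and> b = b')"
  using q by (auto simp: pos_def)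

lemma seg_eq:
  assumes "j < q" "j' < q" "seg a b j = seg a' b' j'" shows "a = a' \<and> b = b' \<and> j = j'"
proof -
  from assms(3) consider "pos a b j = pos a' b' j'" "pos a b (Suc j) = pos a' b' (Suc j')"
    | "pos a b j = pos a' b' (Suc j')" "pos a b (Suc j) = pos a' b' j'"
    unfolding seg_def by (auto simp: doubleton_eq_iff)
  then show ?thesis
    by cases (use assms(1,2) in \<open>auto simp: pos_eq\<close>)
qed

lemma pos_neq_Suc: "pos a b j \<noteq> pos a b (Suc j)" by (simp add: pos_eq)

lemma posI: "(a, b) \<in> P \<Longrightarrow> j \<le> q \<Longrightarrow> pos a b j \<in> SV"
  by (auto simp: SV_def)

lemma segI: "(a, b) \<in> P \<Longrightarrow> j < q \<Longrightarrow> seg a b j \<in> SE"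
  by (auto simp: SE_def)

lemma finP: "finite P" using fin P finite_subset by blast

lemma graph_S: "graph SV SE"
  unfolding graph_def
proof (intro conjI ballI)
  have "SV \<subseteq> (\<lambda>((a, b), j). pos a b j) ` (P \<times> {..q})" by (force simp: SV_def)
  then show "finite SV" by (rule finite_subset) (simp add: finP)
  fix e assume "e \<in> SE"
  then obtain a b j where "e = seg a b j" "(a, b) \<in> P" "j < q" by (auto simp: SE_def)
  then show "\<exists>u v. e = {u, v} \<and> u \<noteq> v \<and> u \<in> SV \<and> v \<in> SV"
    by (intro exI[of _ "pos a b j"] exI[of _ "pos a b (Suc j)"]) (simp add: seg_def posI pos_neq_Suc)
qed

lemma edges_interior:
  assumes "(a, b) \<in> P" "0 < j" "j < q"
  shows "{e\<in>SE. pos a b j \<in> e} = {seg a b (j - 1), seg a b j}"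
proof (rule equalityI)
  show "{e\<in>SE. pos a b j \<in> e} \<subseteq> {seg a b (j - 1), seg a b j}"
    using assms by (auto simp: SE_def seg_def pos_eq)
  have "pos a b j \<in> seg a b (j - 1)" "pos a b j \<in> seg a b j" using assms(2) by (simp_all add: seg_def)
  then show "{seg a b (j - 1), seg a b j} \<subseteq> {e\<in>SE. pos a b j \<in> e}" using assms by (simp add: segI)
qed

lemma edges_left:
  assumes "a \<in> A"
  shows "{e\<in>SE. pos a b 0 \<in> e} = (\<lambda>b. seg a b 0) ` {b. (a, b) \<in> P}"
proof (rule equalityI)
  show "{e\<in>SE. pos a b 0 \<in> e} \<subseteq> (\<lambda>b. seg a b 0) ` {b. (a, b) \<in> P}"
    using assms q by (auto simp: SE_def seg_def pos_eq)
  have "pos a b 0 \<in> seg a b' 0" for b' by (simp add: seg_def pos_eq)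
  then show "(\<lambda>b. seg a b 0) ` {b. (a, b) \<in> P} \<subseteq> {e\<in>SE. pos a b 0 \<in> e}"
    using q by (auto intro: segI)
qed

lemma edges_right:
  assumes "b \<in> B"
  shows "{e\<in>SE. pos a b q \<in> e} = (\<lambda>a. seg a b (q - 1)) ` {a. (a, b) \<in> P}"
proof (rule equalityI)
  show "{e\<in>SE. pos a b q \<in> e} \<subseteq> (\<lambda>a. seg a b (q - 1)) ` {a. (a, b) \<in> P}"
    using assms q by (auto simp: SE_def seg_def pos_eq)
  have "pos a b q \<in> seg a' b (q - 1)" for a' using q by (simp add: seg_def pos_eq)
  then show "(\<lambda>a. seg a b (q - 1)) ` {a. (a, b) \<in> P} \<subseteq> {e\<in>SE. pos a b q \<in> e}"
    using q by (auto intro: segI)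
qed

lemma degree_interior:
  assumes "(a, b) \<in> P" "0 < j" "j < q" shows "degree SE (pos a b j) = 2"
proof -
  have "seg a b (j - 1) \<noteq> seg a b j" using seg_eq[of "j - 1" j a b a b] assms by force
  then show ?thesis unfolding degree_def edges_interior[OF assms] by simp
qed

lemma degree_left: "a \<in> A \<Longrightarrow> degree SE (pos a b 0) = 3"
proof -
  assume a: "a \<in> A"
  have "inj_on (\<lambda>b. seg a b 0) S" for S using seg_eq[of 0 0] q by (intro inj_onI) auto
  then show ?thesis unfolding degree_def edges_left[OF a] using degA[OF a] by (simp add: card_image)
qed

lemma degree_right: "b \<in> B \<Longrightarrow> degree SE (pos a b q) = 3"
proof -
  assume b: "b \<in> B"
  have "q - 1 < q" using q by simp
  from seg_eq[OF this this] have "inj_on (\<lambda>a. seg a b (q - 1)) S" for S by (intro inj_onI) blast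
  then show ?thesis unfolding degree_def edges_right[OF b] using degB[OF b] by (simp add: card_image)
qed

lemma SV_cases:
  assumes "v \<in> SV"
  obtains a b where "a \<in> A" "v = pos a b 0" | a b where "b \<in> B" "v = pos a b q"
    | a b j where "(a, b) \<in> P" "0 < j" "j < q" "v = pos a b j"
proof -
  obtain a b j where v: "v = pos a b j" "(a, b) \<in> P" "j \<le> q" using assms by (auto simp: SV_def)
  have ab: "a \<in> A" "b \<in> B" using v(2) P by auto
  consider "j = 0" | "j = q" | "0 < j" "j < q" using v(3) by linarith
  then show thesis by cases (use v ab that in blast)+
qed

lemma degree_ge_2: "v \<in> SV \<Longrightarrow> 2 \<le> degree SE v"
  by (erule SV_cases) (simp_all add: degree_left degree_right degree_interior)

lemma sum_excess: "(\<Sum>v\<in>SV. degree SE v - 2) \<le> card A + card B"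
proof -
  let ?L = "(\<lambda>a. pos a 0 0) ` A" and ?R = "(\<lambda>b. pos 0 b q) ` B"
  have "degree SE v - 2 \<le> (if v \<in> ?L \<union> ?R then 1 else 0)" if v: "v \<in> SV" for v
    using v
  proof (cases rule: SV_cases)
    case (1 a b)
    then have "v \<in> ?L" by (auto simp: pos_eq)
    then show ?thesis using degree_left[OF 1(1), of b] 1(2) by simp
  next
    case (2 a b)
    then have "v \<in> ?R" using q by (auto simp: pos_eq)
    then show ?thesis using degree_right[OF 2(1), of a] 2(2) by simp
  next
    case (3 a b j)
    then show ?thesis using degree_interior[OF 3(1-3)] by simp
  qed
  then have "(\<Sum>v\<in>SV. degree SE v - 2) \<le> (\<Sum>v\<in>SV. if v \<in> ?L \<union> ?R then 1 else 0)"
    by (rule sum_mono)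
  also have "\<dots> = (\<Sum>v\<in>SV \<inter> (?L \<union> ?R). 1)"
    using graph_S by (intro sum.inter_restrict[symmetric]) (simp add: graph_def)
  also have "\<dots> = card (SV \<inter> (?L \<union> ?R))" by simp
  also have "\<dots> \<le> card (?L \<union> ?R)" using fin by (intro card_mono) auto
  also have "\<dots> \<le> card ?L + card ?R" by (rule card_Un_le)
  also have "\<dots> \<le> card A + card B" using fin by (intro add_mono card_image_le)
  finally show ?thesis .
qed

lemma no_large_minor: "card A + card B < k * (k - 3) \<Longrightarrow> \<not> has_complete_minor k SV SE"
  using complete_minor_size[OF graph_S degree_ge_2] sum_excess by (meson leD order_trans)

text \<open>Degrees are at least two, so only an ear of length at least \<open>q + 1\<close> could
  be deleted. It has at least \<open>q\<close> consecutive inner vertices of degree two, but these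
  stay inside one subdivided edge, which has only \<open>q - 1\<close>.\<close>

lemma not_degenerate: "\<not> p_path_degenerate (Suc q) SV SE"
proof
  assume "p_path_degenerate (Suc q) SV SE"
  moreover obtain a where a: "a \<in> A" using A0 by blast
  moreover obtain b where "(a, b) \<in> P"
  proof -
    have "{b. (a, b) \<in> P} \<noteq> {}" using degA[OF a] by (metis card.empty zero_neq_numeral)
    then show thesis using that by blast
  qed
  then have "SV \<noteq> {}" by (auto simp: SV_def)
  ultimately obtain H where H: "p_reduction (Suc q) (SV, SE) H"
    unfolding p_path_degenerate_def by (metis Pair_inject converse_rtranclpE)
  then consider v where "v \<in> SV" "degree SE v = 0 \<or> degree SE v = 1"
    | vs where "strict_ear SV SE vs" "Suc q \<le> length vs - 1"
    unfolding p_reduction_def by auto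
  then show False
  proof cases
    case 1 then show ?thesis using degree_ge_2 by force
  next
    case 2
    have vs: "distinct vs" "set vs \<subseteq> SV" "\<And>i. Suc i < length vs \<Longrightarrow> {vs ! i, vs ! Suc i} \<in> SE"
      "\<And>i. 0 < i \<Longrightarrow> Suc i < length vs \<Longrightarrow> degree SE (vs ! i) = 2"
      using 2(1) by (auto simp: strict_ear_def is_path_def)
    have len: "Suc i < length vs" if "i \<le> q" for i using 2(2) that by linarith
    have int: "\<exists>a b j. (a, b) \<in> P \<and> 0 < j \<and> j < q \<and> vs ! i = pos a b j" if i: "i \<in> {1..q}" for i
    proof -
      have "vs ! i \<in> SV" using vs(2) len[of i] i by auto
      moreover have "degree SE (vs ! i) = 2" using vs(4)[of i] len[of i] i by simp
      ultimately show ?thesis using degree_left degree_right by (elim SV_cases) auto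
    qed
    obtain a b j where ab: "(a, b) \<in> P" "0 < j" "j < q" "vs ! 1 = pos a b j"
      using int[of 1] q by auto
    \<comment> \<open>Consecutive vertices of degree two cannot pass a branch vertex, so they stay
      on the path of \<open>(a, b)\<close>.\<close>
    have same: "vs ! Suc i \<in> pos a b ` {1..<q}" if "Suc i \<le> q" for i
      using that
    proof (induction i)
      case 0 then show ?case using ab by auto
    next
      case (Suc i)
      then obtain j where j: "vs ! Suc i = pos a b j" "0 < j" "j < q" by auto
      obtain a' b' j' where j': "0 < j'" "j' < q" "vs ! Suc (Suc i) = pos a' b' j'"
        using int[of "Suc (Suc i)"] Suc.prems by auto
      have e: "{vs ! Suc i, vs ! Suc (Suc i)} \<in> {e\<in>SE. pos a b j \<in> e}"
        using vs(3)[of "Suc i"] len[OF Suc.prems] j(1) by simp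
      then have "pos a' b' j' \<in> seg a b (j - 1) \<union> seg a b j"
        unfolding edges_interior[OF ab(1) j(2,3)] using j'(3) by auto
      then have "a' = a" "b' = b" using j' j by (auto simp: seg_def pos_eq)
      then show ?case using j' by auto
    qed
    have "(!) vs ` {1..q} \<subseteq> pos a b ` {1..<q}"
    proof
      fix x assume "x \<in> (!) vs ` {1..q}"
      then obtain i where "i \<in> {1..q}" "x = vs ! i" by blast
      then show "x \<in> pos a b ` {1..<q}" using same[of "i - 1"] by auto
    qed
    then have "card ((!) vs ` {1..q}) \<le> card (pos a b ` {1..<q})" by (intro card_mono) auto
    also have "\<dots> \<le> card {1..<q}" by (rule card_image_le) simp
    also have "card ((!) vs ` {1..q}) = card {1..q}"
      using vs(1) len by (intro card_image inj_onI) (auto simp: nth_eq_iff_index_eq Suc_lessD)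
    finally show False using q by simp
  qed
qed

text \<open>A cycle that uses one segment of a subdivided edge uses all \<open>q\<close> of them,
  since inner vertices have degree two. The base edges it uses form a set without leaves; assuming
  the bound for such sets spares the construction of a cycle in the base graph.\<close>

lemma girth_S:
  assumes girth: "\<And>F. F \<subseteq> P \<Longrightarrow> F \<noteq> {} \<Longrightarrow>
      (\<And>a b. (a, b) \<in> F \<Longrightarrow> (\<exists>b'. b' \<noteq> b \<and> (a, b') \<in> F) \<and> (\<exists>a'. a' \<noteq> a \<and> (a', b) \<in> F)) \<Longrightarrow> g \<le> card F"
  shows "girth_ge SV SE (q * g)"
  unfolding girth_ge_def
proof (intro allI impI)
  fix l assume "has_cycle_len SV SE l"
  then obtain vs where vs: "length vs = l" "3 \<le> l" "distinct vs"
    "\<And>i. i < l \<Longrightarrow> {vs ! i, vs ! ((i + 1) mod l)} \<in> SE"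
    unfolding has_cycle_len_def by (elim exE conjE) (rule that, auto)
  define C where "C i = {vs ! i, vs ! ((i + 1) mod l)}" for i
  define F where "F = C ` {..<l}"
  have FE: "F \<subseteq> SE" using vs(4) by (auto simp: F_def C_def)
  have cF: "card F \<le> l" using card_image_le[of "{..<l}" C] by (simp add: F_def)
  have two: "\<exists>e'\<in>F. e' \<noteq> e \<and> v \<in> e'" if e: "e \<in> F" "v \<in> e" for e v
  proof -
    obtain i0 where "i0 < l" "e = C i0" using e(1) by (auto simp: F_def)
    then obtain i where i: "i < l" "v = vs ! i"
      using e(2) vs(2) by (auto simp: C_def) (metis mod_less_divisor less_le_trans zero_less_numeral)
    define h where "h = (if i = 0 then l - 1 else i - 1)"
    have h: "h < l" "(h + 1) mod l = i" using i(1) vs(2) by (auto simp: h_def)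
    have "vs ! h \<noteq> vs ! ((i + 1) mod l)" "vs ! h \<noteq> vs ! i"
    proof -
      have "h \<noteq> (i + 1) mod l" using i(1) vs(2) by (cases "i + 1 = l") (auto simp: h_def)
      moreover have "h \<noteq> i" using vs(2) by (auto simp: h_def)
      moreover have "(i + 1) mod l < l" using vs(2) by simp
      ultimately show "vs ! h \<noteq> vs ! ((i + 1) mod l)" "vs ! h \<noteq> vs ! i"
        using vs(1,3) h(1) i(1) by (simp_all add: nth_eq_iff_index_eq)
    qed
    then have "C h \<noteq> C i" using h(2) by (auto simp: C_def doubleton_eq_iff)
    moreover have "v \<in> C h" "v \<in> C i" "C h \<in> F" "C i \<in> F" using h i by (auto simp: C_def F_def)
    ultimately show ?thesis by metis
  qed
  define Q where "Q = {(a, b) \<in> P. \<exists>j<q. seg a b j \<in> F}"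
  have down: "seg a b (j - 1) \<in> F" if *: "(a, b) \<in> P" "seg a b j \<in> F" "0 < j" "j < q" for a b j
  proof -
    obtain e' where "e' \<in> F" "e' \<noteq> seg a b j" "pos a b j \<in> e'"
      using two[OF *(2), of "pos a b j"] by (auto simp: seg_def)
    then have "e' \<in> {seg a b (j - 1), seg a b j}"
      using edges_interior[OF *(1,3,4)] FE by blast
    then show ?thesis using \<open>e' \<in> F\<close> \<open>e' \<noteq> seg a b j\<close> by auto
  qed
  have up: "seg a b (Suc j) \<in> F" if *: "(a, b) \<in> P" "seg a b j \<in> F" "Suc j < q" for a b j
  proof -
    obtain e' where "e' \<in> F" "e' \<noteq> seg a b j" "pos a b (Suc j) \<in> e'"
      using two[OF *(2), of "pos a b (Suc j)"] by (auto simp: seg_def)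
    then have "e' \<in> {seg a b (Suc j - 1), seg a b (Suc j)}"
      using edges_interior[OF *(1) _ *(3)] FE by blast
    then show ?thesis using \<open>e' \<in> F\<close> \<open>e' \<noteq> seg a b j\<close> by auto
  qed
  have zero: "seg a b 0 \<in> F" if ab: "(a, b) \<in> P" and j: "j < q" "seg a b j \<in> F" for a b j
    using j
  proof (induction j)
    case (Suc j) then show ?case using down[OF ab Suc.prems(2)] by simp
  qed simp
  have all: "seg a b j \<in> F" if "(a, b) \<in> Q" "j < q" for a b j
    using that(2)
  proof (induction j)
    case 0 then show ?case using that(1) zero by (auto simp: Q_def)
  next
    case (Suc j) then show ?case using up[of a b j] that(1) by (auto simp: Q_def)
  qed
  have "g \<le> card Q"
  proof (rule girth)
    show "Q \<subseteq> P" by (auto simp: Q_def)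
    have "C 0 \<in> F" using vs(2) by (auto simp: F_def)
    then obtain a b j where "(a, b) \<in> P" "j < q" "seg a b j \<in> F" using FE by (auto simp: SE_def)
    then show "Q \<noteq> {}" by (auto simp: Q_def)
    fix a b assume ab: "(a, b) \<in> Q"
    then have abP: "(a, b) \<in> P" "a \<in> A" "b \<in> B" using P by (auto simp: Q_def)
    obtain e where e: "e \<in> F" "e \<noteq> seg a b 0" "pos a b 0 \<in> e"
      using two[OF all[OF ab], of 0 "pos a b 0"] q by (auto simp: seg_def)
    then obtain b' where "e = seg a b' 0" "(a, b') \<in> P" using edges_left[OF abP(2), of b] FE by blast
    then have "b' \<noteq> b" "(a, b') \<in> Q" using e q by (auto simp: Q_def)
    then have 1: "\<exists>b'. b' \<noteq> b \<and> (a, b') \<in> Q" by blast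
    have "pos a b q \<in> seg a b (q - 1)" using q by (simp add: seg_def)
    then obtain e where e: "e \<in> F" "e \<noteq> seg a b (q - 1)" "pos a b q \<in> e"
      using two[OF all[OF ab], of "q - 1" "pos a b q"] q by auto
    then obtain a' where a': "e = seg a' b (q - 1)" "(a', b) \<in> P" using edges_right[OF abP(3), of a] FE by blast
    have "q - 1 < q" using q by simp
    then have "a' \<noteq> a" "(a', b) \<in> Q" using e a' unfolding Q_def by auto
    then show "(\<exists>b'. b' \<noteq> b \<and> (a, b') \<in> Q) \<and> (\<exists>a'. a' \<noteq> a \<and> (a', b) \<in> Q)" using 1 by blast
  qed
  then have "q * g \<le> q * card Q" by simp
  also have "\<dots> = card (Q \<times> {..<q})" by (simp add: card_cartesian_product)
  also have "\<dots> \<le> card F"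
  proof (rule card_inj_on_le)
    show "inj_on (\<lambda>((a, b), j). seg a b j) (Q \<times> {..<q})"
      by (rule inj_onI) (auto dest!: seg_eq[rotated 2])
    show "(\<lambda>((a, b), j). seg a b j) ` (Q \<times> {..<q}) \<subseteq> F" using all by auto
    show "finite F" by (simp add: F_def)
  qed
  finally show "q * g \<le> l" using cF by linarith
qed

end

section \<open>A quaternion order of discriminant five\<close>

text \<open>The order is spanned by \<open>1, g\<^sub>0, g\<^sub>1, z\<close>, where \<open>g\<^sub>0, g\<^sub>1, g\<^sub>2\<close> are pure quaternions of norm \<open>2\<close> with
  \<open>g\<^sub>i g\<^sub>j + g\<^sub>j g\<^sub>i = 1\<close> for \<open>i \<noteq> j\<close>, and \<open>z = (1 + g\<^sub>0 + g\<^sub>1 + g\<^sub>2) / 2\<close>; the multiplication table follows from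
  \<open>g\<^sub>0 g\<^sub>1 = z + g\<^sub>2\<close> and its cyclic shifts.\<close>
type_synonym quat = "int \<times> int \<times> int \<times> int"

fun qmul :: "quat \<Rightarrow> quat \<Rightarrow> quat" where
  "qmul (a, b, c, d) (e, f, g, h) =
    (a*e - 2*(b*f) - 2*(c*g) - d*h - b*g + 2*(c*f) - b*h - d*g,
     a*f + b*e - b*g + c*f + d*f + c*h - d*g,
     a*g + c*e - b*g + c*f - b*h + d*f + c*h,
     a*h + d*e + d*h + 3*(b*g) - 3*(c*f) + b*h - d*f - c*h + d*g)"

fun qnorm :: "quat \<Rightarrow> int" where
  "qnorm (a, b, c, d) = a^2 + a*d + d^2 + 2*b^2 + 2*c^2 - b*c + b*d + c*d"

text \<open>Since \<open>z\<close> has trace 1, its conjugate is \<open>1 - z\<close>, hence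
  \<open>a + d\<close>.\<close>

fun qconj :: "quat \<Rightarrow> quat" where
  "qconj (a, b, c, d) = (a + d, -b, -c, -d)"

fun qscale :: "int \<Rightarrow> quat \<Rightarrow> quat" where
  "qscale t (a, b, c, d) = (t*a, t*b, t*c, t*d)"

fun qadd :: "quat \<Rightarrow> quat \<Rightarrow> quat" where
  "qadd (a, b, c, d) (e, f, g, h) = (a + e, b + f, c + g, d + h)"

text \<open>The third value is \<open>2 z - 1 - g\<^sub>0 - g\<^sub>1\<close>, solved from the
  definition of \<open>z\<close>.\<close>

fun qgen :: "nat \<Rightarrow> quat" where
  "qgen i = (if i = 0 then (0, 1, 0, 0) else if i = 1 then (0, 0, 1, 0) else (-1, -1, -1, 2))"

fun qcong :: "int \<Rightarrow> quat \<Rightarrow> quat \<Rightarrow> bool" where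
  "qcong q (a, b, c, d) (e, f, g, h) \<longleftrightarrow>
    [a = e] (mod q) \<and> [b = f] (mod q) \<and> [c = g] (mod q) \<and> [d = h] (mod q)"

declare qgen.simps [simp del]

section \<open>Ring identities and congruences in the order\<close>

lemma qmul_assoc: "qmul (qmul x y) z = qmul x (qmul y z)"
  by (cases x; cases y; cases z) (simp add: algebra_simps)

lemma qnorm_mul: "qnorm (qmul x y) = qnorm x * qnorm y"
proof -
  obtain a b c d where x: "x = (a, b, c, d)" by (cases x)
  obtain e f g h where y: "y = (e, f, g, h)" by (cases y)
  show ?thesis unfolding x y qmul.simps qnorm.simps by algebra
qed

lemma qconj_mul: "qmul (qconj x) x = (qnorm x, 0, 0, 0)"
  by (cases x) (simp add: algebra_simps power2_eq_square)

lemma qmul_scalar: "qmul x (t, 0, 0, 0) = qscale t x" "qmul (t, 0, 0, 0) x = qscale t x"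
  by (cases x; simp)+

lemma qmul_scale: "qmul (qscale t x) y = qscale t (qmul x y)" "qmul x (qscale t y) = qscale t (qmul x y)"
  by (cases x; cases y; simp add: algebra_simps)+

lemma qscale_scale: "qscale s (qscale t x) = qscale (s * t) x"
  by (cases x) simp

lemma qscale_1 [simp]: "qscale 1 x = x"
  by (cases x) simp

lemma qgen_square: "qmul (qgen i) (qgen i) = (-2, 0, 0, 0)"
  by (simp add: qgen.simps)

lemma qnorm_gen: "qnorm (qgen i) = 2"
  by (simp add: qgen.simps)

lemma qcong_refl [simp]: "qcong q x x"
  by (cases x) simp

lemma qcong_sym: "qcong q x y \<Longrightarrow> qcong q y x"
  by (cases x; cases y) (simp add: cong_sym)

lemma qcong_trans: "qcong q x y \<Longrightarrow> qcong q y z \<Longrightarrow> qcong q x z"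
  by (cases x; cases y; cases z) (auto intro: cong_trans)

lemma qcong_mul:
  assumes "qcong q x y" "qcong q u v" shows "qcong q (qmul x u) (qmul y v)"
proof -
  obtain a b c d where x: "x = (a, b, c, d)" by (cases x)
  obtain a' b' c' d' where y: "y = (a', b', c', d')" by (cases y)
  obtain e f g h where u: "u = (e, f, g, h)" by (cases u)
  obtain e' f' g' h' where v: "v = (e', f', g', h')" by (cases v)
  have 1: "[a = a'] (mod q)" "[b = b'] (mod q)" "[c = c'] (mod q)" "[d = d'] (mod q)"
    "[e = e'] (mod q)" "[f = f'] (mod q)" "[g = g'] (mod q)" "[h = h'] (mod q)"
    using assms by (simp_all add: x y u v)
  show ?thesis unfolding x y u v qmul.simps qcong.simps
    by (intro conjI cong_add cong_diff cong_mult 1 cong_refl)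
qed

lemma qcong_scale: "[s = t] (mod q) \<Longrightarrow> qcong q x y \<Longrightarrow> qcong q (qscale s x) (qscale t y)"
  by (cases x; cases y) (auto intro: cong_mult)

text \<open>The arguments are length, last letter and product. Squares of generators are scalars, so
  words without equal neighbours describe the walks that never turn back.\<close>

inductive reduced_word :: "nat \<Rightarrow> nat \<Rightarrow> quat \<Rightarrow> bool" where
  single: "i < 3 \<Longrightarrow> reduced_word 1 i (qgen i)"
| snoc: "reduced_word n i w \<Longrightarrow> j < 3 \<Longrightarrow> j \<noteq> i \<Longrightarrow> reduced_word (Suc n) j (qmul w (qgen j))"

section \<open>Norm and parity of reduced words\<close>

lemma reduced_word_pos: "reduced_word n i w \<Longrightarrow> n > 0"
  by (induction rule: reduced_word.induct) auto

lemma reduced_word_norm: "reduced_word n i w \<Longrightarrow> qnorm w = 2 ^ n"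
  by (induction rule: reduced_word.induct) (simp_all add: qnorm_mul qnorm_gen)

lemma qgen_anticommute:
  assumes "i < 3" "j < 3" "i \<noteq> j"
  shows "qadd (qmul (qmul w (qgen i)) (qgen j)) (qmul (qmul w (qgen j)) (qgen i)) = w"
proof -
  obtain a b c d where w: "w = (a, b, c, d)" by (cases w)
  have "(i, j) \<in> {(0, 1), (0, 2), (1, 0), (1, 2), (2, 0), (2, 1)}" using assms by auto
  then show ?thesis unfolding w
    by (elim insertE) (simp_all add: qgen.simps)
qed

text \<open>By \<open>qgen_anticommute\<close>, \<open>w\<close> is the sum of the two products
  after one more multiplication each, and both summands are even.\<close>

lemma even_of_two_even:
  assumes ij: "i < 3" "j < 3" "i \<noteq> j"
    and even: "qcong 2 (qmul w (qgen i)) (0, 0, 0, 0)" "qcong 2 (qmul w (qgen j)) (0, 0, 0, 0)"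
  shows "qcong 2 w (0, 0, 0, 0)"
proof -
  have z: "qmul (0, 0, 0, 0) x = (0, 0, 0, 0)" for x by (cases x) simp
  have *: "qcong 2 x (0, 0, 0, 0) \<Longrightarrow> qcong 2 y (0, 0, 0, 0) \<Longrightarrow> qcong 2 (qadd x y) (0, 0, 0, 0)" for x y
    by (cases x; cases y) (auto simp: cong_iff_dvd_diff)
  have "qcong 2 (qadd (qmul (qmul w (qgen i)) (qgen j)) (qmul (qmul w (qgen j)) (qgen i))) (0, 0, 0, 0)"
    by (intro *) (use qcong_mul[OF even(1) qcong_refl, of "qgen j"] qcong_mul[OF even(2) qcong_refl, of "qgen i"]
      in \<open>simp_all only: z\<close>)
  then show ?thesis by (simp only: qgen_anticommute[OF ij])
qed

text \<open>Repeating the last letter produces the factor -2, so by \<open>even_of_two_even\<close>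
  any other letter gives a product that is still not divisible by 2. This is what keeps reduced
  words from collapsing to integers.\<close>

lemma reduced_word_mod2:
  "reduced_word n i w \<Longrightarrow> i < 3 \<and> qcong 2 (qmul w (qgen i)) (0, 0, 0, 0) \<and> \<not> qcong 2 w (0, 0, 0, 0)"
proof (induction rule: reduced_word.induct)
  case (single i)
  then show ?case by (simp add: qgen_square) (simp add: qgen.simps cong_iff_dvd_diff)
next
  case (snoc n i w j)
  have "qmul (qmul w (qgen j)) (qgen j) = qscale (-2) w"
    by (simp add: qmul_assoc qgen_square qmul_scalar)
  then have "qcong 2 (qmul (qmul w (qgen j)) (qgen j)) (0, 0, 0, 0)"
    by (cases w) (simp add: cong_iff_dvd_diff)
  moreover have "\<not> qcong 2 (qmul w (qgen j)) (0, 0, 0, 0)"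
    using even_of_two_even[of i j w] snoc by blast
  ultimately show ?case using snoc by blast
qed

text \<open>The form is four times \<open>qnorm (a, b, c, d)\<close> minus
  \<open>(2 * a + d)^2\<close>; three times it is a sum of squares.\<close>

lemma pos_def_form:
  fixes b c d :: int
  shows "0 \<le> 3*d^2 + 4*d*(b + c) + 8*b^2 + 8*c^2 - 4*b*c"
    and "3*d^2 + 4*d*(b + c) + 8*b^2 + 8*c^2 - 4*b*c = 0 \<Longrightarrow> b = 0 \<and> c = 0 \<and> d = 0"
proof -
  define R where "R = 3*d^2 + 4*d*(b + c) + 8*b^2 + 8*c^2 - 4*b*c"
  have R: "3 * R = (3*d + 2*(b + c))^2 + 10 * (b - c)^2 + 10 * b^2 + 10 * c^2"
    unfolding R_def by (simp add: power2_eq_square algebra_simps)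
  then have "3 * R \<ge> 0" by (simp add: add_nonneg_nonneg)
  then show "0 \<le> 3*d^2 + 4*d*(b + c) + 8*b^2 + 8*c^2 - 4*b*c" by (simp add: R_def)
  assume "3*d^2 + 4*d*(b + c) + 8*b^2 + 8*c^2 - 4*b*c = 0"
  then have "(3*d + 2*(b + c))^2 + 10 * (b - c)^2 + 10 * b^2 + 10 * c^2 = 0" using R by (simp add: R_def)
  moreover have "0 \<le> (3*d + 2*(b + c))^2" "0 \<le> (b - c)^2" "0 \<le> b^2" "0 \<le> c^2" by simp_all
  ultimately have "b^2 = 0" "c^2 = 0" "(3*d + 2*(b + c))^2 = 0" by linarith+
  then show "b = 0 \<and> c = 0 \<and> d = 0" by simp
qed

text \<open>For a word of even length \<open>2s\<close> congruent to a scalar, four times the norm form reads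
  \<open>(2^(s+1))^2 = A^2 + q^2 R\<close>, so \<open>q^2\<close> divides one of the two factors \<open>2^(s+1) \<plusminus> A\<close>.\<close>
lemma scalar_word_long:
  fixes q :: int
  assumes w: "reduced_word (2 * s) i w" and q: "prime q" "q > 2" and sc: "qcong q w (t, 0, 0, 0)"
  shows "q^2 < 2 ^ (s + 2)"
proof -
  obtain a b c d where wd: "w = (a, b, c, d)" by (cases w)
  have "q dvd b" "q dvd c" "q dvd d" using sc by (auto simp: wd cong_iff_dvd_diff)
  then obtain b' c' d' where bcd: "b = q * b'" "c = q * c'" "d = q * d'" unfolding dvd_def by blast
  have s0: "s \<ge> 1" using reduced_word_pos[OF w] by simp
  define R where "R = 3*d'^2 + 4*d'*(b' + c') + 8*b'^2 + 8*c'^2 - 4*b'*c'"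
  define A where "A = 2 * a + d"
  define T where "T = (2::int) ^ (s + 1)"
  have N: "qnorm w = 2 ^ (2 * s)" by (rule reduced_word_norm[OF w])
  have "T^2 = 2 ^ ((s + 1) * 2)" unfolding T_def by (rule power_mult[symmetric])
  also have "(s + 1) * 2 = 2 + 2 * s" by simp
  also have "(2::int) ^ (2 + 2 * s) = 4 * 2 ^ (2 * s)" by (simp only: power_add) simp
  also have "\<dots> = 4 * qnorm w" by (simp add: N)
  also have "\<dots> = A^2 + q^2 * R" unfolding wd qnorm.simps A_def R_def bcd
    by (simp add: power2_eq_square algebra_simps)
  finally have eq: "T^2 = A^2 + q^2 * R" .
  have R0: "R \<ge> 0" unfolding R_def by (rule pos_def_form(1))
  \<comment> \<open>Otherwise \<open>w\<close> would be an integer, even because its square is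
    \<open>2 ^ (2 * s)\<close>; by \<open>reduced_word_mod2\<close> no reduced word is even.\<close>
  have "R \<noteq> 0"
  proof
    assume "R = 0"
    then have "b' = 0 \<and> c' = 0 \<and> d' = 0" unfolding R_def by (rule pos_def_form(2))
    then have w': "w = (a, 0, 0, 0)" using wd bcd by simp
    then have "a^2 = 2 ^ (2 * s)" using N by simp
    then have "even (a^2)" using s0 by simp
    then have "even a" by simp
    then have "qcong 2 w (0, 0, 0, 0)" by (simp add: w' cong_iff_dvd_diff)
    then show False using reduced_word_mod2[OF w] by blast
  qed
  then have "R \<ge> 1" using R0 by linarith
  then have "q^2 * R > 0" using q by simp
  then have "A^2 < T^2" using eq by linarith
  then have AT: "\<bar>A\<bar> < T" using abs_le_square_iff[of T A] by (simp add: T_def)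
  have prod: "q^2 dvd (T - A) * (T + A)"
  proof -
    have "(T - A) * (T + A) = q^2 * R" using eq by (simp add: power2_eq_square algebra_simps)
    then show ?thesis by simp
  qed
  \<comment> \<open>The factors add up to \<open>2 ^ (s + 2)\<close>, so the odd prime
    \<open>q\<close> divides at most one of them and \<open>q^2\<close> goes entirely into that one,
    which lies between 0 and \<open>2 * T\<close>.\<close>
  have ncop: "\<not> (q dvd T - A \<and> q dvd T + A)"
  proof
    assume "q dvd T - A \<and> q dvd T + A"
    then have "q dvd (T - A) + (T + A)" by (meson dvd_add)
    then have "q dvd 2 ^ (s + 2)" by (simp add: T_def)
    then have "q dvd 2" using q(1) prime_dvd_power by blast
    then show False using q(2) zdvd_imp_le[of q 2] by simp
  qed
  have "q^2 dvd T - A \<or> q^2 dvd T + A"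
  proof (cases "q dvd T - A")
    case True
    then have "coprime (q^2) (T + A)" using ncop q(1) by (simp add: prime_imp_coprime)
    then show ?thesis using prod by (simp add: coprime_dvd_mult_left_iff)
  next
    case False
    then have "coprime (q^2) (T - A)" using q(1) by (simp add: prime_imp_coprime)
    then show ?thesis using prod by (simp add: coprime_dvd_mult_right_iff)
  qed
  then have "q^2 < 2 * T"
  proof
    assume "q^2 dvd T - A"
    then have "q^2 \<le> T - A" using AT by (intro zdvd_imp_le) auto
    then show ?thesis using AT by linarith
  next
    assume "q^2 dvd T + A"
    then have "q^2 \<le> T + A" using AT by (intro zdvd_imp_le) auto
    then show ?thesis using AT by linarith
  qed
  then show ?thesis by (simp add: T_def)
qed

section \<open>Cubic graphs from quaternions modulo a prime\<close>

locale quat_mod =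
  fixes q :: int
  assumes q: "prime q" "q > 2"
begin

definition proj_eq :: "quat \<Rightarrow> quat \<Rightarrow> bool" where
  "proj_eq x y \<longleftrightarrow> (\<exists>t. \<not> q dvd t \<and> qcong q (qscale t x) y)"

lemma inverse_mod:
  assumes "\<not> q dvd t" obtains u where "\<not> q dvd u" "[u * t = 1] (mod q)"
proof -
  have "coprime t q" using assms q(1) by (metis coprime_commute prime_imp_coprime)
  then obtain u where u: "[t * u = 1] (mod q)" using cong_solve_coprime_int by blast
  have "\<not> q dvd u"
  proof
    assume "q dvd u"
    then have "q dvd t * u" by simp
    then have "q dvd 1" using u by (simp add: cong_dvd_iff)
    then show False using q by simp
  qed
  then show thesis using that u by (simp add: mult.commute)
qed

lemma proj_eq_refl: "proj_eq x x"
  unfolding proj_eq_def by (rule exI[of _ 1]) (use q in simp)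

lemma proj_eq_sym: "proj_eq x y \<Longrightarrow> proj_eq y x"
proof -
  assume "proj_eq x y"
  then obtain t where t: "\<not> q dvd t" "qcong q (qscale t x) y" by (auto simp: proj_eq_def)
  obtain u where u: "\<not> q dvd u" "[u * t = 1] (mod q)" using inverse_mod[OF t(1)] .
  have "qcong q (qscale u y) (qscale u (qscale t x))"
    by (rule qcong_scale[OF cong_refl qcong_sym[OF t(2)]])
  also have "qscale u (qscale t x) = qscale (u * t) x" by (rule qscale_scale)
  finally have "qcong q (qscale u y) (qscale (u * t) x)" .
  moreover have "qcong q (qscale (u * t) x) (qscale 1 x)" by (rule qcong_scale[OF u(2) qcong_refl])
  ultimately have "qcong q (qscale u y) (qscale 1 x)" by (rule qcong_trans)
  then have "qcong q (qscale u y) x" by (simp only: qscale_1)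
  then show "proj_eq y x" using u(1) by (auto simp: proj_eq_def)
qed

lemma proj_eq_trans: "proj_eq x y \<Longrightarrow> proj_eq y z \<Longrightarrow> proj_eq x z"
proof -
  assume "proj_eq x y" "proj_eq y z"
  then obtain s t where s: "\<not> q dvd s" "qcong q (qscale s x) y" and t: "\<not> q dvd t" "qcong q (qscale t y) z"
    by (auto simp: proj_eq_def)
  have "qcong q (qscale t (qscale s x)) (qscale t y)" by (rule qcong_scale[OF cong_refl s(2)])
  then have "qcong q (qscale (t * s) x) z" using qcong_trans[OF _ t(2)] by (simp add: qscale_scale)
  moreover have "\<not> q dvd t * s" using s t q(1) by (simp add: prime_dvd_mult_iff)
  ultimately show "proj_eq x z" by (auto simp: proj_eq_def)
qed

lemma proj_eq_mul: "proj_eq x y \<Longrightarrow> proj_eq (qmul x z) (qmul y z)"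
  unfolding proj_eq_def using qcong_mul[OF _ qcong_refl, of q _ y z] by (metis qmul_scale(1))

lemma proj_eq_scale: "\<not> q dvd t \<Longrightarrow> proj_eq x (qscale t x)"
  unfolding proj_eq_def by (intro exI[of _ t]) simp

text \<open>A label in \<open>nat\<close>, as \<open>gKp\<close> asks for. Equivalent quaternions
  give the same predicate \<open>proj_eq x\<close>, so the choice operator returns the same
  representative.\<close>

definition cls :: "quat \<Rightarrow> nat" where
  "cls x = to_nat (SOME y. proj_eq x y)"

lemma cls_eq: "cls x = cls y \<longleftrightarrow> proj_eq x y"
proof
  assume "cls x = cls y"
  then have e: "(SOME z. proj_eq x z) = (SOME z. proj_eq y z)" by (simp add: cls_def)
  have "proj_eq x (SOME z. proj_eq x z)" "proj_eq y (SOME z. proj_eq y z)"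
    by (rule someI_ex, use proj_eq_refl in blast)+
  then show "proj_eq x y" using e proj_eq_sym proj_eq_trans by metis
next
  assume "proj_eq x y"
  then have "proj_eq x = proj_eq y" using proj_eq_sym proj_eq_trans by blast
  then show "cls x = cls y" by (simp add: cls_def)
qed

text \<open>Units modulo \<open>q\<close> up to scalars. \<open>es\<close> is the adjacency relation
  of the Cayley graph of this group for the three generators, which are involutions there; as a set
  of ordered pairs it also serves as the edge set of the double cover.\<close>

definition vs :: "nat set" where "vs = {cls w |w. \<not> q dvd qnorm w}"
definition es :: "(nat \<times> nat) set" where
  "es = {(cls w, cls (qmul w (qgen i))) |w i. \<not> q dvd qnorm w \<and> i < 3}"

lemma vsI: "\<not> q dvd qnorm w \<Longrightarrow> cls w \<in> vs"
  unfolding vs_def by blast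

lemma esI: "\<not> q dvd qnorm w \<Longrightarrow> i < 3 \<Longrightarrow> (cls w, cls (qmul w (qgen i))) \<in> es"
  unfolding es_def by blast

lemma esE:
  assumes "(a, b) \<in> es"
  obtains w i where "\<not> q dvd qnorm w" "i < 3" "a = cls w" "b = cls (qmul w (qgen i))"
  using assms unfolding es_def by blast

lemma not_dvd_2: "\<not> q dvd 2" "\<not> q dvd -2"
  using q zdvd_imp_le[of q 2] by auto

lemma norm_gen_ok: "\<not> q dvd qnorm w \<Longrightarrow> \<not> q dvd qnorm (qmul w (qgen i))"
  using not_dvd_2 q(1) by (simp add: qnorm_mul qnorm_gen prime_dvd_mult_iff)

lemma cls_gen_gen: "cls (qmul (qmul w (qgen i)) (qgen i)) = cls w"
proof -
  have "qmul (qmul w (qgen i)) (qgen i) = qscale (-2) w" by (simp add: qmul_assoc qgen_square qmul_scalar)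
  then show ?thesis using proj_eq_sym[OF proj_eq_scale[OF not_dvd_2(2), of w]] by (simp add: cls_eq)
qed

lemma es_sym: "(a, b) \<in> es \<Longrightarrow> (b, a) \<in> es"
proof -
  assume "(a, b) \<in> es"
  then obtain w i where w: "\<not> q dvd qnorm w" "i < 3" "a = cls w" "b = cls (qmul w (qgen i))" by (rule esE)
  show ?thesis using esI[OF norm_gen_ok[OF w(1)] w(2), of i] by (simp only: w(3,4) cls_gen_gen)
qed

lemma es_subset: "es \<subseteq> vs \<times> vs"
proof
  fix e assume "e \<in> es"
  moreover obtain a b where e: "e = (a, b)" by (cases e)
  ultimately obtain w i where "\<not> q dvd qnorm w" "a = cls w" "b = cls (qmul w (qgen i))" by (metis esE)
  then show "e \<in> vs \<times> vs" using vsI norm_gen_ok e by simp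
qed

lemma es_from: "(cls w, b) \<in> es \<Longrightarrow> \<exists>i<3. b = cls (qmul w (qgen i))"
proof -
  assume "(cls w, b) \<in> es"
  then obtain x i where x: "i < 3" "cls w = cls x" "b = cls (qmul x (qgen i))" by (rule esE)
  then have "b = cls (qmul w (qgen i))" using proj_eq_mul[of w x] by (simp add: cls_eq proj_eq_sym)
  then show ?thesis using x(1) by blast
qed

text \<open>Closed walks are quaternions congruent to scalars.\<close>
lemma closed_word_long:
  assumes w: "reduced_word (2 * s) i w" and x: "\<not> q dvd qnorm x" and closed: "cls (qmul x w) = cls x"
  shows "q^2 < 2 ^ (s + 2)"
proof -
  have "proj_eq x (qmul x w)" using closed by (simp add: cls_eq proj_eq_sym)
  then obtain t where t: "qcong q (qscale t x) (qmul x w)" by (auto simp: proj_eq_def)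
  have "qcong q (qmul (qconj x) (qmul x w)) (qmul (qconj x) (qscale t x))"
    by (rule qcong_mul[OF qcong_refl qcong_sym[OF t]])
  moreover have "qmul (qconj x) (qmul x w) = qscale (qnorm x) w"
    by (simp add: qconj_mul qmul_scalar flip: qmul_assoc)
  moreover have "qmul (qconj x) (qscale t x) = (t * qnorm x, 0, 0, 0)"
    by (simp add: qmul_scale qconj_mul)
  ultimately have c: "qcong q (qscale (qnorm x) w) (t * qnorm x, 0, 0, 0)" by simp
  obtain u where u: "[u * qnorm x = 1] (mod q)" using inverse_mod[OF x] .
  have "qcong q (qscale u (qscale (qnorm x) w)) (qscale u (t * qnorm x, 0, 0, 0))"
    by (rule qcong_scale[OF cong_refl c])
  then have 1: "qcong q (qscale (u * qnorm x) w) (u * (t * qnorm x), 0, 0, 0)" by (simp add: qscale_scale)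
  have "qcong q (qscale 1 w) (qscale (u * qnorm x) w)"
    by (rule qcong_scale[OF cong_sym[OF u] qcong_refl])
  from qcong_trans[OF this 1] have "qcong q w (u * (t * qnorm x), 0, 0, 0)" by (simp only: qscale_1)
  then show ?thesis by (rule scalar_word_long[OF w q])
qed

lemma q_ge_3: "q^2 \<ge> 9"
  using q power_mono[of 3 q 2] by simp

text \<open>Otherwise the product of \<open>qgen i\<close> and \<open>qgen j\<close>, a reduced word
  of length two, would be closed, forcing q^2 < 8.\<close>

lemma cls_gen_inj:
  assumes "\<not> q dvd qnorm w" "i < 3" "j < 3" "cls (qmul w (qgen i)) = cls (qmul w (qgen j))"
  shows "i = j"
proof (rule ccontr)
  assume ij: "i \<noteq> j"
  have "cls (qmul (qmul w (qgen i)) (qgen j)) = cls (qmul (qmul w (qgen j)) (qgen j))"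
    using assms(4) proj_eq_mul by (simp add: cls_eq)
  then have "cls (qmul w (qmul (qgen i) (qgen j))) = cls w" by (simp add: cls_gen_gen flip: qmul_assoc)
  moreover have "reduced_word (2 * 1) j (qmul (qgen i) (qgen j))"
    using snoc[OF single[OF assms(2)] assms(3)] ij by (simp add: numeral_2_eq_2)
  ultimately have "q^2 < 2 ^ (1 + 2)" using closed_word_long assms(1) by blast
  then show False using q_ge_3 by simp
qed

lemma degree_es: "a \<in> vs \<Longrightarrow> card {b. (a, b) \<in> es} = 3"
proof -
  assume "a \<in> vs"
  then obtain w where w: "a = cls w" "\<not> q dvd qnorm w" by (auto simp: vs_def)
  have "{b. (a, b) \<in> es} = (\<lambda>i. cls (qmul w (qgen i))) ` {..<3}"
  proof (rule equalityI)
    show "{b. (a, b) \<in> es} \<subseteq> (\<lambda>i. cls (qmul w (qgen i))) ` {..<3}"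
      using es_from[of w] w(1) by blast
    show "(\<lambda>i. cls (qmul w (qgen i))) ` {..<3} \<subseteq> {b. (a, b) \<in> es}"
      using esI[OF w(2)] w(1) by blast
  qed
  moreover have "inj_on (\<lambda>i. cls (qmul w (qgen i))) {..<3}"
    by (rule inj_onI) (use cls_gen_inj[OF w(2)] in auto)
  ultimately show ?thesis by (simp add: card_image)
qed

lemma degree_es': "b \<in> vs \<Longrightarrow> card {a. (a, b) \<in> es} = 3"
proof -
  assume "b \<in> vs"
  moreover have "{a. (a, b) \<in> es} = {a. (b, a) \<in> es}" using es_sym by blast
  ultimately show ?thesis using degree_es by simp
qed

text \<open>Every class has a representative with some coordinate equal to \<open>1\<close>.\<close>
lemma card_vs: "finite vs \<and> int (card vs) \<le> 4 * q ^ 3"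
proof -
  define R where "R = {0..<q}"
  have cR: "card R = nat q" "finite R" using q by (simp_all add: R_def)
  define T :: "quat set" where "T = ({1} \<times> R \<times> R \<times> R \<union> R \<times> {1} \<times> R \<times> R) \<union> (R \<times> R \<times> {1} \<times> R \<union> R \<times> R \<times> R \<times> {1})"
  have finT: "finite T" using cR by (simp add: T_def)
  have "card T \<le> card ({1} \<times> R \<times> R \<times> R \<union> R \<times> {1} \<times> R \<times> R) + card (R \<times> R \<times> {1} \<times> R \<union> R \<times> R \<times> R \<times> {1 :: int})"
    unfolding T_def by (rule card_Un_le)
  also have "\<dots> \<le> (card ({1::int} \<times> R \<times> R \<times> R) + card (R \<times> {1::int} \<times> R \<times> R)) + (card (R \<times> R \<times> {1::int} \<times> R) + card (R \<times> R \<times> R \<times> {1 :: int}))"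
    by (intro add_mono card_Un_le)
  also have "\<dots> = 4 * nat q ^ 3" by (simp add: card_cartesian_product cR power3_eq_cube)
  finally have cT: "card T \<le> 4 * nat q ^ 3" .
  have "vs \<subseteq> cls ` T"
  proof
    fix v assume "v \<in> vs"
    then obtain w where w: "v = cls w" "\<not> q dvd qnorm w" by (auto simp: vs_def)
    obtain a b c d where abcd: "w = (a, b, c, d)" by (cases w)
    have rep: "v \<in> cls ` T" if "t \<in> {a, b, c, d}" "\<not> q dvd t" for t
    proof -
      obtain u where u: "\<not> q dvd u" "[u * t = 1] (mod q)" using inverse_mod[OF \<open>\<not> q dvd t\<close>] .
      let ?y = "((u * a) mod q, (u * b) mod q, (u * c) mod q, (u * d) mod q)"
      have "qcong q (qscale u w) ?y" by (simp add: abcd cong_def)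
      then have "proj_eq w ?y" using u(1) by (auto simp: proj_eq_def)
      then have "v = cls ?y" using w(1) by (simp add: cls_eq)
      moreover have "(u * t) mod q = 1" using u(2) q by (simp add: cong_def)
      then have "?y \<in> T" using that(1) q by (auto simp: T_def R_def)
      ultimately show ?thesis by blast
    qed
    have "\<not> (q dvd a \<and> q dvd b \<and> q dvd c \<and> q dvd d)"
      using w(2) by (auto simp: abcd power2_eq_square)
    then show "v \<in> cls ` T" using rep by blast
  qed
  then have "finite vs" "card vs \<le> card (cls ` T)" using finT by (auto intro: finite_subset card_mono)
  moreover have "card (cls ` T) \<le> card T" using finT by (rule card_image_le)
  ultimately have f: "finite vs" "card vs \<le> 4 * nat q ^ 3" using cT by linarith+
  have "int (card vs) \<le> int (4 * nat q ^ 3)" using f(2) by (simp only: of_nat_le_iff)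
  then show ?thesis using f(1) q by simp
qed

lemma vs_nonempty: "vs \<noteq> {}"
proof -
  have "\<not> q dvd qnorm (1, 0, 0, 0)" using q by simp
  then show ?thesis unfolding vs_def by blast
qed

text \<open>The projection of the double cover.\<close>

definition val :: "nat + nat \<Rightarrow> nat" where "val = case_sum id id"

text \<open>A leafless set of edges of the double cover contains a cycle. Its vertices alternate
  between the two sides, so its length is even, and following it spells a reduced word of that
  length which returns to its start; \<open>closed_word_long\<close> then applies.\<close>

lemma girth_es:
  assumes F: "F \<subseteq> es" "F \<noteq> {}"
    and leafless: "\<And>a b. (a, b) \<in> F \<Longrightarrow> (\<exists>b'. b' \<noteq> b \<and> (a, b') \<in> F) \<and> (\<exists>a'. a' \<noteq> a \<and> (a', b) \<in> F)"
  shows "q^4 < 2 ^ (card F + 4)"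
proof -
  let ?e = "\<lambda>(a, b). {Inl a, Inr b} :: (nat + nat) set"
  define EF where "EF = ?e ` F"
  define VF where "VF = Inl ` vs \<union> (Inr ` vs :: (nat + nat) set)"
  have finvs: "finite vs" using card_vs by simp
  have finF: "finite F" using F(1) es_subset finvs by (meson finite_SigmaI finite_subset)
  have GF: "graph VF EF"
    unfolding graph_def
  proof (intro conjI ballI)
    show "finite VF" using finvs by (simp add: VF_def)
    fix e assume "e \<in> EF"
    then obtain a b where "(a, b) \<in> F" "e = {Inl a, Inr b}" by (auto simp: EF_def)
    then show "\<exists>u v. e = {u, v} \<and> u \<noteq> v \<and> u \<in> VF \<and> v \<in> VF"
      using F(1) es_subset by (intro exI[of _ "Inl a"] exI[of _ "Inr b"]) (auto simp: VF_def)
  qed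
  have "inj_on ?e F" by (auto simp: inj_on_def doubleton_eq_iff)
  then have cEF: "card EF = card F" by (simp add: EF_def card_image)
  have finEF: "finite EF" using finF by (simp add: EF_def)
  have deg2: "2 \<le> degree EF v" if vE: "v \<in> \<Union>EF" for v
  proof -
    obtain a b where ab: "(a, b) \<in> F" "v = Inl a \<or> v = Inr b" using vE by (auto simp: EF_def)
    obtain a' b' where ab': "b' \<noteq> b" "(a, b') \<in> F" "a' \<noteq> a" "(a', b) \<in> F" using leafless[OF ab(1)] by blast
    have "\<exists>e e'. e \<noteq> e' \<and> {e, e'} \<subseteq> {e\<in>EF. v \<in> e}"
    proof (cases "v = Inl a")
      case True
      then show ?thesis using ab ab' by (intro exI[of _ "?e (a, b)"] exI[of _ "?e (a, b')"])
        (auto simp: EF_def doubleton_eq_iff)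
    next
      case False
      then show ?thesis using ab ab' by (intro exI[of _ "?e (a, b)"] exI[of _ "?e (a', b)"])
        (auto simp: EF_def doubleton_eq_iff)
    qed
    then obtain e e' where ee: "e \<noteq> e'" "{e, e'} \<subseteq> {e\<in>EF. v \<in> e}" by blast
    have "card {e, e'} \<le> degree EF v" unfolding degree_def using ee(2) finEF by (intro card_mono) auto
    then show ?thesis using ee(1) by simp
  qed
  have GU: "graph (\<Union>EF) EF" by (rule graph_Union_edges[OF GF])
  have "2 * card (\<Union>EF) = (\<Sum>v\<in>\<Union>EF. 2)" by simp
  also have "\<dots> \<le> (\<Sum>v\<in>\<Union>EF. degree EF v)" by (rule sum_mono) (rule deg2)
  also have "\<dots> = 2 * card EF" by (rule handshake[OF GU])
  finally have "card (\<Union>EF) \<le> card EF" by simp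
  moreover have "EF \<noteq> {}" using F(2) by (simp add: EF_def)
  ultimately obtain l where l: "l \<le> card F" "has_cycle_len (\<Union>EF) EF l"
    using cyclic_has_cycle[OF GF] cEF by metis
  then obtain xs where xs: "length xs = l" "3 \<le> l" "distinct xs"
    "\<And>i. i < l \<Longrightarrow> {xs ! i, xs ! ((i + 1) mod l)} \<in> EF"
    unfolding has_cycle_len_def by (elim exE conjE) (rule that, auto)
  define y where "y i = xs ! (i mod l)" for i
  have l0: "l > 0" using xs(2) by simp
  have edge: "{y i, y (Suc i)} \<in> EF" for i
    using xs(4)[of "i mod l"] l0 by (simp add: y_def mod_Suc_eq)
  have es_edge: "(val u, val v) \<in> es \<and> isl u \<noteq> isl v" if e: "{u, v} \<in> EF" for u v
  proof -
    obtain a b where ab: "(a, b) \<in> F" "{u, v} = {Inl a, Inr b}" using e by (auto simp: EF_def)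
    then consider "u = Inl a" "v = Inr b" | "u = Inr b" "v = Inl a" by (auto simp: doubleton_eq_iff)
    then show ?thesis by cases (use ab(1) F(1) es_sym in \<open>auto simp: val_def\<close>)
  qed
  have side: "isl (y i) = (isl (y 0) = even i)" for i
  proof (induction i)
    case (Suc i)
    have "isl (y i) \<noteq> isl (y (Suc i))" using es_edge[OF edge[of i]] by blast
    then show ?case using Suc by auto
  qed simp
  have "y l = y 0" using l0 by (simp add: y_def)
  with side[of l] have "isl (y 0) = (isl (y 0) = even l)" by simp
  then have "even l" by blast
  then obtain s where s: "l = 2 * s" by blast
  \<comment> \<open>Vertices two apart on the cycle are distinct and on the same side, so forgetting
    the side keeps them distinct: the walk does not turn back.\<close>
  have y2: "val (y (Suc (Suc i))) \<noteq> val (y i)" for i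
  proof
    assume "val (y (Suc (Suc i))) = val (y i)"
    moreover have "isl (y (Suc (Suc i))) = isl (y i)" using side[of "Suc (Suc i)"] side[of i] by simp
    ultimately have "y (Suc (Suc i)) = y i"
      by (cases "y (Suc (Suc i))"; cases "y i") (auto simp: val_def)
    then have "Suc (Suc i) mod l = i mod l"
      using xs(1,3) l0 by (simp add: y_def nth_eq_iff_index_eq)
    then have "l dvd Suc (Suc i) - i" using mod_eq_dvd_iff_nat[of i "Suc (Suc i)" l] by simp
    then have "l dvd 2" by simp
    then show False using xs(2) dvd_imp_le[of l 2] by simp
  qed
  have "val (y 0) \<in> vs" using es_edge[OF edge[of 0]] es_subset by auto
  then obtain x where x: "\<not> q dvd qnorm x" "val (y 0) = cls x" by (auto simp: vs_def)
  \<comment> \<open>The last conjunct records that repeating the last letter leads back, so that the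
    next letter differs from it.\<close>
  have walk: "\<exists>i w. reduced_word (Suc m) i w \<and> val (y (Suc m)) = cls (qmul x w) \<and>
      val (y m) = cls (qmul (qmul x w) (qgen i))" for m
  proof (induction m)
    case 0
    have "(cls x, val (y 1)) \<in> es" using es_edge[OF edge[of 0]] x by simp
    then obtain i where i: "i < 3" "val (y 1) = cls (qmul x (qgen i))" using es_from by blast
    then show ?case
      using single[OF i(1)] x by (intro exI[of _ i] exI[of _ "qgen i"]) (simp add: cls_gen_gen)
  next
    case (Suc m)
    then obtain i w where w: "reduced_word (Suc m) i w" "val (y (Suc m)) = cls (qmul x w)"
      "val (y m) = cls (qmul (qmul x w) (qgen i))" by blast
    have "(cls (qmul x w), val (y (Suc (Suc m)))) \<in> es" using es_edge[OF edge[of "Suc m"]] w(2) by simp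
    then obtain j where j: "j < 3" "val (y (Suc (Suc m))) = cls (qmul (qmul x w) (qgen j))"
      using es_from by blast
    have "j \<noteq> i" using y2[of m] j(2) w(3) by auto
    then have "reduced_word (Suc (Suc m)) j (qmul w (qgen j))" using snoc w(1) j(1) by blast
    then show ?case
      using j w by (intro exI[of _ j] exI[of _ "qmul w (qgen j)"]) (simp add: cls_gen_gen flip: qmul_assoc)
  qed
  obtain i w where w: "reduced_word l i w" "val (y l) = cls (qmul x w)"
    using walk[of "l - 1"] l0 by auto
  have "q^2 < 2 ^ (s + 2)"
    by (rule closed_word_long[OF _ x(1)]) (use w s x(2) \<open>y l = y 0\<close> in auto)
  then have "(q^2)^2 < (2 ^ (s + 2))^2" by (intro power_strict_mono) auto
  also have "(2 ^ (s + 2) :: int)^2 = 2 ^ ((s + 2) * 2)" by (rule power_mult[symmetric])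
  also have "(s + 2) * 2 = l + 4" by (simp add: s)
  also have "(2::int) ^ (l + 4) \<le> 2 ^ (card F + 4)" using l(1) by (intro power_increasing) auto
  finally show ?thesis by (simp flip: power_mult)
qed

text \<open>Both sides of the double cover are copies of \<open>vs\<close> with at most
  \<open>4 * q ^ 3\<close> elements each, hence the 8.\<close>

lemma lower_bound:
  assumes p: "p \<ge> 2" and k: "8 * q ^ 3 < int k * (int k - 3)"
    and g: "\<And>n. q^4 < 2 ^ (n + 4) \<Longrightarrow> g \<le> n"
  shows "ereal (real ((p - 1) * g)) \<le> gKp k p"
proof -
  have "0 < q ^ 3" using q by simp
  then have "0 < int k * (int k - 3)" using k by linarith
  then have k3: "k > 3" by (simp add: zero_less_mult_iff)
  interpret cubic_subdivision vs vs es "p - 1"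
    by unfold_locales (use card_vs es_subset degree_es degree_es' vs_nonempty p in auto)
  have "int (card vs + card vs) < int (k * (k - 3))"
    using card_vs k k3 by (simp add: of_nat_diff)
  then have "card vs + card vs < k * (k - 3)" by (simp only: of_nat_less_iff)
  from no_large_minor[OF this] have "\<not> has_complete_minor k SV SE" .
  moreover have "girth_ge SV SE ((p - 1) * g)"
    by (rule girth_S) (rule g, rule girth_es, auto)
  moreover have "\<not> p_path_degenerate p SV SE" using not_degenerate p by simp
  ultimately show ?thesis unfolding gKp_def using graph_S by (intro Sup_upper) blast
qed

end

theorem gKp_lower_bound:
  "\<exists>K::nat set. infinite K \<and> (\<forall>k\<in>K. \<forall>p::nat. p \<ge> 2 \<longrightarrow>
     gKp k p \<ge> ereal ((8 / 3 * log 2 (real k) - 12) * (real p - 1)))"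
proof -
  \<comment> \<open>The factor 3 makes \<open>k * (k - 3)\<close> at least 9 r^3, above the 8 r^3
    that bound the number of branch vertices.\<close>
  define \<kappa> :: "nat \<Rightarrow> nat" where "\<kappa> r = nat \<lceil>3 * real r powr (3/2)\<rceil> + 3" for r
  define K where "K = \<kappa> ` {r. prime r \<and> r > 2}"
  have kge: "3 * real r powr (3/2) + 3 \<le> real (\<kappa> r)" for r
    unfolding \<kappa>_def by simp
  have "infinite K"
  proof
    assume "finite K"
    then obtain m where m: "\<And>x. x \<in> K \<Longrightarrow> x \<le> m" by (meson finite_nat_set_iff_bounded_le)
    obtain r where r: "prime r" "r > m + 2" using bigger_prime by blast
    have "real r powr 1 \<le> real r powr (3/2)" using r by (intro powr_mono) auto
    then have "real r \<le> real (\<kappa> r)" using kge[of r] r by simp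
    moreover have "\<kappa> r \<le> m" using m r by (auto simp: K_def)
    ultimately show False using r by linarith
  qed
  moreover have "ereal ((8 / 3 * log 2 (real k) - 12) * (real p - 1)) \<le> gKp k p"
    if kK: "k \<in> K" and p: "p \<ge> 2" for k p
  proof -
    obtain r where r: "prime r" "r > 2" "k = \<kappa> r" using kK by (auto simp: K_def)
    interpret quat_mod "int r" by unfold_locales (use r in auto)
    define u where "u = real r powr (3/2)"
    have u1: "u \<ge> 1" unfolding u_def using r by (intro ge_one_powr_ge_zero) auto
    have uu: "u * u = real r ^ 3" unfolding u_def using r by (simp flip: powr_add add: powr_numeral)
    have k1: "3 * u + 3 \<le> real k" using kge[of r] r(3) by (simp add: u_def)
    have k2: "real k \<le> 3 * u + 4" unfolding r(3) \<kappa>_def u_def[symmetric] using u1 by (simp add: of_nat_nat) linarith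
    have "0 < real r ^ 3" using r by simp
    then have "8 * real r ^ 3 < 9 * (u * u)" unfolding uu by simp
    also have "\<dots> = (3 * u) * (3 * u)" by simp
    also have "\<dots> \<le> real k * (real k - 3)" using k1 u1 by (intro mult_mono) auto
    finally have "real_of_int (8 * int r ^ 3) < real_of_int (int k * (int k - 3))" by simp
    then have kk: "8 * int r ^ 3 < int k * (int k - 3)" by (simp only: of_int_less_iff)
    define g where "g = nat \<lceil>4 * log 2 (real r) - 4\<rceil>"
    have g: "g \<le> n" if n: "int r ^ 4 < 2 ^ (n + 4)" for n
    proof -
      have "real_of_int (int r ^ 4) < real_of_int (2 ^ (n + 4))" using n by (simp only: of_int_less_iff)
      then have "real r ^ 4 < 2 ^ (n + 4)" by simp
      then have "log 2 (real r ^ 4) < log 2 (2 ^ (n + 4))" using r by (subst log_less_cancel_iff) auto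
      then have "4 * log 2 (real r) < real n + 4" using r by (simp add: log_nat_power)
      then show ?thesis unfolding g_def by linarith
    qed
    \<comment> \<open>Here k \<le> 3 u + 4 \<le> 8 u, so (8/3) log k is at most 8 + 4 log r; with
      the 4 lost in the girth this gives 12.\<close>
    have "log 2 (real k) \<le> log 2 (8 * u)" using k2 u1 k1 by (subst log_le_cancel_iff) auto
    also have "\<dots> = 3 + 3/2 * log 2 (real r)"
    proof -
      have "log 2 (8::real) = 3" using log_pow_cancel[of 2 3] by simp
      then show ?thesis using u1 r by (simp add: log_mult u_def log_powr)
    qed
    finally have "8 / 3 * log 2 (real k) - 12 \<le> 4 * log 2 (real r) - 4" by simp
    also have "\<dots> \<le> real g" unfolding g_def by linarith
    finally have "(8 / 3 * log 2 (real k) - 12) * (real p - 1) \<le> real g * (real p - 1)"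
      using p by (intro mult_right_mono) auto
    also have "\<dots> = real ((p - 1) * g)" using p by (simp add: of_nat_diff mult.commute)
    finally have "ereal ((8 / 3 * log 2 (real k) - 12) * (real p - 1)) \<le> ereal (real ((p - 1) * g))" by simp
    also have "\<dots> \<le> gKp k p" by (rule lower_bound[OF p kk g])
    finally show ?thesis .
  qed
  ultimately show ?thesis by blast
qed

theorem mainTheorem9:
  shows "(\<exists>C::real. \<forall>k p :: nat. k \<ge> 5 \<longrightarrow> p \<ge> 2 \<longrightarrow>
            gKp k p < ereal ((4 * log 2 (real k) + 2 * log 2 (log 2 (real k)) + C) * (real p - 1)))
       \<and> (\<exists>(c::real) (K::nat set). infinite K \<and> (\<forall>k\<in>K. \<forall>p::nat. p \<ge> 2 \<longrightarrow>
            gKp k p \<ge> ereal ((8 / 3 * log 2 (real k) + c) * (real p - 1))))"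
proof (intro conjI)
  show "\<exists>C::real. \<forall>k p :: nat. k \<ge> 5 \<longrightarrow> p \<ge> 2 \<longrightarrow>
      gKp k p < ereal ((4 * log 2 (real k) + 2 * log 2 (log 2 (real k)) + C) * (real p - 1))"
    using gKp_upper_bound by blast
  obtain K :: "nat set" where "infinite K" "\<forall>k\<in>K. \<forall>p::nat. p \<ge> 2 \<longrightarrow>
      gKp k p \<ge> ereal ((8 / 3 * log 2 (real k) + (- 12)) * (real p - 1))"
    using gKp_lower_bound by auto
  then show "\<exists>(c::real) (K::nat set). infinite K \<and> (\<forall>k\<in>K. \<forall>p::nat. p \<ge> 2 \<longrightarrow>
      gKp k p \<ge> ereal ((8 / 3 * log 2 (real k) + c) * (real p - 1)))" by blast
qed

end
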